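(* $\mathcal L_{\mathsf{Eq}}\preceq_{exp}\mathcal L_{\mathsf{Canco}}\preceq_{exp}\mathcal L_{\mathsf{Hasco}}\preceq_{exp}\mathcal L_{\mathsf{Eq}}$, where for logics $\mathcal L_1,\mathcal L_2$ the relation $\mathcal L_1\preceq_{exp}\mathcal L_2$ means that for every closed formula $\phi\in\mathcal L_1$ there exists a closed formula $\phi'\in\mathcal L_2$ such that for every $TCCS^m$ process $P$, $P$ satisfies $\phi$ (in $\mathcal L_1$) if and only if $P$ satisfies $\phi'$ (in $\mathcal L_2$).
   Context: LANGUAGE. $\mathsf{Act}$ is an infinite set of actions with CCS complementation ($\bar{\bar a}=a$); $\tau\notin\mathsf{Act}$; $\mu$ ranges over $\mathsf{Act}\cup\{\tau\}$. Transaction names: $\mathsf{TrN}=\mathsf{inTrN}\uplus\mathsf{exTrN}$ (internal and external names, both infinite). Terms: $P,Q::=\sum_{i\in J}\mu_i.P_i$ ($J$ countable; $\mathbf 0$ is the empty sum) $\mid P\mid Q\mid\nu a.P\mid X\mid\mathrm{rec}X.P\mid[\![P\triangleright_kQ]\!]$ (running transaction named $k$) $\mid\mathrm{co}\mid[\![P\blacktriangleright Q]\!]$ (dormant transaction). $ftn(o)$ is the set of transaction names in $o$; $o\,\sharp\,o'$ means no transaction name of $o$ occurs in $o'$. A process is a well-formed term: (1) it is closed (no free process variables); (2) $ftn$ of it is finite; and for all subterms $[\![P_1\triangleright_kP_1']\!]$, $[\![P_2\blacktriangleright P_2']\!]$, $\sum\mu_i.Q_i$, $\mathrm{rec}X.R$: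 (3) $P_1,P_1',P_2,P_2',Q_i,R$ contain no transaction names; (4) $P_1,P_2,Q_i$ contain no dormant transactions; (5) $P_1,P_2$ are closed. PROCESS TRANSITIONS. $P\xrightarrow{\alpha}_\sigma Q$ with $\alpha\in\{a,\tau,k(\tau),k(a)\}$ and $\sigma$ a name substitution $\tilde k\mapsto l$ (domain the finite tuple $\tilde k$, possibly empty, range $\{l\}$; $\varepsilon$ alone is the empty substitution). Rules (symmetric ones omitted): - $\sum\mu_i.P_i\xrightarrow{\mu_j}_\varepsilon P_j$; - if $P\xrightarrow{a}_\varepsilon P'$ and $Q\xrightarrow{\bar a}_\varepsilon Q'$ then $P\mid Q\xrightarrow{\tau}_\varepsilon P'\mid Q'$; - $\mathrm{rec}X.P\xrightarrow{\tau}_\varepsilon P[\mathrm{rec}X.P/X]$; - if $\mu_j=a$ then $\sum\mu_i.P_i\xrightarrow{k(a)}_{\varepsilon\mapsto k}[\![P_j\mid\mathrm{co}\triangleright_k\sum\mu_i.P_i]\!]$; - if $P\xrightarrow{\mu}_\varepsilon P'$ and $k\,\sharp\,l$ then $[\![P\triangleright_lQ]\!]\xrightarrow{k(\mu)}_{l\mapsto k}[\![P'\triangleright_kQ]\!]$; - if $P\xrightarrow{k(a)}_{\sigma_1}P'$, $Q\xrightarrow{k(\bar a)}_{\sigma_2}Q'$, $\sigma_i=\tilde l_i\mapsto k$, then $P\mid Q\xrightarrow{k(\tau)}_{(\tilde l_1,\tilde l_2)\mapsto k}P'\sigma_2\mid Q'\sigma_1$; - if $P\xrightarrow{\alpha}_\sigma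 P'$ and $range(\sigma)\,\sharp\,Q$ then $P\mid Q\xrightarrow{\alpha}_\sigma P'\mid Q\sigma$; - if $P\xrightarrow{\alpha}_\sigma P'$ and $a$ does not occur in $\alpha$ then $\nu a.P\xrightarrow{\alpha}_\sigma\nu a.P'$. Reconfiguration transitions $P\xrightarrow{\beta}Q$, $\beta\in\{\mathrm{co}\,k,\mathrm{ab}\,k,\mathrm{new}\,k\}$ (symmetric rules omitted): - if $P\equiv\mathrm{co}\mid P''$ for some $P''$ and $P\rightsquigarrow_{\mathrm{co}}P'$ then $[\![P\triangleright_kQ]\!]\xrightarrow{\mathrm{co}\,k}P'$; - $[\![P\blacktriangleright Q]\!]\xrightarrow{\mathrm{new}\,k}[\![P\triangleright_kQ]\!]$; - $[\![P\triangleright_kQ]\!]\xrightarrow{\mathrm{ab}\,k}Q$; - for $\beta=\mathrm{co}\,k$ or $\mathrm{ab}\,k$: if $P\xrightarrow{\beta}P'$ and $Q\xrightarrow{\beta}Q'$ then $P\mid Q\xrightarrow{\beta}P'\mid Q'$; - if $P\xrightarrow{\beta}P'$ and $\beta\,\sharp\,Q$ then $P\mid Q\xrightarrow{\beta}P'\mid Q$; - if $P\xrightarrow{\beta}P'$ then $\nu a.P\xrightarrow{\beta}\nu a.P'$. Here $\equiv$ is standard CCS structural equivalence extended to transactions, and $\rightsquigarrow_{\mathrm{co}}$ is given by: $\mathrm{co}\rightsquigarrow_{\mathrm{co}}\mathbf 0$; sums, variables, $\mathrm{rec}X.P$ and $[\![P\blacktriangleright Q]\!]$ are related to themselves; it is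 compatible with $\nu a.-$ and $-\mid-$. EXTENDED CONFIGURATIONS. $I$ is a countable index set. An extended configuration is $\langle E;H\bullet P\rangle$ with $P$ a process, $E$ an equivalence relation over a finite subset of $\mathsf{TrN}$, and $H$ a finite partial function from $I$ to $\{k(a),k(\mathrm{ab}),k(\mathrm{co})\mid k\in\mathsf{exTrN},a\in\mathsf{Act}\}$. Let $H^{\mathrm{trn}}(i)$ be the name used in $H(i)$, $H^{\mathrm{trn}}$ the set of all these, and $\mathrm{Hasco}(H)=\{k\mid\exists i.\,H(i)=k(\mathrm{co})\}$. It is required that: (i) $H^{\mathrm{trn}}(i)=H^{\mathrm{trn}}(j)$ implies $i=j$; (ii) for $k\in\mathsf{exTrN}$, $k\,E\,k$ iff $k\in H^{\mathrm{trn}}$, and $k\,E\,k'$ implies ($k\in\mathrm{Hasco}(H)$ iff $k'\in\mathrm{Hasco}(H)$); (iii) $ftn(P)\cap\mathrm{Hasco}(H)=\emptyset$; (iv) $k\,E\,k'$ and $k,k'\in ftn(P)$ imply $k=k'$. Convention: external names of a configuration are those in its history, i.e. $ftn(P)\cap\mathsf{exTrN}\subseteq H^{\mathrm{trn}}$; in particular a process $P$ viewed as $\langle\emptyset;\varepsilon\bullet P\rangle$ ($\varepsilon$ the empty history) has $ftn(P)\subseteq\mathsf{inTrN}$. "$H,k(a)$" denotes $H$ extended at a new index. For $\sigma=\tilde k\mapsto l$, $\sigma(E)$ is the smallest equivalence relation $F\supseteq E$ with $l\,F\,l$ and $k\,F\,l$ for all $k\in dom(\sigma)$. $(E;H)\setminus_{\mathrm{co}}k$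 (resp. $\setminus_{\mathrm{ab}}k$) keeps $E$ and, for every $k'\,E\,k$, changes each $k'(a)$ in $H$ to $k'(\mathrm{co})$ (resp. $k'(\mathrm{ab})$). With $\Delta=E;H$, the extended transitions between extended configurations are: - $\langle\Delta\bullet P\rangle\xrightarrow{\tau}_e\langle\Delta\bullet Q\rangle$ if $P\xrightarrow{\tau}_\varepsilon Q$; - $\xrightarrow{\tau}_e\langle\sigma(E);H\bullet Q\rangle$ if $P\xrightarrow{k(\tau)}_\sigma Q$, $k\,\sharp\,E,H$, $k\in\mathsf{inTrN}$; - $\xrightarrow{\tau}_e\langle\Delta\bullet Q\rangle$ if $P\xrightarrow{\mathrm{new}\,k}Q$, $k\,\sharp\,\Delta$, $k\in\mathsf{inTrN}$; - $\xrightarrow{\tau}_e\langle\Delta\setminus_{\mathrm{co}}k\bullet Q\rangle$ if $P\xrightarrow{\mathrm{co}\,k}Q$; - $\xrightarrow{\tau}_e\langle\Delta\setminus_{\mathrm{ab}}k\bullet Q\rangle$ if $P\xrightarrow{\mathrm{ab}\,k}Q$; - $\xrightarrow{k(a)}_e\langle\sigma(E);H,k(a)\bullet Q\rangle$ if $P\xrightarrow{k(a)}_\sigma Q$, $k\,\sharp\,E,H$, $k\in\mathsf{exTrN}$; - $\xrightarrow{k(a)}_e\langle E,(k,k);H,k(\mathrm{ab})\bullet P\rangle$ if $k\,\sharp\,E,H,P$, $k\in\mathsf{exTrN}$. The commit-sensitive transitions $\xrightarrow{\zeta}_c$ are given by the same rules (with $_c$ for $_e$), except that the commit rule is replaced,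 with $E_{ext}(k)=\{k'\in\mathsf{exTrN}\mid k\,E\,k'\}$, by: $\langle\Delta\bullet P\rangle\xrightarrow{\mathrm{co}(E_{ext}(k))}_c\langle\Delta\setminus_{\mathrm{co}}k\bullet Q\rangle$ if $P\xrightarrow{\mathrm{co}\,k}Q$ and $E_{ext}(k)\neq\emptyset$; and $\langle\Delta\bullet P\rangle\xrightarrow{\tau}_c\langle\Delta\setminus_{\mathrm{co}}k\bullet Q\rangle$ if $P\xrightarrow{\mathrm{co}\,k}Q$ and $E_{ext}(k)=\emptyset$. For $s\in\{e,c\}$, $\stackrel{\tau}{\Rightarrow}_s$ is $(\xrightarrow{\tau}_s)^*$ and $\stackrel{\zeta}{\Rightarrow}_s$ is $\stackrel{\tau}{\Rightarrow}_s\xrightarrow{\zeta}_s\stackrel{\tau}{\Rightarrow}_s$ otherwise. LOGICS. $\mathsf{Var}$ is a countable set of variables disjoint from $\mathsf{exTrN}$. All three logics have formulae $\langle\tau\rangle\phi$, $\langle x(a)\rangle\phi$ ($x\in\mathsf{Var}$, bound in $\phi$; $a\in\mathsf{Act}$), $\neg\phi$, $\bigwedge_{i\in M}\phi_i$ ($M$ an arbitrary index set), plus: in $\mathcal L_{\mathsf{Hasco}}$, $\mathtt{Hasco}(v)$; in $\mathcal L_{\mathsf{Eq}}$, $v_1=_{\mathrm{co}}v_2$; in $\mathcal L_{\mathsf{Canco}}$, $\langle\mathrm{co}(K)\rangle\phi$ with $\emptyset\neq K\subseteq\mathsf{exTrN}\uplus\mathsf{Var}$; here $v,v_1,v_2\in\mathsf{exTrN}\cup\mathsf{Var}$.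 Closed formulae have no free variables. Satisfaction of closed formulae by extended configurations, with $s=e$ for $\mathcal L_{\mathsf{Hasco}},\mathcal L_{\mathsf{Eq}}$ and $s=c$ for $\mathcal L_{\mathsf{Canco}}$: $\mathcal C\models\langle\tau\rangle\phi$ iff $\mathcal C\stackrel{\tau}{\Rightarrow}_s\mathcal C'\models\phi$ for some $\mathcal C'$; $\mathcal C\models\langle x(a)\rangle\phi$ iff there is a cofinite $N\subseteq\mathsf{exTrN}$ such that for all $l\in N$ there is $\mathcal C'$ with $\mathcal C\stackrel{l(a)}{\Rightarrow}_s\mathcal C'$ and $\mathcal C'\models\phi[l/x]$; conjunction and negation are standard; and, for $\mathcal C=\langle E;H\bullet P\rangle$: $\mathcal C\models\mathtt{Hasco}(k)$ iff $k\in\mathrm{Hasco}(H)$; $\mathcal C\models k=_{\mathrm{co}}k'$ iff $k,k'\in\mathrm{Hasco}(H)$ and $k\,E\,k'$; $\mathcal C\models\langle\mathrm{co}(K)\rangle\phi$ iff $\mathcal C\stackrel{\mathrm{co}(K)}{\Rightarrow}_c\mathcal C'\models\phi$ for some $\mathcal C'$. A process $P$ satisfies $\phi$ iff $\langle\emptyset;\varepsilon\bullet P\rangle\models\phi$. *)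

theory Defs
  imports "HOL-Library.Infinite_Typeclass" "HOL-Combinatorics.Transposition"
begin

section \<open>Actions, transaction names and terms\<close>

text \<open>\<open>'n\<close> is the type of channel names; an action is a channel or a co-channel, as in CCS.\<close>

datatype (act_chans: 'n) act = Chan 'n | CoChan 'n

primrec bar :: "'n act \<Rightarrow> 'n act" where
  "bar (Chan a) = CoChan a"
| "bar (CoChan a) = Chan a"

datatype (pre_chans: 'n) pre = Tau | Vis "'n act"

datatype ('i, 'x) trn = InT 'i | ExT 'x

text \<open>
  \<open>Choice f\<close> is the sum of the prefixed terms \<open>f i\<close>, \<open>i \<in> dom f\<close>: the countable index sets are the
  sets of natural numbers. \<open>Run P k Q\<close> is the transaction named \<open>k\<close> running \<open>P\<close> with alternative \<open>Q\<close>,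
  and \<open>Dorm P Q\<close> the dormant one. \<open>Res a P\<close> restricts both actions of the channel \<open>a\<close>.
  \<open>ftn P\<close> is the set of all transaction names in \<open>P\<close> (these have no binders).
\<close>

datatype (tm_chans: 'n, ftn: 'k) tm =
    Choice "nat \<rightharpoonup> 'n pre \<times> ('n, 'k) tm"
  | Par "('n, 'k) tm" "('n, 'k) tm"
  | Res 'n "('n, 'k) tm"
  | PVar nat
  | Rec nat "('n, 'k) tm"
  | Run "('n, 'k) tm" 'k "('n, 'k) tm"
  | Co
  | Dorm "('n, 'k) tm" "('n, 'k) tm"
  for map: map_tm

abbreviation Nil0 :: "('n, 'k) tm" where
  "Nil0 \<equiv> Choice Map.empty"

primrec fpv :: "('n, 'k) tm \<Rightarrow> nat set" where
  "fpv (Choice f) = (\<Union>(\<mu>, A) \<in> ran (\<lambda>i. map_option (map_prod id fpv) (f i)). A)"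
| "fpv (Par P Q) = fpv P \<union> fpv Q"
| "fpv (Res a P) = fpv P"
| "fpv (PVar X) = {X}"
| "fpv (Rec X P) = fpv P - {X}"
| "fpv (Run P k Q) = fpv P \<union> fpv Q"
| "fpv Co = {}"
| "fpv (Dorm P Q) = fpv P \<union> fpv Q"

primrec pvars :: "('n, 'k) tm \<Rightarrow> nat set" where
  "pvars (Choice f) = (\<Union>(\<mu>, A) \<in> ran (\<lambda>i. map_option (map_prod id pvars) (f i)). A)"
| "pvars (Par P Q) = pvars P \<union> pvars Q"
| "pvars (Res a P) = pvars P"
| "pvars (PVar X) = {X}"
| "pvars (Rec X P) = insert X (pvars P)"
| "pvars (Run P k Q) = pvars P \<union> pvars Q"
| "pvars Co = {}"
| "pvars (Dorm P Q) = pvars P \<union> pvars Q"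

primrec fch :: "('n, 'k) tm \<Rightarrow> 'n set" where
  "fch (Choice f) = (\<Union>(\<mu>, A) \<in> ran (\<lambda>i. map_option (map_prod id fch) (f i)). pre_chans \<mu> \<union> A)"
| "fch (Par P Q) = fch P \<union> fch Q"
| "fch (Res a P) = fch P - {a}"
| "fch (PVar X) = {}"
| "fch (Rec X P) = fch P"
| "fch (Run P k Q) = fch P \<union> fch Q"
| "fch Co = {}"
| "fch (Dorm P Q) = fch P \<union> fch Q"

text \<open>
  \<open>subst_ren P \<rho> X R\<close> simultaneously renames the free channels of \<open>P\<close> by \<open>\<rho>\<close> and replaces the free
  occurrences of \<open>X\<close> by \<open>R\<close>, where a restricted channel is renamed if it would capture a free channel.
  If every channel is to be avoided there is no suitable name, and the bound channel is left alone.
  Free process variables of \<open>R\<close> are not protected: below, \<open>R\<close> is closed or a variable that does not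
  occur in \<open>P\<close>.
\<close>

primrec subst_ren :: "('n, 'k) tm \<Rightarrow> ('n \<Rightarrow> 'n) \<Rightarrow> nat \<Rightarrow> ('n, 'k) tm \<Rightarrow> ('n, 'k) tm" where
  "subst_ren (Choice f) \<rho> X R =
     Choice (\<lambda>i. map_option (map_prod (map_pre \<rho>) (\<lambda>P. subst_ren P \<rho> X R)) (f i))"
| "subst_ren (Par P Q) \<rho> X R = Par (subst_ren P \<rho> X R) (subst_ren Q \<rho> X R)"
| "subst_ren (Res a P) \<rho> X R =
     (let S = \<rho> ` (fch P - {a}) \<union> (if X \<in> fpv P then fch R else {});
          b = (if a \<notin> S \<or> S = UNIV then a else SOME b. b \<notin> S)
      in Res b (subst_ren P (\<rho>(a := b)) X R))"
| "subst_ren (PVar Y) \<rho> X R = (if Y = X then R else PVar Y)"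
| "subst_ren (Rec Y P) \<rho> X R =
     Rec Y (if Y = X then subst_ren P \<rho> Y (PVar Y) else subst_ren P \<rho> X R)"
| "subst_ren (Run P k Q) \<rho> X R = Run (subst_ren P \<rho> X R) k (subst_ren Q \<rho> X R)"
| "subst_ren Co \<rho> X R = Co"
| "subst_ren (Dorm P Q) \<rho> X R = Dorm (subst_ren P \<rho> X R) (subst_ren Q \<rho> X R)"

definition subst_tm :: "('n, 'k) tm \<Rightarrow> nat \<Rightarrow> ('n, 'k) tm \<Rightarrow> ('n, 'k) tm" where
  "subst_tm P X R = subst_ren P id X R"

inductive subterm :: "('n, 'k) tm \<Rightarrow> ('n, 'k) tm \<Rightarrow> bool" where
  "subterm P P"
| "f i = Some (\<mu>, P) \<Longrightarrow> subterm R P \<Longrightarrow> subterm R (Choice f)"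
| "subterm R P \<or> subterm R Q \<Longrightarrow> subterm R (Par P Q)"
| "subterm R P \<Longrightarrow> subterm R (Res a P)"
| "subterm R P \<Longrightarrow> subterm R (Rec X P)"
| "subterm R P \<or> subterm R Q \<Longrightarrow> subterm R (Run P k Q)"
| "subterm R P \<or> subterm R Q \<Longrightarrow> subterm R (Dorm P Q)"

definition no_dormant :: "('n, 'k) tm \<Rightarrow> bool" where
  "no_dormant P \<longleftrightarrow> (\<forall>A B. \<not> subterm (Dorm A B) P)"

definition process :: "('n, 'k) tm \<Rightarrow> bool" where
  "process P \<longleftrightarrow>
     fpv P = {} \<and> finite (ftn P) \<and>
     (\<forall>P1 k P1'. subterm (Run P1 k P1') P \<longrightarrow>
        ftn P1 = {} \<and> ftn P1' = {} \<and> no_dormant P1 \<and> fpv P1 = {}) \<and>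
     (\<forall>P2 P2'. subterm (Dorm P2 P2') P \<longrightarrow>
        ftn P2 = {} \<and> ftn P2' = {} \<and> no_dormant P2 \<and> fpv P2 = {}) \<and>
     (\<forall>f i \<mu> Q. subterm (Choice f) P \<and> f i = Some (\<mu>, Q) \<longrightarrow> ftn Q = {} \<and> no_dormant Q) \<and>
     (\<forall>X R. subterm (Rec X R) P \<longrightarrow> ftn R = {})"


section \<open>Process transitions\<close>

text \<open>\<open>Ren ks l\<close> is the substitution \<open>ks \<mapsto> l\<close>; its range is \<open>{l}\<close> even when \<open>ks\<close> is empty.\<close>

datatype 'k sub = Eps | Ren "'k list" 'k

primrec sub_range :: "'k sub \<Rightarrow> 'k set" where
  "sub_range Eps = {}"
| "sub_range (Ren ks l) = {l}"

primrec sub_fun :: "'k sub \<Rightarrow> 'k \<Rightarrow> 'k" where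
  "sub_fun Eps k = k"
| "sub_fun (Ren ks l) k = (if k \<in> set ks then l else k)"

definition app_sub :: "('n, 'k) tm \<Rightarrow> 'k sub \<Rightarrow> ('n, 'k) tm" where
  "app_sub P \<sigma> = map_tm id (sub_fun \<sigma>) P"

text \<open>\<open>Plain \<mu>\<close> is \<open>a\<close> or \<open>\<tau>\<close>; \<open>Tr k \<mu>\<close> is \<open>k(a)\<close> or \<open>k(\<tau>)\<close>.\<close>

datatype (lab_chans: 'n, lab_trns: 'k) lab = Plain "'n pre" | Tr 'k "'n pre"

inductive step :: "('n, 'k) tm \<Rightarrow> ('n, 'k) lab \<Rightarrow> 'k sub \<Rightarrow> ('n, 'k) tm \<Rightarrow> bool" where
  sum: "f j = Some (\<mu>, P) \<Longrightarrow> step (Choice f) (Plain \<mu>) Eps P"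
| com: "step P (Plain (Vis a)) Eps P' \<Longrightarrow> step Q (Plain (Vis (bar a))) Eps Q' \<Longrightarrow>
     step (Par P Q) (Plain Tau) Eps (Par P' Q')"
| rec: "step (Rec X P) (Plain Tau) Eps (subst_tm P X (Rec X P))"
| tr_sum: "f j = Some (Vis a, P) \<Longrightarrow>
     step (Choice f) (Tr k (Vis a)) (Ren [] k) (Run (Par P Co) k (Choice f))"
| tr_run: "step P (Plain \<mu>) Eps P' \<Longrightarrow> k \<noteq> l \<Longrightarrow>
     step (Run P l Q) (Tr k \<mu>) (Ren [l] k) (Run P' k Q)"
| tr_com: "step P (Tr k (Vis a)) (Ren ls1 k) P' \<Longrightarrow> step Q (Tr k (Vis (bar a))) (Ren ls2 k) Q' \<Longrightarrow>
     step (Par P Q) (Tr k Tau) (Ren (ls1 @ ls2) k)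
       (Par (app_sub P' (Ren ls2 k)) (app_sub Q' (Ren ls1 k)))"
| par_left: "step P \<alpha> \<sigma> P' \<Longrightarrow> sub_range \<sigma> \<inter> ftn Q = {} \<Longrightarrow>
     step (Par P Q) \<alpha> \<sigma> (Par P' (app_sub Q \<sigma>))"
| par_right: "step Q \<alpha> \<sigma> Q' \<Longrightarrow> sub_range \<sigma> \<inter> ftn P = {} \<Longrightarrow>
     step (Par P Q) \<alpha> \<sigma> (Par (app_sub P \<sigma>) Q')"
| res: "step P \<alpha> \<sigma> P' \<Longrightarrow> a \<notin> lab_chans \<alpha> \<Longrightarrow> step (Res a P) \<alpha> \<sigma> (Res a P')"


section \<open>Structural congruence and reconfiguration\<close>

text \<open>
  Recursion unfolding is not a structural law, since it is a \<open>\<tau>\<close>-transition. Rule \<open>choice\<close> combines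
  congruence of sums with reindexing.
\<close>

inductive scong :: "('n, 'k) tm \<Rightarrow> ('n, 'k) tm \<Rightarrow> bool" (infix "\<equiv>\<^sub>s" 50) where
  refl: "P \<equiv>\<^sub>s P"
| sym: "P \<equiv>\<^sub>s Q \<Longrightarrow> Q \<equiv>\<^sub>s P"
| trans: "P \<equiv>\<^sub>s Q \<Longrightarrow> Q \<equiv>\<^sub>s R \<Longrightarrow> P \<equiv>\<^sub>s R"
| choice: "bij_betw h (dom f) (dom g) \<Longrightarrow>
     (\<And>i \<mu> P. f i = Some (\<mu>, P) \<Longrightarrow> \<exists>Q. g (h i) = Some (\<mu>, Q) \<and> P \<equiv>\<^sub>s Q) \<Longrightarrow>
     Choice f \<equiv>\<^sub>s Choice g"
| par: "P \<equiv>\<^sub>s P' \<Longrightarrow> Q \<equiv>\<^sub>s Q' \<Longrightarrow> Par P Q \<equiv>\<^sub>s Par P' Q'"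
| res: "P \<equiv>\<^sub>s P' \<Longrightarrow> Res a P \<equiv>\<^sub>s Res a P'"
| rec: "P \<equiv>\<^sub>s P' \<Longrightarrow> Rec X P \<equiv>\<^sub>s Rec X P'"
| run: "P \<equiv>\<^sub>s P' \<Longrightarrow> Q \<equiv>\<^sub>s Q' \<Longrightarrow> Run P k Q \<equiv>\<^sub>s Run P' k Q'"
| dorm: "P \<equiv>\<^sub>s P' \<Longrightarrow> Q \<equiv>\<^sub>s Q' \<Longrightarrow> Dorm P Q \<equiv>\<^sub>s Dorm P' Q'"
| par_comm: "Par P Q \<equiv>\<^sub>s Par Q P"
| par_assoc: "Par (Par P Q) R \<equiv>\<^sub>s Par P (Par Q R)"
| par_nil: "Par P Nil0 \<equiv>\<^sub>s P"
| res_nil: "Res a Nil0 \<equiv>\<^sub>s Nil0"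
| res_comm: "Res a (Res b P) \<equiv>\<^sub>s Res b (Res a P)"
| res_par: "a \<notin> fch P \<Longrightarrow> Res a (Par P Q) \<equiv>\<^sub>s Par P (Res a Q)"
| alpha_res: "b \<notin> fch P \<Longrightarrow> Res a P \<equiv>\<^sub>s Res b (map_tm (transpose a b) id P)"
| alpha_rec: "Y \<notin> pvars P \<Longrightarrow> Rec X P \<equiv>\<^sub>s Rec Y (subst_tm P X (PVar Y))"

inductive co_red :: "('n, 'k) tm \<Rightarrow> ('n, 'k) tm \<Rightarrow> bool" (infix "\<leadsto>\<^sub>c\<^sub>o" 50) where
  "Co \<leadsto>\<^sub>c\<^sub>o Nil0"
| "Choice f \<leadsto>\<^sub>c\<^sub>o Choice f"
| "PVar X \<leadsto>\<^sub>c\<^sub>o PVar X"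
| "Rec X P \<leadsto>\<^sub>c\<^sub>o Rec X P"
| "Dorm P Q \<leadsto>\<^sub>c\<^sub>o Dorm P Q"
| "P \<leadsto>\<^sub>c\<^sub>o P' \<Longrightarrow> Res a P \<leadsto>\<^sub>c\<^sub>o Res a P'"
| "P \<leadsto>\<^sub>c\<^sub>o P' \<Longrightarrow> Q \<leadsto>\<^sub>c\<^sub>o Q' \<Longrightarrow> Par P Q \<leadsto>\<^sub>c\<^sub>o Par P' Q'"

datatype (rlab_trns: 'k) rlab = Commit 'k | Abort 'k | New 'k

inductive reconf :: "('n, 'k) tm \<Rightarrow> 'k rlab \<Rightarrow> ('n, 'k) tm \<Rightarrow> bool" where
  commit: "P \<equiv>\<^sub>s Par Co P'' \<Longrightarrow> P \<leadsto>\<^sub>c\<^sub>o P' \<Longrightarrow> reconf (Run P k Q) (Commit k) P'"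
| new: "reconf (Dorm P Q) (New k) (Run P k Q)"
| abort: "reconf (Run P k Q) (Abort k) Q"
| par_both: "\<beta> = Commit k \<or> \<beta> = Abort k \<Longrightarrow> reconf P \<beta> P' \<Longrightarrow> reconf Q \<beta> Q' \<Longrightarrow>
     reconf (Par P Q) \<beta> (Par P' Q')"
| par_left: "reconf P \<beta> P' \<Longrightarrow> rlab_trns \<beta> \<inter> ftn Q = {} \<Longrightarrow> reconf (Par P Q) \<beta> (Par P' Q)"
| par_right: "reconf Q \<beta> Q' \<Longrightarrow> rlab_trns \<beta> \<inter> ftn P = {} \<Longrightarrow> reconf (Par P Q) \<beta> (Par P Q')"
| res: "reconf P \<beta> P' \<Longrightarrow> reconf (Res a P) \<beta> (Res a P')"


section \<open>Extended configurations\<close>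

datatype ('n, 'x) hist_entry = HAct 'x "'n act" | HAb 'x | HCo 'x

primrec entry_trn :: "('n, 'x) hist_entry \<Rightarrow> 'x" where
  "entry_trn (HAct k a) = k"
| "entry_trn (HAb k) = k"
| "entry_trn (HCo k) = k"

type_synonym ('n, 'x) hist = "nat \<rightharpoonup> ('n, 'x) hist_entry"

definition htrn :: "('n, 'x) hist \<Rightarrow> 'x set" where
  "htrn H = entry_trn ` ran H"

definition hasco :: "('n, 'x) hist \<Rightarrow> 'x set" where
  "hasco H = {k. HCo k \<in> ran H}"

type_synonym ('n, 'i, 'x) conf =
  "('i, 'x) trn rel \<times> ('n, 'x) hist \<times> ('n, ('i, 'x) trn) tm"

text \<open>The last conjunct is the convention that the external names of the process occur in the history.\<close>

fun ext_conf :: "('n, 'i, 'x) conf \<Rightarrow> bool" where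
  "ext_conf (E, H, P) \<longleftrightarrow>
     process P \<and> equiv (Field E) E \<and> finite (Field E) \<and> finite (dom H) \<and>
     (\<forall>i j u v. H i = Some u \<and> H j = Some v \<and> entry_trn u = entry_trn v \<longrightarrow> i = j) \<and>
     (\<forall>k. (ExT k, ExT k) \<in> E \<longleftrightarrow> k \<in> htrn H) \<and>
     (\<forall>k k'. (ExT k, ExT k') \<in> E \<longrightarrow> (k \<in> hasco H \<longleftrightarrow> k' \<in> hasco H)) \<and>
     ftn P \<inter> ExT ` hasco H = {} \<and>
     (\<forall>k k'. (k, k') \<in> E \<and> k \<in> ftn P \<and> k' \<in> ftn P \<longrightarrow> k = k') \<and>
     ftn P \<inter> range ExT \<subseteq> ExT ` htrn H"

definition init_conf :: "('n, ('i, 'x) trn) tm \<Rightarrow> ('n, 'i, 'x) conf" where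
  "init_conf P = ({}, Map.empty, P)"

primrec sub_rel :: "'k sub \<Rightarrow> 'k rel \<Rightarrow> 'k rel" where
  "sub_rel Eps E = E"
| "sub_rel (Ren ks l) E =
     \<Inter> {F. equiv (Field F) F \<and> E \<subseteq> F \<and> (l, l) \<in> F \<and> (\<forall>k \<in> set ks. (k, l) \<in> F)}"

definition mark ::
  "('x \<Rightarrow> ('n, 'x) hist_entry) \<Rightarrow> ('i, 'x) trn rel \<Rightarrow> ('i, 'x) trn \<Rightarrow> ('n, 'x) hist \<Rightarrow> ('n, 'x) hist"
where
  "mark c E k H = (\<lambda>i. case H i of
       Some (HAct k' a) \<Rightarrow> Some (if (ExT k', k) \<in> E then c k' else HAct k' a)
     | u \<Rightarrow> u)"

definition fresh_trn :: "('i, 'x) trn \<Rightarrow> ('i, 'x) trn rel \<Rightarrow> ('n, 'x) hist \<Rightarrow> bool" where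
  "fresh_trn k E H \<longleftrightarrow> k \<notin> Field E \<and> k \<notin> ExT ` htrn H"

definition ext_class :: "('i, 'x) trn rel \<Rightarrow> ('i, 'x) trn \<Rightarrow> 'x set" where
  "ext_class E k = {k'. (k, ExT k') \<in> E}"

datatype ('n, 'x) xlab = XTau | XAct 'x "'n act" | XCo "'x set"

datatype mode = Ext | ComSens

text \<open>
  \<open>xstep Ext\<close> are the extended transitions and \<open>xstep ComSens\<close> the commit-sensitive ones. The rules
  are not guarded by \<open>ext_conf\<close>. Unfolding may put a dormant transaction under a
  prefix, as in \<open>rec X. (a.X | D)\<close> with \<open>D\<close> dormant, which \<open>process\<close> excludes; such steps are kept.
\<close>

inductive xstep :: "mode \<Rightarrow> ('n, 'i, 'x) conf \<Rightarrow> ('n, 'x) xlab \<Rightarrow> ('n, 'i, 'x) conf \<Rightarrow> bool"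
  for s :: mode where
  tau: "step P (Plain Tau) Eps Q \<Longrightarrow> xstep s (E, H, P) XTau (E, H, Q)"
| tr_tau: "step P (Tr (InT k) Tau) \<sigma> Q \<Longrightarrow> fresh_trn (InT k) E H \<Longrightarrow>
     xstep s (E, H, P) XTau (sub_rel \<sigma> E, H, Q)"
| new: "reconf P (New (InT k)) Q \<Longrightarrow> fresh_trn (InT k) E H \<Longrightarrow>
     xstep s (E, H, P) XTau (E, H, Q)"
| commit: "s = Ext \<Longrightarrow> reconf P (Commit k) Q \<Longrightarrow>
     xstep s (E, H, P) XTau (E, mark HCo E k H, Q)"
| commit_ext: "s = ComSens \<Longrightarrow> reconf P (Commit k) Q \<Longrightarrow> ext_class E k \<noteq> {} \<Longrightarrow>
     xstep s (E, H, P) (XCo (ext_class E k)) (E, mark HCo E k H, Q)"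
| commit_int: "s = ComSens \<Longrightarrow> reconf P (Commit k) Q \<Longrightarrow> ext_class E k = {} \<Longrightarrow>
     xstep s (E, H, P) XTau (E, mark HCo E k H, Q)"
| abort: "reconf P (Abort k) Q \<Longrightarrow>
     xstep s (E, H, P) XTau (E, mark HAb E k H, Q)"
| act: "step P (Tr (ExT k) (Vis a)) \<sigma> Q \<Longrightarrow> fresh_trn (ExT k) E H \<Longrightarrow> i \<notin> dom H \<Longrightarrow>
     xstep s (E, H, P) (XAct k a) (sub_rel \<sigma> E, H(i \<mapsto> HAct k a), Q)"
| act_ab: "fresh_trn (ExT k) E H \<Longrightarrow> ExT k \<notin> ftn P \<Longrightarrow> i \<notin> dom H \<Longrightarrow>
     xstep s (E, H, P) (XAct k a) (insert (ExT k, ExT k) E, H(i \<mapsto> HAb k), P)"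

definition xtaus :: "mode \<Rightarrow> ('n, 'i, 'x) conf \<Rightarrow> ('n, 'i, 'x) conf \<Rightarrow> bool" where
  "xtaus s = (\<lambda>C C'. xstep s C XTau C')\<^sup>*\<^sup>*"

definition xweak :: "mode \<Rightarrow> ('n, 'i, 'x) conf \<Rightarrow> ('n, 'x) xlab \<Rightarrow> ('n, 'i, 'x) conf \<Rightarrow> bool" where
  "xweak s C \<zeta> C' \<longleftrightarrow>
     (if \<zeta> = XTau then xtaus s C C'
      else \<exists>C1 C2. xtaus s C C1 \<and> xstep s C1 \<zeta> C2 \<and> xtaus s C2 C')"


section \<open>The logics\<close>

text \<open>\<open>Vr x\<close> is a variable and \<open>Nm k\<close> a literal external transaction name.\<close>

datatype 'x nv = Nm 'x | Vr nat

text \<open>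
  The formulae of all three logics. \<open>Conj M f\<close> is the conjunction of the \<open>f i\<close> for \<open>i \<in> M\<close>, where
  \<open>M\<close> is a set over an arbitrary type \<open>'m\<close> of indices: there is no type of all index sets, but any
  family of index sets fits in a large enough \<open>'m\<close>. Statements about all three logics should only
  require that \<open>'m\<close> is large enough to form conjunctions over all transaction names.
\<close>

datatype ('n, 'x, 'm) form =
    DiaTau "('n, 'x, 'm) form"
  | DiaAct nat "'n act" "('n, 'x, 'm) form"
  | Neg "('n, 'x, 'm) form"
  | Conj "'m set" "'m \<Rightarrow> ('n, 'x, 'm) form"
  | HasCo "'x nv"
  | EqCo "'x nv" "'x nv"
  | DiaCo "'x nv set" "('n, 'x, 'm) form"

datatype logic_id = Hasco | Eq | Canco

inductive formula :: "logic_id \<Rightarrow> ('n, 'x, 'm) form \<Rightarrow> bool" for L :: logic_id where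
  "formula L \<phi> \<Longrightarrow> formula L (DiaTau \<phi>)"
| "formula L \<phi> \<Longrightarrow> formula L (DiaAct x a \<phi>)"
| "formula L \<phi> \<Longrightarrow> formula L (Neg \<phi>)"
| "(\<And>i. i \<in> M \<Longrightarrow> formula L (f i)) \<Longrightarrow> formula L (Conj M f)"
| "L = Hasco \<Longrightarrow> formula L (HasCo v)"
| "L = Eq \<Longrightarrow> formula L (EqCo v w)"
| "L = Canco \<Longrightarrow> K \<noteq> {} \<Longrightarrow> formula L \<phi> \<Longrightarrow> formula L (DiaCo K \<phi>)"

primrec fvars :: "('n, 'x, 'm) form \<Rightarrow> nat set" where
  "fvars (DiaTau \<phi>) = fvars \<phi>"
| "fvars (DiaAct x a \<phi>) = fvars \<phi> - {x}"
| "fvars (Neg \<phi>) = fvars \<phi>"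
| "fvars (Conj M f) = (\<Union>i\<in>M. fvars (f i))"
| "fvars (HasCo v) = {x. v = Vr x}"
| "fvars (EqCo v w) = {x. v = Vr x \<or> w = Vr x}"
| "fvars (DiaCo K \<phi>) = {x. Vr x \<in> K} \<union> fvars \<phi>"

definition inst_nv :: "nat \<Rightarrow> 'x \<Rightarrow> 'x nv \<Rightarrow> 'x nv" where
  "inst_nv x l v = (if v = Vr x then Nm l else v)"

primrec inst :: "nat \<Rightarrow> 'x \<Rightarrow> ('n, 'x, 'm) form \<Rightarrow> ('n, 'x, 'm) form" where
  "inst x l (DiaTau \<phi>) = DiaTau (inst x l \<phi>)"
| "inst x l (DiaAct y a \<phi>) = DiaAct y a (if y = x then \<phi> else inst x l \<phi>)"
| "inst x l (Neg \<phi>) = Neg (inst x l \<phi>)"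
| "inst x l (Conj M f) = Conj M (\<lambda>i. inst x l (f i))"
| "inst x l (HasCo v) = HasCo (inst_nv x l v)"
| "inst x l (EqCo v w) = EqCo (inst_nv x l v) (inst_nv x l w)"
| "inst x l (DiaCo K \<phi>) = DiaCo (inst_nv x l ` K) (inst x l \<phi>)"

text \<open>
  Satisfaction recurses on instances of subformulae, so termination is shown on formulae with their
  names and variables erased.
\<close>

primrec erase :: "('n, 'x, 'm) form \<Rightarrow> ('n, 'x, 'm) form" where
  "erase (DiaTau \<phi>) = DiaTau (erase \<phi>)"
| "erase (DiaAct x a \<phi>) = DiaAct 0 a (erase \<phi>)"
| "erase (Neg \<phi>) = Neg (erase \<phi>)"
| "erase (Conj M f) = Conj M (\<lambda>i. erase (f i))"
| "erase (HasCo v) = HasCo (Vr 0)"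
| "erase (EqCo v w) = EqCo (Vr 0) (Vr 0)"
| "erase (DiaCo K \<phi>) = DiaCo {} (erase \<phi>)"

lemma erase_inst [simp]: "erase (inst x l \<phi>) = erase \<phi>"
  by (induction \<phi>) auto

inductive_set isub :: "(('n, 'x, 'm) form \<times> ('n, 'x, 'm) form) set" where
  "(\<phi>, DiaTau \<phi>) \<in> isub"
| "(\<phi>, DiaAct x a \<phi>) \<in> isub"
| "(\<phi>, Neg \<phi>) \<in> isub"
| "(f i, Conj M f) \<in> isub"
| "(\<phi>, DiaCo K \<phi>) \<in> isub"

lemma wf_isub: "wf isub"
proof (rule wfUNIVI)
  fix Q :: "('n, 'x, 'm) form \<Rightarrow> bool" and \<psi> :: "('n, 'x, 'm) form"
  assume *: "\<forall>\<phi>. (\<forall>\<theta>. (\<theta>, \<phi>) \<in> isub \<longrightarrow> Q \<theta>) \<longrightarrow> Q \<phi>"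
  show "Q \<psi>"
    by (induction \<psi>) (rule *[rule_format], erule isub.cases; auto)+
qed

function sat :: "mode \<Rightarrow> ('n, 'i, 'x) conf \<Rightarrow> ('n, 'x, 'm) form \<Rightarrow> bool" where
  "sat s C (DiaTau \<phi>) \<longleftrightarrow> (\<exists>C'. xweak s C XTau C' \<and> sat s C' \<phi>)"
| "sat s C (DiaAct x a \<phi>) \<longleftrightarrow>
     (\<exists>N. finite (- N) \<and> (\<forall>l\<in>N. \<exists>C'. xweak s C (XAct l a) C' \<and> sat s C' (inst x l \<phi>)))"
| "sat s C (Neg \<phi>) \<longleftrightarrow> \<not> sat s C \<phi>"
| "sat s C (Conj M f) \<longleftrightarrow> (\<forall>i\<in>M. sat s C (f i))"
| "sat s (E, H, P) (HasCo v) \<longleftrightarrow> (\<exists>k. v = Nm k \<and> k \<in> hasco H)"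
| "sat s (E, H, P) (EqCo v w) \<longleftrightarrow>
     (\<exists>k k'. v = Nm k \<and> w = Nm k' \<and> k \<in> hasco H \<and> k' \<in> hasco H \<and> (ExT k, ExT k') \<in> E)"
| "sat s C (DiaCo K \<phi>) \<longleftrightarrow>
     (\<exists>L C'. K = Nm ` L \<and> xweak s C (XCo L) C' \<and> sat s C' \<phi>)"
  by pat_completeness auto
termination
  by (relation "inv_image isub (\<lambda>(s, C, \<phi>). erase \<phi>)")
     (auto intro: wf_isub isub.intros)

primrec logic_mode :: "logic_id \<Rightarrow> mode" where
  "logic_mode Hasco = Ext"
| "logic_mode Eq = Ext"
| "logic_mode Canco = ComSens"

text \<open>A logic is given by its closed formulae and the satisfaction relation between processes and formulae.\<close>

type_synonym ('n, 'i, 'x, 'm) logic =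
  "('n, 'x, 'm) form set \<times> (('n, ('i, 'x) trn) tm \<Rightarrow> ('n, 'x, 'm) form \<Rightarrow> bool)"

definition logic_of :: "logic_id \<Rightarrow> ('n, 'i, 'x, 'm) logic" where
  "logic_of L = ({\<phi>. formula L \<phi> \<and> fvars \<phi> = {}}, \<lambda>P. sat (logic_mode L) (init_conf P))"

abbreviation L_Hasco :: "('n, 'i, 'x, 'm) logic" where "L_Hasco \<equiv> logic_of Hasco"
abbreviation L_Eq :: "('n, 'i, 'x, 'm) logic" where "L_Eq \<equiv> logic_of Eq"
abbreviation L_Canco :: "('n, 'i, 'x, 'm) logic" where "L_Canco \<equiv> logic_of Canco"

text \<open>
  The processes are the \<open>P\<close> for which \<open>init_conf P\<close> is an extended configuration, that is,
  the well-formed terms without external transaction names.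
\<close>

definition exp_le :: "('n, 'i, 'x, 'm) logic \<Rightarrow> ('n, 'i, 'x, 'm) logic \<Rightarrow> bool"
  (infix "\<preceq>\<^sub>e\<^sub>x\<^sub>p" 50) where
  "L1 \<preceq>\<^sub>e\<^sub>x\<^sub>p L2 \<longleftrightarrow>
     (\<forall>\<phi> \<in> fst L1. \<exists>\<phi>' \<in> fst L2. \<forall>P. ext_conf (init_conf P) \<longrightarrow> (snd L1 P \<phi> \<longleftrightarrow> snd L2 P \<phi>'))"

end

theory Submission
  imports Defs "HOL-Library.Countable_Set"
begin

text \<open>
  Extended and commit-sensitive transitions differ only in the labels of commits, so everything
  depends on recovering commits from what a logic can observe. Along every run the classes of
  committed names are disjoint and frozen. Hence an equality \<open>v =\<^sub>c\<^sub>o w\<close> is decided by the labels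
  \<open>co(K)\<close> met on the way, and a \<open>\<tau>\<close>-modality of \<open>\<L>\<^sub>E\<^sub>q\<close> is a countable disjunction over sequences
  of such labels. Conversely, \<open>\<langle>co(K)\<rangle>\<phi>\<close> says that a configuration with the same committed names is
  reached from which the committed names can grow by \<open>K\<close>, but not by a proper nonempty part of \<open>K\<close>.

  Formulae may mention arbitrarily many literal names, which may coincide with the names introduced
  later by \<open>\<langle>x(a)\<rangle>\<close>. The translation therefore depends on the concrete names \<open>l\<close> in the history,
  but yields formulae in which these names occur only through variables: since such formulae are
  invariant under permutations of names, a statement about one fresh \<open>l\<close> is a formula
  \<open>\<langle>x(a)\<rangle>\<phi>\<^sub>l\<close>, and \<open>\<langle>x(a)\<rangle>\<phi>\<close> becomes the disjunction over cofinite sets \<open>N\<close> of the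
  conjunctions of the \<open>\<langle>x(a)\<rangle>\<phi>\<^sub>l\<close> for \<open>l \<in> N\<close>.
\<close>

section \<open>Transaction names under transitions\<close>

text \<open>The generated set function passes through the range of \<open>f\<close>, options and
  pairs; later proofs need only the branches.\<close>

lemma ftn_Choice: "ftn (Choice f) = \<Union>{ftn Q |i \<mu> Q. f i = Some (\<mu>, Q)}"
proof -
  have "ftn (Choice f) = (\<Union>x\<in>range f. \<Union>y\<in>set_option x. \<Union>z\<in>{snd y}. ftn z)"
    by (auto simp: prod_set_defs)
  also have "\<dots> = \<Union>{ftn Q |i \<mu> Q. f i = Some (\<mu>, Q)}"
    by (force simp: image_iff set_eq_iff)
  finally show ?thesis .
qed

text \<open>Of well-formedness, only the placement of transaction names is kept: they name running
  transactions that are reached through parallel compositions and restrictions alone. Unlike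
  \<open>process\<close>, this survives every transition, also an unfolding that puts a dormant
  transaction under a prefix.\<close>

primrec flat :: "('n, 'k) tm \<Rightarrow> bool" where
  "flat (Choice f) \<longleftrightarrow> ftn (Choice f) = {}"
| "flat (Par P Q) \<longleftrightarrow> flat P \<and> flat Q"
| "flat (Res a P) \<longleftrightarrow> flat P"
| "flat (PVar X) \<longleftrightarrow> True"
| "flat (Rec X P) \<longleftrightarrow> ftn P = {}"
| "flat (Run P k Q) \<longleftrightarrow> ftn P = {} \<and> ftn Q = {}"
| "flat Co \<longleftrightarrow> True"
| "flat (Dorm P Q) \<longleftrightarrow> ftn P = {} \<and> ftn Q = {}"

lemma flat_if_no_names: "ftn P = {} \<Longrightarrow> flat P"
  by (induction P) auto

lemma flat_if_process:
  assumes "process P"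
  shows "flat P"
proof -
  have "(\<And>P1 k P1'. subterm (Run P1 k P1') P \<Longrightarrow> ftn P1 = {} \<and> ftn P1' = {}) \<Longrightarrow>
     (\<And>P2 P2'. subterm (Dorm P2 P2') P \<Longrightarrow> ftn P2 = {} \<and> ftn P2' = {}) \<Longrightarrow>
     (\<And>f i \<mu> Q. subterm (Choice f) P \<Longrightarrow> f i = Some (\<mu>, Q) \<Longrightarrow> ftn Q = {}) \<Longrightarrow>
     (\<And>X R. subterm (Rec X R) P \<Longrightarrow> ftn R = {}) \<Longrightarrow> flat P"
  proof (induction P)
    case (Choice f)
    from Choice.prems(3)[OF subterm.intros(1)] show ?case
      by (auto simp: ftn_Choice simp del: tm.set)
  next
    case (Par P Q)
    from Par.prems have "flat P" by (intro Par.IH(1)) (blast intro: subterm.intros)+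
    moreover from Par.prems have "flat Q" by (intro Par.IH(2)) (blast intro: subterm.intros)+
    ultimately show ?case by simp
  next
    case (Res a P)
    from Res.prems have "flat P" by (intro Res.IH) (blast intro: subterm.intros)+
    then show ?case by simp
  next
    case (Rec X P)
    from Rec.prems(4)[OF subterm.intros(1)] show ?case by simp
  next
    case (Run P k Q)
    from Run.prems(1)[OF subterm.intros(1)] show ?case by simp
  next
    case (Dorm P Q)
    from Dorm.prems(2)[OF subterm.intros(1)] show ?case by simp
  qed simp_all
  then show ?thesis using assms unfolding process_def by blast
qed

lemma ftn_subst_ren: "ftn (subst_ren P \<rho> X R) \<subseteq> ftn P \<union> ftn R"
proof (induction P arbitrary: \<rho> X R)
  case (Choice f)
  have "ftn (subst_ren Q \<rho> X R) \<subseteq> ftn (Choice f) \<union> ftn R" if "f i = Some (\<mu>, Q)" for i \<mu> Q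
  proof -
    have "ftn (subst_ren Q \<rho> X R) \<subseteq> ftn Q \<union> ftn R"
      using that by (intro Choice[of "f i" "(\<mu>, Q)"]) (auto intro: range_eqI[of _ _ i])
    moreover have "ftn Q \<subseteq> ftn (Choice f)"
      using that unfolding ftn_Choice by blast
    ultimately show ?thesis by blast
  qed
  then show ?case
    unfolding subst_ren.simps ftn_Choice[of "\<lambda>i. map_option _ (f i)"] by (auto simp del: tm.set)
next
  case (Rec Y P)
  have "ftn (subst_ren P \<rho> Y (PVar Y)) \<subseteq> ftn P" "ftn (subst_ren P \<rho> X R) \<subseteq> ftn P \<union> ftn R"
    using Rec[of \<rho> Y "PVar Y"] Rec[of \<rho> X R] by auto
  then show ?case by auto
next
  case (Res a P)
  then show ?case by (simp add: Let_def)
qed (auto; blast)+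

lemma ftn_app_sub: "ftn (app_sub P \<sigma>) = sub_fun \<sigma> ` ftn P"
  by (simp add: app_sub_def tm.set_map)

lemma ftn_app_sub_Ren: "ftn (app_sub P (Ren ks l)) \<subseteq> insert l (ftn P - set ks)"
  by (auto simp: ftn_app_sub)

lemma flat_map_tm: "flat P \<Longrightarrow> flat (map_tm id g P)"
proof (induction P)
  case (Choice f)
  from Choice.prems have "ftn (map_tm id g (Choice f)) = {}"
    by (simp only: flat.simps tm.set_map image_empty)
  then show ?case by (rule flat_if_no_names)
qed (auto simp: tm.set_map)

lemma flat_app_sub: "flat P \<Longrightarrow> flat (app_sub P \<sigma>)"
  unfolding app_sub_def by (rule flat_map_tm)

lemma app_sub_Eps [simp]: "app_sub P Eps = P"
proof -
  have "sub_fun (Eps :: 'b sub) = id" by (rule ext) simp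
  then show ?thesis by (simp add: app_sub_def tm.map_id)
qed

text \<open>A transition on \<open>k\<close> replaces the names \<open>ls\<close> of the process by
  the new name \<open>k\<close>. Flatness excludes other sources of names: branches of sums,
  unfolded recursions and bodies of running transactions contribute none, and the side conditions of
  the rules keep \<open>k\<close> out of the source. Parallel components undergo the same
  substitution, so \<open>ls\<close> vanish everywhere.\<close>

lemma step_names:
  assumes "step P \<alpha> \<sigma> Q" "flat P"
  shows "flat Q \<and> (case \<alpha> of
      Plain \<mu> \<Rightarrow> \<sigma> = Eps \<and> ftn Q \<subseteq> ftn P
    | Tr k \<mu> \<Rightarrow> \<exists>ls. \<sigma> = Ren ls k \<and> set ls \<subseteq> ftn P \<and> k \<notin> ftn P \<and> ftn Q \<subseteq> insert k (ftn P - set ls))"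
  using assms
proof (induction rule: step.induct)
  case (sum f j \<mu> P)
  then have "ftn P = {}" unfolding flat.simps ftn_Choice by blast
  then show ?case by (simp add: flat_if_no_names)
next
  case (com P a P' Q Q')
  then show ?case by auto
next
  case (rec X P)
  then have "ftn (subst_tm P X (Rec X P)) = {}"
    using ftn_subst_ren[of P id X "Rec X P"] by (simp add: subst_tm_def)
  then show ?case by (simp add: flat_if_no_names)
next
  case (tr_sum f j a P k)
  then have "ftn P = {}" unfolding flat.simps ftn_Choice by blast
  with tr_sum.prems show ?case by (simp del: tm.set(1) add: tm.set(2-))
next
  case (tr_run P \<mu> P' k l Q)
  then show ?case by (auto simp: flat_if_no_names)
next
  case (tr_com P k a ls1 P' Q ls2 Q')
  then have *: "flat P'" "flat Q'" "set ls1 \<subseteq> ftn P" "k \<notin> ftn P" "ftn P' \<subseteq> insert k (ftn P - set ls1)"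
    "set ls2 \<subseteq> ftn Q" "k \<notin> ftn Q" "ftn Q' \<subseteq> insert k (ftn Q - set ls2)"
    by auto
  then show ?case
    using ftn_app_sub_Ren[of P' ls2 k] ftn_app_sub_Ren[of Q' ls1 k] by (auto simp: flat_app_sub)
next
  case (par_left P \<alpha> \<sigma> P' Q)
  then show ?case
    using ftn_app_sub_Ren[of Q] by (cases \<alpha>) (fastforce simp: flat_app_sub)+
next
  case (par_right Q \<alpha> \<sigma> Q' P)
  then show ?case
    using ftn_app_sub_Ren[of P] by (cases \<alpha>) (fastforce simp: flat_app_sub)+
next
  case (res P \<alpha> \<sigma> P' a)
  then show ?case by (cases \<alpha>) auto
qed

lemma co_red_names: "P \<leadsto>\<^sub>c\<^sub>o Q \<Longrightarrow> ftn Q \<subseteq> ftn P"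
  by (induction rule: co_red.induct) auto

text \<open>A commit or abort of \<open>k\<close> acts on all components containing \<open>k\<close>
  at once, so \<open>k\<close> disappears. What it releases has no names, since the process is
  flat.\<close>

lemma reconf_names:
  assumes "reconf P \<beta> Q" "flat P"
  shows "flat Q \<and> (case \<beta> of
      Commit k \<Rightarrow> k \<in> ftn P \<and> ftn Q \<subseteq> ftn P - {k}
    | Abort k \<Rightarrow> k \<in> ftn P \<and> ftn Q \<subseteq> ftn P - {k}
    | New k \<Rightarrow> ftn Q \<subseteq> insert k (ftn P))"
  using assms
proof (induction rule: reconf.induct)
  case (commit P P'' P' k Q)
  then have "ftn P' = {}" using co_red_names[of P P'] by simp
  then show ?case by (simp add: flat_if_no_names)
next
  case (par_both \<beta> k P P' Q Q')
  then show ?case by auto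
next
  case (par_left P \<beta> P' Q)
  then show ?case by (cases \<beta>) auto
next
  case (par_right Q \<beta> Q' P)
  then show ?case by (cases \<beta>) auto
next
  case (res P \<beta> P' a)
  then show ?case by (cases \<beta>) auto
qed (auto simp: flat_if_no_names)


section \<open>Reachable configurations\<close>

text \<open>Closed form, for an equivalence \<open>E\<close>, of the generated equivalence in
  \<open>sub_rel\<close>: \<open>U\<close> and all classes meeting it become one class.\<close>

definition merge :: "'k rel \<Rightarrow> 'k set \<Rightarrow> 'k rel" where
  "merge E U = E \<union> (U \<union> E `` U) \<times> (U \<union> E `` U)"

lemma sym_merge: "sym E \<Longrightarrow> sym (merge E U)"
  by (auto simp: merge_def sym_def)

lemma trans_merge: "sym E \<Longrightarrow> trans E \<Longrightarrow> trans (merge E U)"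
  unfolding merge_def sym_def by (rule transI) (auto dest: transD)

lemma equiv_Field: "sym E \<Longrightarrow> trans E \<Longrightarrow> equiv (Field E) E"
  by (auto simp: equiv_def refl_on_def Field_def dest: symD transD)

text \<open>The merged relation is one of the relations intersected, and it lies in each of them
  because there every element of the block is related to \<open>k\<close>.\<close>

lemma sub_rel_Ren:
  assumes "sym E" "trans E"
  shows "sub_rel (Ren ls k) E = merge E (insert k (set ls))"
proof
  let ?U = "insert k (set ls)"
  have "equiv (Field (merge E ?U)) (merge E ?U)"
    using assms by (intro equiv_Field sym_merge trans_merge)
  moreover have "E \<subseteq> merge E ?U" "\<And>l. l \<in> ?U \<Longrightarrow> (l, k) \<in> merge E ?U"
    by (auto simp: merge_def)
  ultimately show "sub_rel (Ren ls k) E \<subseteq> merge E ?U"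
    unfolding sub_rel.simps by (intro Inter_lower CollectI conjI ballI) blast+
  show "merge E ?U \<subseteq> sub_rel (Ren ls k) E"
    unfolding sub_rel.simps
  proof (rule Inter_greatest)
    fix F
    assume "F \<in> {F. equiv (Field F) F \<and> E \<subseteq> F \<and> (k, k) \<in> F \<and> (\<forall>l \<in> set ls. (l, k) \<in> F)}"
    then have F: "sym F" "trans F" "E \<subseteq> F" "\<And>l. l \<in> ?U \<Longrightarrow> (l, k) \<in> F"
      by (auto simp: equiv_def)
    have "(l, k) \<in> F" if "l \<in> ?U \<union> E `` ?U" for l
      using that
    proof
      assume "l \<in> E `` ?U"
      then obtain m where m: "m \<in> ?U" "(m, l) \<in> E" by (rule ImageE)
      then have "(l, m) \<in> F" using F(1,3) by (auto dest: symD)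
      then show ?thesis using F(4)[OF m(1)] by (rule transD[OF F(2)])
    qed (rule F(4))
    then have "(l, l') \<in> F" if "l \<in> ?U \<union> E `` ?U" "l' \<in> ?U \<union> E `` ?U" for l l'
      using that symD[OF F(1)] transD[OF F(2)] by metis
    then show "merge E ?U \<subseteq> F"
      using F(3) unfolding merge_def by (intro Un_least) auto
  qed
qed

section \<open>Decided names and marked histories\<close>

definition aborted :: "('n, 'x) hist \<Rightarrow> 'x set" where
  "aborted H = {k. HAb k \<in> ran H}"

abbreviation dead :: "('n, 'x) hist \<Rightarrow> 'x set" where
  "dead H \<equiv> hasco H \<union> aborted H"

lemma htrn_cases:
  assumes "k \<in> htrn H"
  obtains a where "HAct k a \<in> ran H" | "k \<in> dead H"
proof -
  from assms obtain u where "u \<in> ran H" "entry_trn u = k" by (auto simp: htrn_def)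
  then show thesis by (cases u) (auto simp: hasco_def aborted_def intro: that)
qed

lemma dead_subset_htrn: "dead H \<subseteq> htrn H"
  by (force simp: htrn_def hasco_def aborted_def image_iff)

lemma htrn_upd: "i \<notin> dom H \<Longrightarrow> htrn (H(i \<mapsto> u)) = insert (entry_trn u) (htrn H)"
  by (simp add: htrn_def domIff)

lemma hasco_upd_HAct [simp]: "i \<notin> dom H \<Longrightarrow> hasco (H(i \<mapsto> HAct k a)) = hasco H"
  and hasco_upd_HAb [simp]: "i \<notin> dom H \<Longrightarrow> hasco (H(i \<mapsto> HAb k)) = hasco H"
  and aborted_upd_HAct [simp]: "i \<notin> dom H \<Longrightarrow> aborted (H(i \<mapsto> HAct k a)) = aborted H"
  and aborted_upd_HAb [simp]: "i \<notin> dom H \<Longrightarrow> aborted (H(i \<mapsto> HAb k)) = insert k (aborted H)"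
  by (auto simp: hasco_def aborted_def domIff)

text \<open>The names, the committed names and the aborted names of a history are all read from its
  range, so the effect of \<open>mark\<close> matters only there.\<close>

lemma ran_mark:
  "ran (mark c E k H) =
     {u \<in> ran H. \<forall>k' a. u = HAct k' a \<longrightarrow> (ExT k', k) \<notin> E} \<union>
     {c k' |k' a. HAct k' a \<in> ran H \<and> (ExT k', k) \<in> E}" (is "?L = ?R")
proof
  show "?L \<subseteq> ?R"
  proof
    fix u assume "u \<in> ?L"
    then obtain i where i: "mark c E k H i = Some u" by (auto simp: ran_def)
    then obtain v where v: "H i = Some v" by (cases "H i") (auto simp: mark_def)
    then have "v \<in> ran H" by (rule ranI)
    then show "u \<in> ?R"
      using i v by (cases v) (auto simp: mark_def split: if_splits)
  qed
  show "?R \<subseteq> ?L"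
  proof
    fix u assume "u \<in> ?R"
    then consider "u \<in> ran H" "\<forall>k' a. u = HAct k' a \<longrightarrow> (ExT k', k) \<notin> E"
      | k' a where "u = c k'" "HAct k' a \<in> ran H" "(ExT k', k) \<in> E"
      by blast
    then show "u \<in> ?L"
    proof cases
      case 1
      then obtain i where "H i = Some u" by (auto simp: ran_def)
      with 1(2) have "mark c E k H i = Some u" by (cases u) (auto simp: mark_def)
      then show ?thesis by (rule ranI)
    next
      case 2
      then obtain i where "H i = Some (HAct k' a)" by (auto simp: ran_def)
      with 2 have "mark c E k H i = Some u" by (auto simp: mark_def)
      then show ?thesis by (rule ranI)
    qed
  qed
qed

lemma htrn_mark:
  assumes "\<And>k'. entry_trn (c k') = k'"
  shows "htrn (mark c E k H) = htrn H"
proof -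
  have "htrn (mark c E k H) \<subseteq> htrn H"
    using assms unfolding htrn_def ran_mark by force
  moreover have "htrn H \<subseteq> htrn (mark c E k H)"
  proof
    fix x assume "x \<in> htrn H"
    then obtain u where u: "u \<in> ran H" "x = entry_trn u" by (auto simp: htrn_def)
    show "x \<in> htrn (mark c E k H)"
    proof (cases "\<exists>k' a. u = HAct k' a \<and> (ExT k', k) \<in> E")
      case True
      then obtain k' a where "u = HAct k' a" "(ExT k', k) \<in> E" by blast
      with u have "c k' \<in> ran (mark c E k H)" "x = entry_trn (c k')"
        using assms unfolding ran_mark by auto
      then show ?thesis unfolding htrn_def by blast
    next
      case False
      with u(1) have "u \<in> ran (mark c E k H)" unfolding ran_mark by auto
      with u(2) show ?thesis unfolding htrn_def by blast
    qed
  qed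
  ultimately show ?thesis ..
qed

section \<open>The invariant of configurations and the effect of each transition\<close>

lemma ext_class_Un: "x \<notin> U \<Longrightarrow> ext_class (E \<union> U \<times> U) x = ext_class E x"
  by (simp add: ext_class_def)

text \<open>The classes of the committed names. On a commit-sensitive run from an initial
  configuration these are exactly the sets in the commit labels met so far.\<close>

definition groups :: "('i, 'x) trn rel \<Rightarrow> ('n, 'x) hist \<Rightarrow> 'x set set" where
  "groups E H = (\<lambda>k. ext_class E (ExT k)) ` hasco H"

text \<open>
  The conjunct on \<open>dead H\<close>: once a transaction is committed or aborted, its class has no name left
  in the process, so that the class can neither grow nor commit again.
\<close>

fun coherent :: "('n, 'i, 'x) conf \<Rightarrow> bool" where
  "coherent (E, H, P) \<longleftrightarrow> flat P \<and> sym E \<and> trans E \<and>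
     (\<forall>k. (ExT k, ExT k) \<in> E \<longleftrightarrow> k \<in> htrn H) \<and>
     (\<forall>k. ExT k \<in> ftn P \<longrightarrow> k \<in> htrn H) \<and>
     (\<forall>k m. k \<in> dead H \<and> (ExT k, m) \<in> E \<longrightarrow> m \<notin> ftn P) \<and>
     (\<forall>m m'. (m, m') \<in> E \<and> m \<in> ftn P \<and> m' \<in> ftn P \<longrightarrow> m = m') \<and>
     (\<forall>k k'. (ExT k, ExT k') \<in> E \<longrightarrow> k \<in> hasco H \<longrightarrow> k' \<in> hasco H)"

declare coherent.simps [simp del]

lemma coherentD:
  assumes "coherent (E, H, P)"
  shows "flat P" "sym E" "trans E"
    "\<And>k. (ExT k, ExT k) \<in> E \<longleftrightarrow> k \<in> htrn H"
    "\<And>k. ExT k \<in> ftn P \<Longrightarrow> k \<in> htrn H"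
    "\<And>k m. k \<in> dead H \<Longrightarrow> (ExT k, m) \<in> E \<Longrightarrow> m \<notin> ftn P"
    "\<And>m m'. (m, m') \<in> E \<Longrightarrow> m \<in> ftn P \<Longrightarrow> m' \<in> ftn P \<Longrightarrow> m = m'"
    "\<And>k k'. (ExT k, ExT k') \<in> E \<Longrightarrow> k \<in> hasco H \<Longrightarrow> k' \<in> hasco H"
  using assms unfolding coherent.simps by blast+

lemma coherentI:
  assumes "flat P" "sym E" "trans E"
    "\<And>k. (ExT k, ExT k) \<in> E \<longleftrightarrow> k \<in> htrn H"
    "\<And>k. ExT k \<in> ftn P \<Longrightarrow> k \<in> htrn H"
    "\<And>k m. k \<in> dead H \<Longrightarrow> (ExT k, m) \<in> E \<Longrightarrow> m \<notin> ftn P"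
    "\<And>m m'. (m, m') \<in> E \<Longrightarrow> m \<in> ftn P \<Longrightarrow> m' \<in> ftn P \<Longrightarrow> m = m'"
    "\<And>k k'. (ExT k, ExT k') \<in> E \<Longrightarrow> k \<in> hasco H \<Longrightarrow> k' \<in> hasco H"
  shows "coherent (E, H, P)"
  using assms unfolding coherent.simps by blast

lemma coherent_mono:
  assumes C: "coherent (E, H, P)" and Q: "flat Q" "ftn Q \<subseteq> ftn P"
  shows "coherent (E, H, Q)"
proof (rule coherentI)
  note D = coherentD[OF C]
  show "k \<in> htrn H" if "ExT k \<in> ftn Q" for k using D(5) Q(2) that by blast
  show "m \<notin> ftn Q" if "k \<in> dead H" "(ExT k, m) \<in> E" for k m using D(6)[OF that] Q(2) by blast
  show "m = m'" if "(m, m') \<in> E" "m \<in> ftn Q" "m' \<in> ftn Q" for m m'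
    using D(7)[OF that(1)] Q(2) that(2,3) by blast
  show "k' \<in> hasco H" if "(ExT k, ExT k') \<in> E" "k \<in> hasco H" for k k' using D(8)[OF that] .
  show "(ExT k, ExT k) \<in> E \<longleftrightarrow> k \<in> htrn H" for k using D(4) .
qed (use Q(1) coherentD(2,3)[OF C] in simp_all)

lemma coherent_init: "ext_conf (init_conf P) \<Longrightarrow> coherent (init_conf P)"
  by (auto simp: coherent.simps init_conf_def htrn_def hasco_def aborted_def sym_def trans_def
      intro: flat_if_process)

text \<open>A name related to anything is related to itself by symmetry and transitivity, hence
  occurs in the history.\<close>

lemma coherent_names:
  assumes "coherent (E, H, P)"
  shows "(m, ExT k) \<in> E \<Longrightarrow> k \<in> htrn H" "(ExT k, m) \<in> E \<Longrightarrow> k \<in> htrn H"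
  using coherentD(4)[OF assms] symD[OF coherentD(2)[OF assms]] transD[OF coherentD(3)[OF assms]] by blast+

text \<open>Serves both the internal transitions on \<open>k\<close>, where \<open>H'\<close> is
  \<open>H\<close> and the added set of names is empty, and the external ones, where
  \<open>H'\<close> has one more action entry. The merged block consists of undecided names, so
  committed classes do not change.\<close>

lemma coherent_tr:
  fixes k :: "('i, 'x) trn"
  assumes coherent: "coherent (E, H, P)" and fresh: "fresh_trn k E H"
    and k: "k \<notin> ftn P" and ls: "set ls \<subseteq> ftn P"
    and Q: "flat Q" "ftn Q \<subseteq> insert k (ftn P - set ls)"
    and H': "htrn H' = htrn H \<union> {l. k = ExT l}" "hasco H' = hasco H" "aborted H' = aborted H"
  shows "coherent (sub_rel (Ren ls k) E, H', Q) \<and> groups (sub_rel (Ren ls k) E) H' = groups E H"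
proof -
  note D = coherentD[OF coherent]
  let ?U = "insert k (set ls) \<union> E `` insert k (set ls)"
  let ?F = "E \<union> ?U \<times> ?U"
  have F: "sub_rel (Ren ls k) E = ?F"
    using sub_rel_Ren[OF D(2,3)] by (simp only: merge_def)
  have sF: "sym ?F" and tF: "trans ?F"
    using sym_merge[OF D(2), of "insert k (set ls)"] trans_merge[OF D(2,3), of "insert k (set ls)"]
    by (simp_all only: merge_def)
  have kE: "(k, m) \<notin> E" "(m, k) \<notin> E" for m
    using fresh by (auto simp: fresh_trn_def Field_def)
  have kd: "k \<noteq> ExT l" if "l \<in> htrn H" for l
    using fresh that by (auto simp: fresh_trn_def)
  \<comment> \<open>Every name in the block other than \<open>k\<close> shares a class with a name
    of the process, which the class of a decided name never does.\<close>
  have U_dead: "ExT l \<notin> ?U" if l: "l \<in> dead H" for l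
  proof
    assume "ExT l \<in> ?U"
    moreover have "ExT l \<noteq> k" using kd[of l] dead_subset_htrn[of H] l by auto
    moreover have "ExT l \<notin> ftn P"
    proof
      assume "ExT l \<in> ftn P"
      then have "(ExT l, ExT l) \<in> E" using D(4,5) by blast
      with D(6)[OF l this] \<open>ExT l \<in> ftn P\<close> show False by blast
    qed
    moreover have "(m, ExT l) \<notin> E" if "m \<in> ftn P" for m
      using D(6)[OF l] that symD[OF D(2)] by blast
    ultimately show False using ls kE by blast
  qed
  \<comment> \<open>Each merged class had a single name in the process, and that name is among the
    renamed \<open>ls\<close>.\<close>
  have U_Q: "m = k" if m: "m \<in> ?U" "m \<in> ftn Q" for m
  proof (rule ccontr)
    assume "m \<noteq> k"
    with m Q(2) have "m \<in> ftn P" "m \<notin> set ls" by auto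
    with m \<open>m \<noteq> k\<close> kE obtain l where "l \<in> set ls" "(l, m) \<in> E" by auto
    with ls \<open>m \<in> ftn P\<close> have "l = m" using D(7) by blast
    with \<open>l \<in> set ls\<close> \<open>m \<notin> set ls\<close> show False by simp
  qed
  have U_names: "l \<in> htrn H" if "ExT l \<in> ?U" "ExT l \<noteq> k" for l
    using that ls D(5) coherent_names[OF coherent] by blast
  have "coherent (?F, H', Q)"
  proof (rule coherentI)
    fix l
    show "(ExT l, ExT l) \<in> ?F \<longleftrightarrow> l \<in> htrn H'"
      using D(4)[of l] U_names[of l] unfolding H' by blast
    show "ExT l \<in> ftn Q \<Longrightarrow> l \<in> htrn H'"
      using D(5)[of l] Q(2) unfolding H' by blast
  next
    fix l m
    assume l: "l \<in> dead H'" and "(ExT l, m) \<in> ?F"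
    then have lm: "(ExT l, m) \<in> E" using U_dead unfolding H' by blast
    with kE have "m \<noteq> k" by blast
    moreover have "m \<notin> ftn P" using D(6) l lm unfolding H' by blast
    ultimately show "m \<notin> ftn Q" using Q(2) by blast
  next
    fix m m'
    assume mm: "(m, m') \<in> ?F" "m \<in> ftn Q" "m' \<in> ftn Q"
    show "m = m'"
    proof (cases "(m, m') \<in> E")
      case True
      with kE have "m \<noteq> k" "m' \<noteq> k" by blast+
      with mm Q(2) True show ?thesis using D(7) by blast
    next
      case False
      with mm U_Q show ?thesis by blast
    qed
  next
    fix l l'
    assume "(ExT l, ExT l') \<in> ?F" "l \<in> hasco H'"
    moreover from this have "ExT l \<notin> ?U" using U_dead H' by blast
    ultimately show "l' \<in> hasco H'" using D(8) unfolding H' by blast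
  qed (fact Q(1) sF tF)+
  moreover have "groups ?F H' = groups E H"
    unfolding groups_def H'
  proof (rule image_cong[OF HOL.refl])
    fix l assume "l \<in> hasco H"
    then have "ExT l \<notin> ?U" using U_dead by blast
    then show "ext_class ?F (ExT l) = ext_class E (ExT l)"
      by (rule ext_class_Un)
  qed
  ultimately show ?thesis unfolding F by blast
qed

text \<open>While \<open>k\<close> occurs in the process, all external names of its class are still
  pending actions, so committing or aborting \<open>k\<close> marks the whole class.\<close>

lemma coherent_class_HAct:
  assumes coherent: "coherent (E, H, P)" and k: "k \<in> ftn P" and l: "(ExT l, k) \<in> E"
  shows "l \<notin> dead H" "\<exists>a. HAct l a \<in> ran H"
proof -
  show "l \<notin> dead H" using coherentD(6)[OF coherent] k l by blast
  then show "\<exists>a. HAct l a \<in> ran H"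
    using coherent_names(2)[OF coherent l] by (rule_tac htrn_cases) auto
qed

lemma coherent_commit:
  assumes coherent: "coherent (E, H, P)" and k: "k \<in> ftn P" and Q: "flat Q" "ftn Q \<subseteq> ftn P - {k}"
  shows "coherent (E, mark HCo E k H, Q)"
    and "hasco (mark HCo E k H) = hasco H \<union> ext_class E k"
    and "groups E (mark HCo E k H) =
      (if ext_class E k = {} then groups E H else insert (ext_class E k) (groups E H))"
proof -
  note D = coherentD[OF coherent] and s = symD[OF coherentD(2)[OF coherent]] and t = transD[OF coherentD(3)[OF coherent]]
  show hasco: "hasco (mark HCo E k H) = hasco H \<union> ext_class E k"
    using coherent_class_HAct(2)[OF coherent k] s unfolding hasco_def ran_mark ext_class_def by auto
  have ab: "aborted (mark HCo E k H) = aborted H"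
    unfolding aborted_def ran_mark by auto
  show "coherent (E, mark HCo E k H, Q)"
  proof (rule coherentI)
    fix l m
    assume l: "l \<in> dead (mark HCo E k H)" and lm: "(ExT l, m) \<in> E"
    show "m \<notin> ftn Q"
    proof (cases "l \<in> dead H")
      case True
      with lm D(6) Q(2) show ?thesis by blast
    next
      case False
      with l have "(k, ExT l) \<in> E" unfolding hasco ab ext_class_def by blast
      then have "(k, m) \<in> E" using lm t by blast
      then show ?thesis using D(7) k Q(2) by blast
    qed
  next
    fix l l'
    assume "(ExT l, ExT l') \<in> E" "l \<in> hasco (mark HCo E k H)"
    then show "l' \<in> hasco (mark HCo E k H)"
      using D(8) t unfolding hasco ext_class_def by blast
  next
    fix m m' assume "(m, m') \<in> E" "m \<in> ftn Q" "m' \<in> ftn Q"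
    then show "m = m'" using D(7)[of m m'] Q(2) by blast
  next
    fix l
    show "ExT l \<in> ftn Q \<Longrightarrow> l \<in> htrn (mark HCo E k H)" using D(5)[of l] Q(2) by (auto simp: htrn_mark)
    show "(ExT l, ExT l) \<in> E \<longleftrightarrow> l \<in> htrn (mark HCo E k H)" using D(4)[of l] by (simp add: htrn_mark)
  qed (fact D(2,3) Q(1))+
  \<comment> \<open>All newly committed names have the same class, so they add one set to the
    groups, or none if the class has no external name.\<close>
  have cls: "ext_class E (ExT l) = ext_class E k" if "l \<in> ext_class E k" for l
    using that s t unfolding ext_class_def by blast
  show "groups E (mark HCo E k H) =
      (if ext_class E k = {} then groups E H else insert (ext_class E k) (groups E H))"
    using cls unfolding groups_def hasco by (auto simp: image_Un image_iff)
qed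

lemma coherent_abort:
  assumes coherent: "coherent (E, H, P)" and k: "k \<in> ftn P" and Q: "flat Q" "ftn Q \<subseteq> ftn P - {k}"
  shows "coherent (E, mark HAb E k H, Q)" "hasco (mark HAb E k H) = hasco H"
proof -
  note D = coherentD[OF coherent] and s = symD[OF coherentD(2)[OF coherent]] and t = transD[OF coherentD(3)[OF coherent]]
  show hasco: "hasco (mark HAb E k H) = hasco H"
    unfolding hasco_def ran_mark by auto
  have ab: "aborted (mark HAb E k H) = aborted H \<union> ext_class E k"
    using coherent_class_HAct(2)[OF coherent k] s unfolding aborted_def ran_mark ext_class_def by auto
  show "coherent (E, mark HAb E k H, Q)"
  proof (rule coherentI)
    fix l m
    assume l: "l \<in> dead (mark HAb E k H)" and lm: "(ExT l, m) \<in> E"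
    show "m \<notin> ftn Q"
    proof (cases "l \<in> dead H")
      case True
      with lm D(6) Q(2) show ?thesis by blast
    next
      case False
      with l have "(k, ExT l) \<in> E" unfolding hasco ab ext_class_def by blast
      then have "(k, m) \<in> E" using lm t by blast
      then show ?thesis using D(7) k Q(2) by blast
    qed
  next
    fix m m' assume "(m, m') \<in> E" "m \<in> ftn Q" "m' \<in> ftn Q"
    then show "m = m'" using D(7)[of m m'] Q(2) by blast
  next
    fix l l' assume "(ExT l, ExT l') \<in> E" "l \<in> hasco (mark HAb E k H)"
    then show "l' \<in> hasco (mark HAb E k H)" using D(8)[of l l'] unfolding hasco by blast
  next
    fix l
    show "ExT l \<in> ftn Q \<Longrightarrow> l \<in> htrn (mark HAb E k H)" using D(5)[of l] Q(2) by (auto simp: htrn_mark)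
    show "(ExT l, ExT l) \<in> E \<longleftrightarrow> l \<in> htrn (mark HAb E k H)" using D(4)[of l] by (simp add: htrn_mark)
  qed (fact D(2,3) Q(1))+
qed

fun names :: "('n, 'i, 'x) conf \<Rightarrow> 'x set" where "names (E, H, P) = htrn H"
fun committed :: "('n, 'i, 'x) conf \<Rightarrow> 'x set" where "committed (E, H, P) = hasco H"
fun classes :: "('n, 'i, 'x) conf \<Rightarrow> 'x set set" where "classes (E, H, P) = groups E H"

text \<open>The bookkeeping behind both nontrivial translations: only actions add names, only commit
  labels add committed names, and a label \<open>XCo L\<close> adds precisely the class
  \<open>L\<close>. Commits of classes without external names mark nothing, which is why they may be
  silent.\<close>

lemma xstep_ComSens:
  assumes "xstep ComSens C \<zeta> C'" "coherent C"
  shows "coherent C' \<and> (case \<zeta> of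
      XTau \<Rightarrow> names C' = names C \<and> committed C' = committed C \<and> classes C' = classes C
    | XAct l a \<Rightarrow> l \<notin> names C \<and> names C' = insert l (names C) \<and>
        committed C' = committed C \<and> classes C' = classes C
    | XCo L \<Rightarrow> L \<noteq> {} \<and> L \<subseteq> names C \<and> L \<inter> committed C = {} \<and> names C' = names C \<and>
        committed C' = committed C \<union> L \<and> classes C' = insert L (classes C))"
  using assms
proof (induction rule: xstep.induct)
  case (tau P Q E H)
  then have "flat Q" "ftn Q \<subseteq> ftn P" using step_names[OF tau(1) coherentD(1)[OF tau(2)]] by auto
  then show ?case using coherent_mono[OF tau(2)] by simp
next
  case (tr_tau P k \<sigma> Q E H)
  then obtain ls where *: "\<sigma> = Ren ls (InT k)" "flat Q" "set ls \<subseteq> ftn P" "InT k \<notin> ftn P"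
      "ftn Q \<subseteq> insert (InT k) (ftn P - set ls)"
    using step_names[OF tr_tau(1) coherentD(1)[OF tr_tau(3)]] by auto
  show ?case
    unfolding *(1) using coherent_tr[OF tr_tau(3,2) *(4,3,2,5), of H] by simp
next
  case (new P k Q E H)
  note D = coherentD[OF new(3)]
  from new have Q: "flat Q" "ftn Q \<subseteq> insert (InT k) (ftn P)"
    using reconf_names[OF new(1) coherentD(1)[OF new(3)]] by auto
  have kE: "(InT k, m) \<notin> E" "(m, InT k) \<notin> E" for m
    using new(2) by (auto simp: fresh_trn_def Field_def)
  have "coherent (E, H, Q)"
  proof (rule coherentI)
    fix l m assume "l \<in> dead H" "(ExT l, m) \<in> E"
    then show "m \<notin> ftn Q" using D(6)[of l m] kE Q(2) by blast
  next
    fix m m' assume "(m, m') \<in> E" "m \<in> ftn Q" "m' \<in> ftn Q"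
    then show "m = m'" using D(7)[of m m'] kE Q(2) by blast
  next
    fix l assume "ExT l \<in> ftn Q"
    then show "l \<in> htrn H" using D(5)[of l] Q(2) by blast
  next
    fix l l' assume "(ExT l, ExT l') \<in> E" "l \<in> hasco H"
    then show "l' \<in> hasco H" by (rule D(8))
  next
    fix l show "(ExT l, ExT l) \<in> E \<longleftrightarrow> l \<in> htrn H" by (rule D(4))
  qed (fact D(2,3) Q(1))+
  then show ?case by simp
next
  case (commit P k Q E H)
  then show ?case by simp
next
  case (commit_ext P k Q E H)
  then have "flat Q" "k \<in> ftn P" "ftn Q \<subseteq> ftn P - {k}"
    using reconf_names[OF commit_ext(2) coherentD(1)[OF commit_ext(4)]] by auto
  note I = coherent_commit[OF commit_ext(4) this(2,1,3)]
  show ?case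
    using I commit_ext(3) coherent_names(1)[OF commit_ext(4)]
      coherent_class_HAct(1)[OF commit_ext(4) \<open>k \<in> ftn P\<close>] symD[OF coherentD(2)[OF commit_ext(4)]]
    by (auto simp: htrn_mark ext_class_def)
next
  case (commit_int P k Q E H)
  then have "flat Q" "k \<in> ftn P" "ftn Q \<subseteq> ftn P - {k}"
    using reconf_names[OF commit_int(2) coherentD(1)[OF commit_int(4)]] by auto
  note I = coherent_commit[OF commit_int(4) this(2,1,3)]
  show ?case using I commit_int(3) by (simp add: htrn_mark)
next
  case (abort P k Q E H)
  then have "flat Q" "k \<in> ftn P" "ftn Q \<subseteq> ftn P - {k}"
    using reconf_names[OF abort(1) coherentD(1)[OF abort(2)]] by auto
  note I = coherent_abort[OF abort(2) this(2,1,3)]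
  show ?case using I by (simp add: htrn_mark groups_def)
next
  case (act P k a \<sigma> Q E H i)
  then obtain ls where *: "\<sigma> = Ren ls (ExT k)" "flat Q" "set ls \<subseteq> ftn P" "ExT k \<notin> ftn P"
      "ftn Q \<subseteq> insert (ExT k) (ftn P - set ls)"
    using step_names[OF act(1) coherentD(1)[OF act(4)]] by auto
  have "k \<notin> htrn H" using act(2) by (auto simp: fresh_trn_def)
  then show ?case
    unfolding *(1) using coherent_tr[OF act(4,2) *(4,3,2,5), of "H(i \<mapsto> HAct k a)"] act(3)
    by (simp add: htrn_upd)
next
  case (act_ab k E H P i a)
  note D = coherentD[OF act_ab(4)]
  \<comment> \<open>Freshness makes \<open>k\<close> a class of its own, so the added pair disturbs
    neither transitivity nor any other class.\<close>
  have kE: "(ExT k, m) \<notin> E" "(m, ExT k) \<notin> E" for m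
    using act_ab(1) by (auto simp: fresh_trn_def Field_def)
  have kH: "k \<notin> htrn H" using act_ab(1) by (auto simp: fresh_trn_def)
  then have kd: "k \<notin> hasco H" using dead_subset_htrn[of H] by blast
  have coherent: "coherent (insert (ExT k, ExT k) E, H(i \<mapsto> HAb k), P)"
  proof (rule coherentI)
    show "sym (insert (ExT k, ExT k) E)" using D(2) by (auto simp: sym_def)
    show "trans (insert (ExT k, ExT k) E)"
      using D(3) kE by (auto simp: trans_def)
  next
    fix l m
    assume "l \<in> dead (H(i \<mapsto> HAb k))" "(ExT l, m) \<in> insert (ExT k, ExT k) E"
    then show "m \<notin> ftn P"
      using D(6)[of l m] kE act_ab(2,3) by auto
  next
    fix l
    show "(ExT l, ExT l) \<in> insert (ExT k, ExT k) E \<longleftrightarrow> l \<in> htrn (H(i \<mapsto> HAb k))"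
      using D(4)[of l] act_ab(3) by (auto simp: htrn_upd)
    show "ExT l \<in> ftn P \<Longrightarrow> l \<in> htrn (H(i \<mapsto> HAb k))"
      using D(5)[of l] act_ab(3) by (auto simp: htrn_upd)
  next
    fix m m' assume "(m, m') \<in> insert (ExT k, ExT k) E" "m \<in> ftn P" "m' \<in> ftn P"
    then show "m = m'" using D(7)[of m m'] by blast
  next
    fix l l' assume "(ExT l, ExT l') \<in> insert (ExT k, ExT k) E" "l \<in> hasco (H(i \<mapsto> HAb k))"
    then show "l' \<in> hasco (H(i \<mapsto> HAb k))" using D(8)[of l l'] act_ab(3) kd by auto
  qed (fact D(1))
  moreover have "groups (insert (ExT k, ExT k) E) (H(i \<mapsto> HAb k)) = groups E H"
    using act_ab(3) kd unfolding groups_def by (auto intro!: image_cong simp: ext_class_def)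
  ultimately show ?case using act_ab(3) kH by (simp add: htrn_upd)
qed

lemma xstep_ExtI: "xstep ComSens C \<zeta> C' \<Longrightarrow> xstep Ext C (case \<zeta> of XCo L \<Rightarrow> XTau | _ \<Rightarrow> \<zeta>) C'"
  by (induction rule: xstep.induct) (auto intro: xstep.intros)

text \<open>The only difference between the modes is a commit of a class with external names, which
  is silent in one mode and labelled in the other.\<close>

lemma xstep_Ext_cases:
  assumes "xstep Ext C \<zeta> C'"
  obtains "xstep ComSens C \<zeta> C'" | L where "\<zeta> = XTau" "xstep ComSens C (XCo L) C'"
proof -
  have "xstep ComSens C \<zeta> C' \<or> (\<zeta> = XTau \<and> (\<exists>L. xstep ComSens C (XCo L) C'))"
    using assms
  proof (induction rule: xstep.induct)
    case (commit P k Q E H)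
    then show ?case
      by (cases "ext_class E k = {}") (auto intro: xstep.intros)
  qed (auto intro: xstep.intros)
  then show thesis using that by blast
qed


section \<open>Satisfaction with environments\<close>

primrec nval :: "(nat \<Rightarrow> 'x) \<Rightarrow> 'x nv \<Rightarrow> 'x" where
  "nval e (Nm k) = k"
| "nval e (Vr x) = e x"

text \<open>Evaluating variables in an environment replaces instantiation. Recursion becomes
  structural and open formulae get a meaning, so inductions over formulae can pass below a
  binder.\<close>

primrec esat :: "mode \<Rightarrow> ('n, 'x, 'm) form \<Rightarrow> (nat \<Rightarrow> 'x) \<Rightarrow> ('n, 'i, 'x) conf \<Rightarrow> bool" where
  "esat s (DiaTau \<phi>) e C \<longleftrightarrow> (\<exists>C'. xtaus s C C' \<and> esat s \<phi> e C')"
| "esat s (DiaAct x a \<phi>) e C \<longleftrightarrow>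
     (\<exists>N. finite (- N) \<and> (\<forall>l\<in>N. \<exists>C'. xweak s C (XAct l a) C' \<and> esat s \<phi> (e(x := l)) C'))"
| "esat s (Neg \<phi>) e C \<longleftrightarrow> \<not> esat s \<phi> e C"
| "esat s (Conj M f) e C \<longleftrightarrow> (\<forall>i\<in>M. esat s (f i) e C)"
| "esat s (HasCo v) e C \<longleftrightarrow> nval e v \<in> committed C"
| "esat s (EqCo v w) e C \<longleftrightarrow> nval e v \<in> committed C \<and> nval e w \<in> committed C \<and>
     (ExT (nval e v), ExT (nval e w)) \<in> fst C"
| "esat s (DiaCo K \<phi>) e C \<longleftrightarrow> (\<exists>C'. xweak s C (XCo (nval e ` K)) C' \<and> esat s \<phi> e C')"

lemma nval_inst_nv: "nval e (inst_nv x l v) = nval (e(x := l)) v"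
  by (cases v) (auto simp: inst_nv_def)

lemma esat_inst: "esat s (inst x l \<phi>) e C \<longleftrightarrow> esat s \<phi> (e(x := l)) C"
proof (induction \<phi> arbitrary: e C)
  case (DiaAct y a \<phi>)
  then show ?case by (cases "y = x") (simp_all add: fun_upd_twist del: fun_upd_apply)
next
  case (DiaCo K \<phi>)
  then show ?case by (simp add: nval_inst_nv image_image del: fun_upd_apply)
qed (simp_all add: nval_inst_nv del: fun_upd_apply)

lemma fvars_inst: "fvars (inst x l \<phi>) = fvars \<phi> - {x}"
proof (induction \<phi>)
  case (DiaCo K \<phi>)
  have "Vr y \<in> inst_nv x l ` K \<longleftrightarrow> Vr y \<in> K \<and> y \<noteq> x" for y
    by (force simp: inst_nv_def image_iff)
  with DiaCo show ?case by auto
qed (auto simp: inst_nv_def)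

lemma sat_iff_esat:
  fixes C :: "('n, 'i, 'x) conf"
  shows "fvars \<phi> = {} \<Longrightarrow> sat s C \<phi> \<longleftrightarrow> esat s \<phi> e C"
proof (induction s C \<phi> rule: sat.induct)
  case (1 s C \<phi>)
  then show ?case by (simp add: xweak_def)
next
  case (2 s C x a \<phi>)
  from 2(2) have "fvars (inst x l \<phi>) = {}" for l by (simp add: fvars_inst)
  \<comment> \<open>Taking \<open>UNIV\<close> for the set of names in the modality gives the
    induction hypothesis for every \<open>l\<close>.\<close>
  with 2(1)[of _ UNIV] have "sat s C' (inst x l \<phi>) \<longleftrightarrow> esat s \<phi> (e(x := l)) C'" for l and C' :: "('n, 'i, 'x) conf"
    by (simp add: esat_inst)
  then show ?case by simp
next
  case (5 s E H P v)
  then show ?case by (cases v) auto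
next
  case (6 s E H P v w)
  then show ?case by (cases v; cases w) auto
next
  case (7 s C K \<phi>)
  from 7(2) have "\<And>x. Vr x \<notin> K" by auto
  then have Nm: "v = Nm (nval e v)" if "v \<in> K" for v using that by (cases v) auto
  have "K = Nm ` L \<longleftrightarrow> nval e ` K = L" for L
  proof
    assume "nval e ` K = L"
    then have "Nm ` L = (\<lambda>v. Nm (nval e v)) ` K" by (auto simp: image_image)
    also have "\<dots> = (\<lambda>v. v) ` K" using Nm by (intro image_cong) auto
    finally show "K = Nm ` L" by simp
  qed (simp add: image_image)
  then show ?case using 7 by auto
qed auto

lemma esat_cong:
  fixes C :: "('n, 'i, 'x) conf"
  shows "(\<And>x. x \<in> fvars \<phi> \<Longrightarrow> e x = e' x) \<Longrightarrow> esat s \<phi> e C \<longleftrightarrow> esat s \<phi> e' C"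
proof (induction \<phi> arbitrary: e e' C)
  case (DiaTau \<phi>)
  have "esat s \<phi> e C' \<longleftrightarrow> esat s \<phi> e' C'" for C' :: "('n, 'i, 'x) conf"
    by (rule DiaTau.IH) (use DiaTau.prems in simp)
  then show ?case by simp
next
  case (DiaAct x a \<phi>)
  have "esat s \<phi> (e(x := l)) C' \<longleftrightarrow> esat s \<phi> (e'(x := l)) C'" for l and C' :: "('n, 'i, 'x) conf"
    using DiaAct.prems by (intro DiaAct.IH) simp
  then show ?case by simp
next
  case (Neg \<phi>)
  have "esat s \<phi> e C \<longleftrightarrow> esat s \<phi> e' C" by (rule Neg.IH) (use Neg.prems in simp)
  then show ?case by simp
next
  case (Conj M f)
  have "esat s (f i) e C \<longleftrightarrow> esat s (f i) e' C" if "i \<in> M" for i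
    using Conj.prems that by (intro Conj.IH) auto
  then show ?case by simp
next
  case (HasCo v)
  then show ?case by (cases v) auto
next
  case (EqCo v w)
  then show ?case by (cases v; cases w) auto
next
  case (DiaCo K \<phi>)
  have "nval e v = nval e' v" if "v \<in> K" for v using DiaCo.prems that by (cases v) auto
  then have "nval e ` K = nval e' ` K" by (rule image_cong[OF HOL.refl])
  moreover have "esat s \<phi> e C' \<longleftrightarrow> esat s \<phi> e' C'" for C' :: "('n, 'i, 'x) conf"
    using DiaCo.prems by (intro DiaCo.IH) simp
  ultimately show ?case by simp
qed


section \<open>Renaming of external names\<close>

lemma map_tm_no_names: "ftn P = {} \<Longrightarrow> map_tm id (g :: 'k \<Rightarrow> 'k) P = P"
  by (rule tm.map_ident_strong) auto

lemma ftn_branch: "ftn (Choice f) = {} \<Longrightarrow> f j = Some (\<mu>, P) \<Longrightarrow> ftn P = {}"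
  unfolding ftn_Choice by blast

lemma sub_fun_map:
  assumes "inj g"
  shows "sub_fun (map_sub g \<sigma>) (g k) = g (sub_fun \<sigma> k)"
  using inj_image_mem_iff[OF assms] by (cases \<sigma>) auto

lemma map_tm_app_sub:
  assumes "inj g"
  shows "map_tm id g (app_sub P \<sigma>) = app_sub (map_tm id g P) (map_sub g \<sigma>)"
  unfolding app_sub_def tm.map_comp by (rule tm.map_cong) (auto simp: sub_fun_map[OF assms])

lemma lab_chans_map: "lab_chans (map_lab id g \<alpha>) = lab_chans \<alpha>"
  by (simp add: lab.set_map)

lemma sub_range_map: "sub_range (map_sub g \<sigma>) = g ` sub_range \<sigma>"
  by (cases \<sigma>) auto

lemma map_lab_Plain: "map_lab id g (Plain \<mu>) = Plain \<mu>"
  and map_lab_Tr: "map_lab id g (Tr k \<mu>) = Tr (g k) \<mu>"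
  by (simp_all only: lab.map pre.map_id)

lemma inj_image_disjoint: "inj g \<Longrightarrow> A \<inter> B = {} \<Longrightarrow> g ` A \<inter> g ` B = {}"
  by (auto simp: inj_eq)

text \<open>Flatness avoids commuting renaming with substitution: branches of sums, recursions and
  bodies of running transactions have no names, so renaming leaves them alone. Injectivity preserves
  the freshness conditions.\<close>

lemma step_map:
  fixes g :: "'k \<Rightarrow> 'k"
  assumes "step P \<alpha> \<sigma> Q" "flat P" and g: "inj g"
  shows "step (map_tm id g P) (map_lab id g \<alpha>) (map_sub g \<sigma>) (map_tm id g Q)"
  using assms(1,2)
proof (induction rule: step.induct)
  case (sum f j \<mu> P)
  from sum(2) have ch: "ftn (Choice f) = {}" by simp
  show ?case
    unfolding map_tm_no_names[OF ch] map_tm_no_names[OF ftn_branch[OF ch sum(1)]] map_lab_Plain sub.map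
    by (rule step.sum[of f j, OF sum(1)])
next
  case (com P a P' Q Q')
  then show ?case unfolding tm.map map_lab_Plain sub.map flat.simps by (blast intro: step.com)
next
  case (rec X P)
  then have "ftn (Rec X P) = {}" "ftn (subst_tm P X (Rec X P)) = {}"
    using ftn_subst_ren[of P id X "Rec X P"] by (simp_all add: subst_tm_def)
  then show ?case using step.rec[of X P] by (simp only: map_tm_no_names map_lab_Plain sub.map)
next
  case (tr_sum f j a P k)
  from tr_sum(2) have ch: "ftn (Choice f) = {}" by simp
  show ?case
    unfolding map_tm_no_names[OF ch] tm.map(2,6,7) map_tm_no_names[OF ftn_branch[OF ch tr_sum(1)]]
      map_lab_Tr sub.map list.map
    by (rule step.tr_sum[of f j, OF tr_sum(1)])
next
  case (tr_run P \<mu> P' k l Q)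
  have "ftn P' = {}" using step_names[OF tr_run(1)] tr_run(4) by (auto simp: flat_if_no_names)
  with tr_run(4) have no: "map_tm id g P = P" "map_tm id g P' = P'" "map_tm id g Q = Q"
    by (simp_all only: flat.simps map_tm_no_names)
  have "g k \<noteq> g l" using tr_run(2) g by (simp add: inj_eq)
  then show ?case
    unfolding tm.map no map_lab_Tr sub.map list.map by (rule step.tr_run[OF tr_run(1)])
next
  case (tr_com P k a ls1 P' Q ls2 Q')
  then show ?case
    unfolding tm.map map_tm_app_sub[OF g] map_lab_Tr sub.map list.map map_append flat.simps
    by (blast intro: step.tr_com)
next
  case (par_left P \<alpha> \<sigma> P' Q)
  then show ?case
    unfolding tm.map map_tm_app_sub[OF g] flat.simps
    by (intro step.par_left) (simp_all only: tm.set_map sub_range_map inj_image_disjoint[OF g])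
next
  case (par_right Q \<alpha> \<sigma> Q' P)
  then show ?case
    unfolding tm.map map_tm_app_sub[OF g] flat.simps
    by (intro step.par_right) (simp_all only: tm.set_map sub_range_map inj_image_disjoint[OF g])
next
  case (res P \<alpha> \<sigma> P' a)
  then have "step (Res a (map_tm id g P)) (map_lab id g \<alpha>) (map_sub g \<sigma>) (Res a (map_tm id g P'))"
    by (intro step.res) (simp_all only: lab_chans_map flat.simps not_False_eq_True)
  then show ?case by (simp only: tm.map id_def)
qed

text \<open>The structural congruence in the commit rule needs no renaming, since by flatness the
  body of the transaction has no names.\<close>

lemma reconf_map:
  fixes g :: "'k \<Rightarrow> 'k"
  assumes "reconf P \<beta> Q" "flat P" and g: "inj g"
  shows "reconf (map_tm id g P) (map_rlab g \<beta>) (map_tm id g Q)"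
  using assms(1,2)
proof (induction rule: reconf.induct)
  case (commit P P'' P' k Q)
  then have "ftn P' = {}" using co_red_names[of P P'] by simp
  with commit(3) have "map_tm id g P = P" "map_tm id g P' = P'"
    by (simp_all only: flat.simps map_tm_no_names)
  with reconf.commit[OF commit(1,2)] show ?case by (simp only: tm.map rlab.map)
next
  case (new P Q k)
  show ?case unfolding tm.map rlab.map by (rule reconf.new)
next
  case (abort P k Q)
  show ?case unfolding tm.map rlab.map by (rule reconf.abort)
next
  case (par_both \<beta> k P P' Q Q')
  then show ?case unfolding tm.map flat.simps
    by (intro reconf.par_both[of _ "g k"]) (auto simp only: rlab.map)
next
  case (par_left P \<beta> P' Q)
  then show ?case
    unfolding tm.map flat.simps
    by (intro reconf.par_left) (simp_all only: tm.set_map rlab.set_map inj_image_disjoint[OF g])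
next
  case (par_right Q \<beta> Q' P)
  then show ?case
    unfolding tm.map flat.simps
    by (intro reconf.par_right) (simp_all only: tm.set_map rlab.set_map inj_image_disjoint[OF g])
next
  case (res P \<beta> P' a)
  then show ?case unfolding tm.map flat.simps by (intro reconf.res)
qed

lemma map_prod_Image: "inj g \<Longrightarrow> (map_prod g g ` E) `` (g ` U) = g ` (E `` U)"
  by (auto simp: inj_eq) (metis ImageI image_eqI map_prod_simp)+

lemma merge_map:
  assumes "inj g"
  shows "merge (map_prod g g ` E) (g ` U) = map_prod g g ` merge E U"
  unfolding merge_def map_prod_Image[OF assms] image_Un map_prod_surj_on by auto

lemma sym_map: "sym E \<Longrightarrow> sym (map_prod g g ` E)"
  by (fastforce simp: sym_def)

lemma trans_map: "inj g \<Longrightarrow> trans E \<Longrightarrow> trans (map_prod g g ` E)"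
  by (auto simp: trans_def inj_eq)

lemma map_prod_mem: "inj g \<Longrightarrow> (g x, g y) \<in> map_prod g g ` E \<longleftrightarrow> (x, y) \<in> E"
  by (auto simp: inj_eq)

lemma Field_map: "Field (map_prod g g ` E) = g ` Field E"
  by (force simp: Field_def image_iff)

text \<open>The closed form \<open>merge\<close> makes this a computation with images, without
  renaming the intersected family.\<close>

lemma sub_rel_map:
  assumes "inj g" "sym E" "trans E"
  shows "sub_rel (map_sub g \<sigma>) (map_prod g g ` E) = map_prod g g ` sub_rel \<sigma> E"
proof (cases \<sigma>)
  case (Ren ls k)
  have "sub_rel (map_sub g \<sigma>) (map_prod g g ` E) = merge (map_prod g g ` E) (g ` insert k (set ls))"
    unfolding Ren sub.map
    by (subst sub_rel_Ren[OF sym_map[OF assms(2)] trans_map[OF assms(1,3)]]) simp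
  also have "\<dots> = map_prod g g ` sub_rel \<sigma> E"
    unfolding Ren merge_map[OF assms(1)] sub_rel_Ren[OF assms(2,3)] ..
  finally show ?thesis .
qed simp


text \<open>The part of \<open>coherent\<close> that renaming transitions relies on: flatness for
  \<open>step_map\<close> and \<open>reconf_map\<close>, symmetry and transitivity for
  \<open>sub_rel_map\<close>. It is preserved in both modes and by renaming itself.\<close>

fun tame :: "('n, 'i, 'x) conf \<Rightarrow> bool" where
  "tame (E, H, P) \<longleftrightarrow> flat P \<and> sym E \<and> trans E"

lemma tame_if_coherent: "coherent C \<Longrightarrow> tame C"
  by (cases C) (auto dest: coherentD)

lemma tame_xstep:
  assumes "xstep s C \<zeta> C'" "tame C"
  shows "tame C'"
  using assms
proof (induction rule: xstep.induct)
  case (tau P Q E H)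
  then show ?case using step_names[OF tau(1)] by simp
next
  case (tr_tau P k \<sigma> Q E H)
  then obtain ls where "\<sigma> = Ren ls (InT k)" "flat Q" using step_names[OF tr_tau(1)] by auto
  with tr_tau(3) show ?case
    by (simp only: tame.simps sub_rel_Ren sym_merge trans_merge simp_thms)
next
  case (act P k a \<sigma> Q E H i)
  then obtain ls where "\<sigma> = Ren ls (ExT k)" "flat Q" using step_names[OF act(1)] by auto
  with act(4) show ?case
    by (simp only: tame.simps sub_rel_Ren sym_merge trans_merge simp_thms)
next
  case (act_ab k E H P i a)
  have kE: "(ExT k, m) \<notin> E" "(m, ExT k) \<notin> E" for m
    using act_ab(1) by (auto simp: fresh_trn_def Field_def)
  from act_ab(4) have t: "flat P" "sym E" "trans E" by simp_all
  have "sym (insert (ExT k, ExT k) E)" using t(2) by (auto simp: sym_def)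
  moreover have "trans (insert (ExT k, ExT k) E)" using t(3) kE by (auto simp: trans_def)
  ultimately show ?case using t(1) by simp
next
  case (new P k Q E H)
  then show ?case using reconf_names[OF new(1)] by simp
next
  case (commit P k Q E H)
  then show ?case using reconf_names[OF commit(2)] by simp
next
  case (commit_ext P k Q E H)
  then show ?case using reconf_names[OF commit_ext(2)] by simp
next
  case (commit_int P k Q E H)
  then show ?case using reconf_names[OF commit_int(2)] by simp
next
  case (abort P k Q E H)
  then show ?case using reconf_names[OF abort(1)] by simp
qed

section \<open>Renaming of external names in configurations, with internal names fixed\<close>

definition prm_trn :: "('x \<Rightarrow> 'x) \<Rightarrow> ('i, 'x) trn \<Rightarrow> ('i, 'x) trn" where
  "prm_trn p = map_trn id p"

definition prm_hist :: "('x \<Rightarrow> 'x) \<Rightarrow> ('n, 'x) hist \<Rightarrow> ('n, 'x) hist" where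
  "prm_hist p H = map_option (map_hist_entry id p) \<circ> H"

fun prm :: "('x \<Rightarrow> 'x) \<Rightarrow> ('n, 'i, 'x) conf \<Rightarrow> ('n, 'i, 'x) conf" where
  "prm p (E, H, P) = (map_prod (prm_trn p) (prm_trn p) ` E, prm_hist p H, map_tm id (prm_trn p) P)"

primrec prm_lab :: "('x \<Rightarrow> 'x) \<Rightarrow> ('n, 'x) xlab \<Rightarrow> ('n, 'x) xlab" where
  "prm_lab p XTau = XTau"
| "prm_lab p (XAct k a) = XAct (p k) a"
| "prm_lab p (XCo L) = XCo (p ` L)"

lemma prm_trn_simps [simp]: "prm_trn p (InT i) = InT i" "prm_trn p (ExT k) = ExT (p k)"
  by (simp_all add: prm_trn_def)

lemma inj_prm_trn: "inj p \<Longrightarrow> inj (prm_trn p)"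
  by (simp add: prm_trn_def trn.inj_map)

lemma prm_trn_ExT: "prm_trn p t = ExT k \<longleftrightarrow> (\<exists>k'. t = ExT k' \<and> k = p k')"
  by (cases t) auto

lemma ran_prm_hist: "ran (prm_hist p H) = map_hist_entry id p ` ran H"
  by (auto simp: prm_hist_def ran_def image_iff)

lemma entry_trn_map: "entry_trn (map_hist_entry id p u) = p (entry_trn u)"
  by (cases u) auto

lemma htrn_prm: "htrn (prm_hist p H) = p ` htrn H"
  by (simp add: htrn_def ran_prm_hist image_image entry_trn_map)

lemma hasco_prm:
  fixes H :: "('n, 'x) hist"
  shows "hasco (prm_hist p H) = p ` hasco H"
proof -
  have *: "HCo k = map_hist_entry id p u \<longleftrightarrow> (\<exists>k'. u = HCo k' \<and> k = p k')" for u :: "('n, 'x) hist_entry" and k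
    by (cases u) auto
  have "k \<in> hasco (prm_hist p H) \<longleftrightarrow> (\<exists>u\<in>ran H. \<exists>k'. u = HCo k' \<and> k = p k')" for k
    unfolding hasco_def ran_prm_hist mem_Collect_eq image_iff * ..
  then show ?thesis unfolding hasco_def by blast
qed

lemma fresh_trn_prm:
  assumes "inj p" "fresh_trn k E H"
  shows "fresh_trn (prm_trn p k) (map_prod (prm_trn p) (prm_trn p) ` E) (prm_hist p H)"
proof -
  have *: "ExT ` htrn (prm_hist p H) = prm_trn p ` ExT ` htrn H"
    by (simp add: htrn_prm image_image)
  show ?thesis
    using assms(2) unfolding fresh_trn_def Field_map *
    by (simp only: inj_image_mem_iff[OF inj_prm_trn[OF assms(1)]] simp_thms)
qed

lemma ext_class_prm:
  assumes "inj p"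
  shows "ext_class (map_prod (prm_trn p) (prm_trn p) ` E) (prm_trn p k) = p ` ext_class E k"
proof -
  have "(prm_trn p k, ExT l) \<in> map_prod (prm_trn p) (prm_trn p) ` E \<longleftrightarrow> (\<exists>l'. l = p l' \<and> (k, ExT l') \<in> E)" for l
  proof
    assume "(prm_trn p k, ExT l) \<in> map_prod (prm_trn p) (prm_trn p) ` E"
    then obtain a b where ab: "(a, b) \<in> E" "prm_trn p a = prm_trn p k" "prm_trn p b = ExT l" by auto
    from ab(3) obtain l' where "b = ExT l'" "l = p l'" unfolding prm_trn_ExT by blast
    with ab injD[OF inj_prm_trn[OF assms] ab(2)] show "\<exists>l'. l = p l' \<and> (k, ExT l') \<in> E" by blast
  next
    assume "\<exists>l'. l = p l' \<and> (k, ExT l') \<in> E"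
    then obtain l' where "l = p l'" "(k, ExT l') \<in> E" by blast
    then show "(prm_trn p k, ExT l) \<in> map_prod (prm_trn p) (prm_trn p) ` E"
      using map_prod_imageI[of k "ExT l'" E "prm_trn p" "prm_trn p"] by simp
  qed
  then show ?thesis by (auto simp: ext_class_def)
qed

lemma mark_prm:
  assumes "inj p" "\<And>k. map_hist_entry id p (c k) = c (p k)"
  shows "mark c (map_prod (prm_trn p) (prm_trn p) ` E) (prm_trn p k) (prm_hist p H) = prm_hist p (mark c E k H)"
proof
  fix i
  have "(ExT (p k'), prm_trn p k) \<in> map_prod (prm_trn p) (prm_trn p) ` E \<longleftrightarrow> (ExT k', k) \<in> E" for k'
    using map_prod_mem[OF inj_prm_trn[OF assms(1)], of "ExT k'" k E] by simp
  then show "mark c (map_prod (prm_trn p) (prm_trn p) ` E) (prm_trn p k) (prm_hist p H) i =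
      prm_hist p (mark c E k H) i"
    by (auto simp: mark_def prm_hist_def assms(2) split: option.split hist_entry.split)
qed

lemma prm_hist_upd: "prm_hist p (H(i \<mapsto> u)) = (prm_hist p H)(i \<mapsto> map_hist_entry id p u)"
  by (auto simp: prm_hist_def)

lemma dom_prm_hist: "dom (prm_hist p H) = dom H"
  by (auto simp: prm_hist_def)

text \<open>Every premise of a transition rule is stable under an injective renaming; history
  indices stay where they are.\<close>

lemma xstep_prm:
  assumes "xstep s C \<zeta> C'" "tame C" and p: "inj p"
  shows "xstep s (prm p C) (prm_lab p \<zeta>) (prm p C')"
  using assms(1,2)
proof (induction rule: xstep.induct)
  case (tau P Q E H)
  then show ?case
    using step_map[OF tau(1) _ inj_prm_trn[OF p]] by (auto simp: map_lab_Plain intro: xstep.tau)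
next
  case (tr_tau P k \<sigma> Q E H)
  then have t: "flat P" "sym E" "trans E" by simp_all
  have "step (map_tm id (prm_trn p) P) (Tr (InT k) Tau) (map_sub (prm_trn p) \<sigma>) (map_tm id (prm_trn p) Q)"
    using step_map[OF tr_tau(1) t(1) inj_prm_trn[OF p]] by (simp only: map_lab_Tr prm_trn_simps)
  from xstep.tr_tau[OF this fresh_trn_prm[OF p tr_tau(2), unfolded prm_trn_simps], of s] show ?case
    by (simp only: prm.simps prm_lab.simps sub_rel_map[OF inj_prm_trn[OF p] t(2,3)])
next
  case (new P k Q E H)
  then have t: "flat P" by simp
  have "reconf (map_tm id (prm_trn p) P) (New (InT k)) (map_tm id (prm_trn p) Q)"
    using reconf_map[OF new(1) t inj_prm_trn[OF p]] by (simp only: rlab.map prm_trn_simps)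
  from xstep.new[OF this] show ?case
    using fresh_trn_prm[OF p new(2)] by (simp only: prm.simps prm_lab.simps prm_trn_simps)
next
  case (commit P k Q E H)
  then have t: "flat P" by simp
  have "reconf (map_tm id (prm_trn p) P) (Commit (prm_trn p k)) (map_tm id (prm_trn p) Q)"
    using reconf_map[OF commit(2) t inj_prm_trn[OF p]] by (simp only: rlab.map)
  from xstep.commit[OF commit(1) this, of "map_prod (prm_trn p) (prm_trn p) ` E" "prm_hist p H"] show ?case
    by (simp only: prm.simps prm_lab.simps mark_prm[OF p] hist_entry.map)
next
  case (commit_ext P k Q E H)
  then have t: "flat P" by simp
  have "reconf (map_tm id (prm_trn p) P) (Commit (prm_trn p k)) (map_tm id (prm_trn p) Q)"
    using reconf_map[OF commit_ext(2) t inj_prm_trn[OF p]] by (simp only: rlab.map)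
  from xstep.commit_ext[OF commit_ext(1) this, of "map_prod (prm_trn p) (prm_trn p) ` E" "prm_hist p H"] show ?case
    using commit_ext(3)
    by (simp only: prm.simps prm_lab.simps mark_prm[OF p] hist_entry.map ext_class_prm[OF p] image_is_empty simp_thms)
next
  case (commit_int P k Q E H)
  then have t: "flat P" by simp
  have "reconf (map_tm id (prm_trn p) P) (Commit (prm_trn p k)) (map_tm id (prm_trn p) Q)"
    using reconf_map[OF commit_int(2) t inj_prm_trn[OF p]] by (simp only: rlab.map)
  from xstep.commit_int[OF commit_int(1) this, of "map_prod (prm_trn p) (prm_trn p) ` E" "prm_hist p H"] show ?case
    using commit_int(3)
    by (simp only: prm.simps prm_lab.simps mark_prm[OF p] hist_entry.map ext_class_prm[OF p] image_is_empty simp_thms)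
next
  case (abort P k Q E H)
  then have t: "flat P" by simp
  have "reconf (map_tm id (prm_trn p) P) (Abort (prm_trn p k)) (map_tm id (prm_trn p) Q)"
    using reconf_map[OF abort(1) t inj_prm_trn[OF p]] by (simp only: rlab.map)
  from xstep.abort[OF this, of s "map_prod (prm_trn p) (prm_trn p) ` E" "prm_hist p H"] show ?case
    by (simp only: prm.simps prm_lab.simps mark_prm[OF p] hist_entry.map)
next
  case (act P k a \<sigma> Q E H i)
  then have t: "flat P" "sym E" "trans E" by simp_all
  have "step (map_tm id (prm_trn p) P) (Tr (ExT (p k)) (Vis a)) (map_sub (prm_trn p) \<sigma>) (map_tm id (prm_trn p) Q)"
    using step_map[OF act(1) t(1) inj_prm_trn[OF p]] by (simp only: map_lab_Tr prm_trn_simps)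
  from xstep.act[OF this fresh_trn_prm[OF p act(2), unfolded prm_trn_simps], of i s] show ?case
    using act(3)
    by (simp only: prm.simps prm_lab.simps prm_hist_upd dom_prm_hist hist_entry.map act.map_id
        sub_rel_map[OF inj_prm_trn[OF p] t(2,3)] simp_thms)
next
  case (act_ab k E H P i a)
  have "ExT (p k) \<notin> ftn (map_tm id (prm_trn p) P)"
    using act_ab(2) inj_image_mem_iff[OF inj_prm_trn[OF p], of "ExT k" "ftn P"] by (simp add: tm.set_map)
  from xstep.act_ab[OF fresh_trn_prm[OF p act_ab(1), unfolded prm_trn_simps] this, of i s a] show ?case
    using act_ab(3)
    by (simp only: prm.simps prm_lab.simps prm_trn_simps prm_hist_upd dom_prm_hist hist_entry.map
        image_insert map_prod_simp simp_thms)
qed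

lemma xtaus_prm:
  assumes "xtaus s C C'" "tame C" "inj p"
  shows "xtaus s (prm p C) (prm p C') \<and> tame C'"
  using assms(1) unfolding xtaus_def
proof (induction rule: rtranclp_induct)
  case (step C1 C2)
  then show ?case
    using xstep_prm[OF step(2) _ assms(3)] tame_xstep[OF step(2)]
    by (auto intro: rtranclp.rtrancl_into_rtrancl)
qed (simp add: assms(2))

lemma xweak_prm:
  assumes "xweak s C \<zeta> C'" "tame C" "inj p"
  shows "xweak s (prm p C) (prm_lab p \<zeta>) (prm p C') \<and> tame C'"
proof (cases "\<zeta> = XTau")
  case True
  then show ?thesis using xtaus_prm assms by (simp add: xweak_def)
next
  case False
  then obtain C1 C2 where C: "xtaus s C C1" "xstep s C1 \<zeta> C2" "xtaus s C2 C'"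
    using assms(1) by (auto simp: xweak_def)
  have "prm_lab p \<zeta> \<noteq> XTau" using False by (cases \<zeta>) auto
  moreover note 1 = xtaus_prm[OF C(1) assms(2,3)]
  moreover note 2 = xstep_prm[OF C(2) conjunct2[OF 1] assms(3)]
  moreover note 3 = xtaus_prm[OF C(3) tame_xstep[OF C(2) conjunct2[OF 1]] assms(3)]
  ultimately show ?thesis unfolding xweak_def by (simp only: if_False) blast
qed

lemma tame_prm: "inj p \<Longrightarrow> tame C \<Longrightarrow> tame (prm p C)"
  by (cases C) (simp add: sym_map trans_map inj_prm_trn flat_map_tm)

lemma prm_prm:
  fixes C :: "('n, 'i, 'x) conf"
  assumes "\<And>k. p (p k) = k"
  shows "prm p (prm p C) = C"
proof (cases C)
  case (fields E H P)
  have t: "prm_trn p (prm_trn p t) = t" for t :: "('i, 'x) trn" by (cases t) (simp_all add: assms)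
  have u: "map_hist_entry id p (map_hist_entry id p u) = u" for u :: "('n, 'x) hist_entry"
    by (cases u) (simp_all only: hist_entry.map assms act.map_id)
  have "map_prod (prm_trn p) (prm_trn p) ` map_prod (prm_trn p) (prm_trn p) ` E = E"
    unfolding image_image by (rule HOL.trans[OF image_cong[OF HOL.refl] image_ident]) (auto simp: t)
  moreover have "prm_hist p (prm_hist p H) = H"
    unfolding prm_hist_def by (rule ext) (simp add: option.map_comp comp_def u option.map_ident)
  moreover have "map_tm id (prm_trn p) (map_tm id (prm_trn p) P) = P"
    unfolding tm.map_comp by (rule tm.map_ident_strong) (simp_all add: t)
  ultimately show ?thesis using fields by simp
qed

text \<open>In a coherent configuration the external names of the relation and of the process all
  occur in the history, so fixing the latter fixes everything.\<close>

lemma prm_ident: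
  assumes "coherent C" "\<And>k. k \<in> names C \<Longrightarrow> p k = k"
  shows "prm p C = C"
proof (cases C)
  case (fields E H P)
  then have C: "coherent (E, H, P)" and p: "\<And>k. k \<in> htrn H \<Longrightarrow> p k = k" using assms by simp_all
  have t: "prm_trn p t = t" if "(t, t') \<in> E \<or> (t', t) \<in> E" for t t'
    using that p coherent_names[OF C] by (cases t) auto
  have "map_prod (prm_trn p) (prm_trn p) ` E = id ` E"
    by (rule image_cong[OF HOL.refl]) (use t in \<open>fastforce simp: map_prod_def\<close>)
  moreover have "prm_hist p H = H"
  proof
    fix i
    show "prm_hist p H i = H i"
    proof (cases "H i")
      case (Some u)
      then have "entry_trn u \<in> htrn H" by (auto simp: htrn_def intro: ranI)
      with Some p show ?thesis by (cases u) (simp_all add: prm_hist_def act.map_id act.map_ident)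
    qed (simp add: prm_hist_def)
  qed
  moreover have "map_tm id (prm_trn p) P = P"
  proof (rule tm.map_ident_strong)
    fix t assume "t \<in> ftn P"
    then show "prm_trn p t = t" using p coherentD(5)[OF C] by (cases t rule: trn.exhaust) auto
  qed simp
  ultimately show ?thesis using fields by simp
qed

section \<open>Invariance of literal-free formulae under renaming\<close>

primrec nolit :: "('n, 'x, 'm) form \<Rightarrow> bool" where
  "nolit (DiaTau \<phi>) \<longleftrightarrow> nolit \<phi>"
| "nolit (DiaAct x a \<phi>) \<longleftrightarrow> nolit \<phi>"
| "nolit (Neg \<phi>) \<longleftrightarrow> nolit \<phi>"
| "nolit (Conj M f) \<longleftrightarrow> (\<forall>i\<in>M. nolit (f i))"
| "nolit (HasCo v) \<longleftrightarrow> v \<in> range Vr"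
| "nolit (EqCo v w) \<longleftrightarrow> v \<in> range Vr \<and> w \<in> range Vr"
| "nolit (DiaCo K \<phi>) \<longleftrightarrow> K \<subseteq> range Vr \<and> nolit \<phi>"

lemma nval_prm: "v \<in> range Vr \<Longrightarrow> nval (p \<circ> e) v = p (nval e v)"
  by auto

lemma committed_prm: "committed (prm p C) = p ` committed C"
  by (cases C) (simp add: hasco_prm)

lemma fst_prm: "fst (prm p C) = map_prod (prm_trn p) (prm_trn p) ` fst C"
  by (cases C) simp

text \<open>Involutions suffice, as only transpositions are applied later, and they let the same
  transport of transitions serve both directions.\<close>

lemma esat_prm:
  fixes C :: "('n, 'i, 'x) conf"
  assumes p: "\<And>k. p (p k) = k"
  shows "nolit \<phi> \<Longrightarrow> tame C \<Longrightarrow> esat s \<phi> (p \<circ> e) (prm p C) \<longleftrightarrow> esat s \<phi> e C"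
proof (induction \<phi> arbitrary: C e)
  have inj: "inj p" using p by (rule inj_on_inverseI)
  have pp: "prm p (prm p C) = C" for C :: "('n, 'i, 'x) conf" by (rule prm_prm) (rule p)
  \<comment> \<open>Common core of the three modalities. For the direction back to \<open>C\<close>,
    the transition is renamed once more, which undoes the first renaming.\<close>
  have dia: "(\<exists>C'. xweak s (prm p C) (prm_lab p \<zeta>) C' \<and> \<Phi>' C') \<longleftrightarrow> (\<exists>C'. xweak s C \<zeta> C' \<and> \<Phi> C')"
    if "tame C" "\<And>C'. tame C' \<Longrightarrow> \<Phi>' (prm p C') \<longleftrightarrow> \<Phi> C'" for C :: "('n, 'i, 'x) conf" and \<zeta> \<Phi> \<Phi>'
  proof
    assume "\<exists>C'. xweak s C \<zeta> C' \<and> \<Phi> C'"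
    then show "\<exists>C'. xweak s (prm p C) (prm_lab p \<zeta>) C' \<and> \<Phi>' C'"
      using xweak_prm[OF _ that(1) inj] that(2) by blast
  next
    assume "\<exists>C'. xweak s (prm p C) (prm_lab p \<zeta>) C' \<and> \<Phi>' C'"
    then obtain C' where C': "xweak s (prm p C) (prm_lab p \<zeta>) C'" "\<Phi>' C'" by blast
    have ll: "prm_lab p (prm_lab p \<zeta>) = \<zeta>" by (cases \<zeta>) (simp_all add: p image_image)
    have "xweak s C \<zeta> (prm p C') \<and> tame C'"
      using xweak_prm[OF C'(1) tame_prm[OF inj that(1)] inj] by (simp add: ll pp)
    moreover from this have "\<Phi> (prm p C')"
      using that(2)[of "prm p C'"] C'(2) by (simp add: pp tame_prm[OF inj])
    ultimately show "\<exists>C'. xweak s C \<zeta> C' \<and> \<Phi> C'" by blast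
  qed
  {
    case (DiaTau \<phi>)
    have "esat s \<phi> (p \<circ> e) (prm p C') \<longleftrightarrow> esat s \<phi> e C'" if "tame C'" for C' :: "('n, 'i, 'x) conf"
      using DiaTau.prems(1) that by (intro DiaTau.IH) simp_all
    from dia[where \<Phi>' = "esat s \<phi> (p \<circ> e)" and \<Phi> = "esat s \<phi> e" and \<zeta> = XTau, OF DiaTau.prems(2) this] show ?case
      by (simp only: esat.simps prm_lab.simps xweak_def if_True simp_thms)
  next
    case (DiaAct x a \<phi>)
    let ?G = "\<lambda>l. \<exists>C'. xweak s C (XAct l a) C' \<and> esat s \<phi> (e(x := l)) C'"
    let ?G' = "\<lambda>l. \<exists>C'. xweak s (prm p C) (XAct l a) C' \<and> esat s \<phi> ((p \<circ> e)(x := l)) C'"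
    \<comment> \<open>Renaming permutes the names witnessing the modality, and the image of a
      cofinite set is again cofinite.\<close>
    have G: "?G' (p l) \<longleftrightarrow> ?G l" for l
    proof -
      have "(p \<circ> e)(x := p l) = p \<circ> e(x := l)" by auto
      then show ?thesis
        using dia[where \<Phi>' = "esat s \<phi> (p \<circ> e(x := l))" and \<Phi> = "esat s \<phi> (e(x := l))" and \<zeta> = "XAct l a",
            OF DiaAct.prems(2) DiaAct.IH] DiaAct.prems(1)
        by (simp only: nolit.simps prm_lab.simps simp_thms)
    qed
    have cof: "finite (- N) \<Longrightarrow> finite (- (p ` N))" for N
    proof -
      have "- (p ` N) = p ` (- N)"
        using bij_image_Compl_eq[OF o_bij[of p p]] p by (simp add: fun_eq_iff)
      then show "finite (- N) \<Longrightarrow> finite (- (p ` N))" by simp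
    qed
    have "(\<exists>N. finite (- N) \<and> (\<forall>l\<in>N. ?G' l)) \<longleftrightarrow> (\<exists>N. finite (- N) \<and> (\<forall>l\<in>N. ?G l))"
    proof
      assume "\<exists>N. finite (- N) \<and> (\<forall>l\<in>N. ?G l)"
      then obtain N where N: "finite (- N)" "\<forall>l\<in>N. ?G l" by blast
      then have "\<forall>l \<in> p ` N. ?G' l" using G by simp
      with cof[OF N(1)] show "\<exists>N. finite (- N) \<and> (\<forall>l\<in>N. ?G' l)" by blast
    next
      assume "\<exists>N. finite (- N) \<and> (\<forall>l\<in>N. ?G' l)"
      then obtain N where N: "finite (- N)" "\<forall>l\<in>N. ?G' l" by blast
      then have "\<forall>l \<in> p ` N. ?G l" using G p by (metis imageE)
      with cof[OF N(1)] show "\<exists>N. finite (- N) \<and> (\<forall>l\<in>N. ?G l)" by blast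
    qed
    then show ?case by (simp only: esat.simps)
  next
    case (Neg \<phi>)
    then show ?case by simp
  next
    case (Conj M f)
    then show ?case by simp
  next
    case (HasCo v)
    then show ?case
      by (simp only: esat.simps nolit.simps nval_prm committed_prm inj_image_mem_iff[OF inj])
  next
    case (EqCo v w)
    have "(ExT (p k), ExT (p l)) \<in> fst (prm p C) \<longleftrightarrow> (ExT k, ExT l) \<in> fst C" for k l
      using map_prod_mem[OF inj_prm_trn[OF inj], of "ExT k" "ExT l" "fst C"] by (simp add: fst_prm)
    with EqCo show ?case
      by (simp only: esat.simps nolit.simps nval_prm committed_prm inj_image_mem_iff[OF inj])
  next
    case (DiaCo K \<phi>)
    have "nval (p \<circ> e) ` K = p ` nval e ` K"
      unfolding image_image using DiaCo.prems by (intro image_cong[OF HOL.refl] nval_prm) auto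
    then show ?case
      using dia[where \<Phi>' = "esat s \<phi> (p \<circ> e)" and \<Phi> = "esat s \<phi> e" and \<zeta> = "XCo (nval e ` K)",
          OF DiaCo.prems(2) DiaCo.IH] DiaCo.prems(1)
      by (simp only: esat.simps nolit.simps prm_lab.simps simp_thms)
  }
qed


section \<open>Commits in the two kinds of transitions\<close>

text \<open>Related names stay related, and names that commit together are related beforehand. This
  is what later forbids committing only a part of such a class.\<close>

lemma xstep_linked:
  assumes "xstep s C \<zeta> C'" "tame C"
  shows "fst C \<subseteq> fst C' \<and>
    (\<forall>L. \<zeta> = XCo L \<longrightarrow> (\<forall>k\<in>L. \<forall>k'\<in>L. (ExT k, ExT k') \<in> fst C))"
  using assms
proof (induction rule: xstep.induct)
  case (tr_tau P k \<sigma> Q E H)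
  then show ?case by (cases \<sigma>) auto
next
  case (act P k a \<sigma> Q E H i)
  then show ?case by (cases \<sigma>) auto
next
  case (commit_ext P k Q E H)
  then have "sym E" "trans E" by simp_all
  then have "(ExT l, ExT l') \<in> E" if "l \<in> ext_class E k" "l' \<in> ext_class E k" for l l'
    using that unfolding ext_class_def by (blast dest: symD transD)
  then show ?case by simp
qed auto

lemma xtaus_linked:
  assumes "xtaus s C C'" "tame C"
  shows "fst C \<subseteq> fst C'"
proof -
  have "tame C' \<and> fst C \<subseteq> fst C'"
    using assms(1) unfolding xtaus_def
  proof (induction rule: rtranclp_induct)
    case (step C1 C2)
    then show ?case using xstep_linked[OF step(2)] tame_xstep[OF step(2)] by blast
  qed (simp add: assms(2))
  then show ?thesis ..
qed

lemma xtaus_ComSens: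
  assumes "xtaus ComSens C C'" "coherent C"
  shows "coherent C'" "names C' = names C" "committed C' = committed C" "classes C' = classes C"
proof -
  have "coherent C' \<and> names C' = names C \<and> committed C' = committed C \<and> classes C' = classes C"
    using assms(1) unfolding xtaus_def
  proof (induction rule: rtranclp_induct)
    case (step C1 C2)
    then show ?case using xstep_ComSens[OF step(2)] by simp
  qed (simp add: assms(2))
  then show "coherent C'" "names C' = names C" "committed C' = committed C" "classes C' = classes C"
    by simp_all
qed

lemma xweak_ComSens:
  assumes "xweak ComSens C \<zeta> C'" "coherent C"
  shows "coherent C' \<and> (case \<zeta> of
      XTau \<Rightarrow> names C' = names C \<and> committed C' = committed C \<and> classes C' = classes C
    | XAct l a \<Rightarrow> l \<notin> names C \<and> names C' = insert l (names C) \<and>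
        committed C' = committed C \<and> classes C' = classes C
    | XCo L \<Rightarrow> L \<noteq> {} \<and> L \<subseteq> names C \<and> L \<inter> committed C = {} \<and> names C' = names C \<and>
        committed C' = committed C \<union> L \<and> classes C' = insert L (classes C))"
proof (cases "\<zeta> = XTau")
  case True
  then show ?thesis using assms xtaus_ComSens[of C C'] by (simp add: xweak_def)
next
  case False
  then obtain C1 C2 where C: "xtaus ComSens C C1" "xstep ComSens C1 \<zeta> C2" "xtaus ComSens C2 C'"
    using assms(1) by (auto simp: xweak_def)
  note 1 = xtaus_ComSens[OF C(1) assms(2)]
  note 2 = xstep_ComSens[OF C(2) 1(1)]
  note 3 = xtaus_ComSens[OF C(3) conjunct1[OF 2]]
  show ?thesis using 2 unfolding 1 3 using 3(1) by (cases \<zeta>) simp_all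
qed

lemma xstep_Ext:
  assumes "xstep Ext C \<zeta> C'" "coherent C"
  shows "coherent C' \<and> committed C \<subseteq> committed C' \<and> (case \<zeta> of
      XTau \<Rightarrow> names C' = names C
    | XAct l a \<Rightarrow> l \<notin> names C \<and> names C' = insert l (names C)
    | XCo L \<Rightarrow> False)"
  using assms(1)
proof (cases rule: xstep_Ext_cases)
  case 1
  have "\<zeta> \<noteq> XCo L" for L using assms(1) by (auto elim: xstep.cases)
  with xstep_ComSens[OF 1 assms(2)] show ?thesis by (cases \<zeta>) auto
next
  case (2 L)
  with xstep_ComSens[OF 2(2) assms(2)] show ?thesis by auto
qed

lemma xtaus_Ext:
  assumes "xtaus Ext C C'" "coherent C"
  shows "coherent C'" "names C' = names C" "committed C \<subseteq> committed C'"
proof -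
  have "coherent C' \<and> names C' = names C \<and> committed C \<subseteq> committed C'"
    using assms(1) unfolding xtaus_def
  proof (induction rule: rtranclp_induct)
    case (step C1 C2)
    then show ?case using xstep_Ext[OF step(2)] by auto
  qed (simp add: assms(2))
  then show "coherent C'" "names C' = names C" "committed C \<subseteq> committed C'" by simp_all
qed

lemma xweak_Ext:
  assumes "xweak Ext C \<zeta> C'" "coherent C"
  shows "coherent C' \<and> (case \<zeta> of
      XTau \<Rightarrow> names C' = names C
    | XAct l a \<Rightarrow> l \<notin> names C \<and> names C' = insert l (names C)
    | XCo L \<Rightarrow> False)"
proof (cases "\<zeta> = XTau")
  case True
  then show ?thesis using assms xtaus_Ext[of C C'] by (simp add: xweak_def)
next
  case False
  then obtain C1 C2 where C: "xtaus Ext C C1" "xstep Ext C1 \<zeta> C2" "xtaus Ext C2 C'"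
    using assms(1) by (auto simp: xweak_def)
  note 1 = xtaus_Ext[OF C(1) assms(2)]
  note 2 = xstep_Ext[OF C(2) 1(1)]
  note 3 = xtaus_Ext[OF C(3) conjunct1[OF 2]]
  show ?thesis using 2 unfolding 1 3 using 3(1) by (cases \<zeta>) simp_all
qed

lemma coherent_xweak: "xweak s C \<zeta> C' \<Longrightarrow> coherent C \<Longrightarrow> coherent C'"
  using xweak_Ext xweak_ComSens by (cases s) blast+

lemma coherent_committed:
  assumes "coherent C" "k \<in> committed C" "(ExT k, ExT k') \<in> fst C"
  shows "k' \<in> committed C"
  using assms by (cases C) (simp, rule coherentD(8))

lemma xtaus_refl: "xtaus s C C"
  by (simp add: xtaus_def)

lemma xtaus_trans: "xtaus s C C1 \<Longrightarrow> xtaus s C1 C2 \<Longrightarrow> xtaus s C C2"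
  unfolding xtaus_def by (rule rtranclp_trans)

lemma xtaus_step: "xstep s C XTau C' \<Longrightarrow> xtaus s C C'"
  unfolding xtaus_def by blast

lemma xtaus_ExtI: "xtaus ComSens C C' \<Longrightarrow> xtaus Ext C C'"
  unfolding xtaus_def
proof (induction rule: rtranclp_induct)
  case (step C1 C2)
  from xstep_ExtI[OF step(2)] have "xstep Ext C1 XTau C2" by simp
  with step(3) show ?case by (rule rtranclp.rtrancl_into_rtrancl)
qed simp

lemma xweakI:
  "xtaus s C C1 \<Longrightarrow> xstep s C1 \<zeta> C2 \<Longrightarrow> xtaus s C2 C' \<Longrightarrow> \<zeta> \<noteq> XTau \<Longrightarrow> xweak s C \<zeta> C'"
  unfolding xweak_def by (simp only: if_False) blast

lemma xweakE:
  assumes "xweak s C \<zeta> C'" "\<zeta> \<noteq> XTau"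
  obtains C1 C2 where "xtaus s C C1" "xstep s C1 \<zeta> C2" "xtaus s C2 C'"
  using assms unfolding xweak_def by (simp only: if_False) blast

lemma xweak_XAct_ExtI:
  assumes "xweak ComSens C (XAct l a) C'"
  shows "xweak Ext C (XAct l a) C'"
proof -
  obtain C1 C2 where C: "xtaus ComSens C C1" "xstep ComSens C1 (XAct l a) C2" "xtaus ComSens C2 C'"
    using assms by (rule xweakE) simp
  from xstep_ExtI[OF C(2)] have "xstep Ext C1 (XAct l a) C2" by simp
  with xtaus_ExtI[OF C(1)] show ?thesis using xtaus_ExtI[OF C(3)] by (rule xweakI) simp
qed

text \<open>Splits an extended run at its first commit that is labelled in the commit-sensitive
  transitions, if there is one.\<close>

lemma xtaus_Ext_decomp:
  assumes "xtaus Ext C C'"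
  shows "xtaus ComSens C C' \<or>
    (\<exists>C1 L C2. xtaus ComSens C C1 \<and> xstep ComSens C1 (XCo L) C2 \<and> xtaus Ext C2 C')"
  using assms unfolding xtaus_def[of Ext]
proof (induction rule: converse_rtranclp_induct)
  case base
  show ?case by (simp add: xtaus_refl)
next
  case (step C C1)
  from step(1) show ?case
  proof (cases rule: xstep_Ext_cases)
    case 1
    then show ?thesis using step(3) xtaus_trans[OF xtaus_step[OF 1]] by blast
  next
    case (2 L)
    then show ?thesis using step(2) xtaus_refl unfolding xtaus_def[of Ext] by blast
  qed
qed

text \<open>A labelled commit strictly enlarges the committed set, which never shrinks again. Hence
  an extended run that ends with the same committed set has no labelled commit.\<close>

lemma xtaus_ComSens_iff:
  assumes "coherent C"
  shows "xtaus ComSens C C' \<longleftrightarrow> xtaus Ext C C' \<and> committed C' = committed C"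
proof
  assume "xtaus ComSens C C'"
  then show "xtaus Ext C C' \<and> committed C' = committed C"
    using xtaus_ComSens(3) xtaus_ExtI assms by blast
next
  assume *: "xtaus Ext C C' \<and> committed C' = committed C"
  then consider "xtaus ComSens C C'"
    | C1 L C2 where "xtaus ComSens C C1" "xstep ComSens C1 (XCo L) C2" "xtaus Ext C2 C'"
    using xtaus_Ext_decomp by blast
  then show "xtaus ComSens C C'"
  proof cases
    case 2
    note 1 = xtaus_ComSens[OF 2(1) assms]
    have "coherent C2" "L \<noteq> {}" "L \<inter> committed C = {}" "committed C2 = committed C \<union> L"
      using xstep_ComSens[OF 2(2) 1(1)] by (simp_all add: 1)
    moreover from this have "committed C2 \<subseteq> committed C'" using xtaus_Ext[OF 2(3)] by blast
    ultimately show ?thesis using * by blast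
  qed
qed

lemma xweak_XAct_ComSens_iff:
  assumes "coherent C"
  shows "xweak ComSens C (XAct l a) C' \<longleftrightarrow> xweak Ext C (XAct l a) C' \<and> committed C' = committed C"
proof
  assume w: "xweak ComSens C (XAct l a) C'"
  then have "xweak Ext C (XAct l a) C'" by (rule xweak_XAct_ExtI)
  then show "xweak Ext C (XAct l a) C' \<and> committed C' = committed C"
    using xweak_ComSens[OF w assms] by simp
next
  assume *: "xweak Ext C (XAct l a) C' \<and> committed C' = committed C"
  then obtain C1 C2 where C: "xtaus Ext C C1" "xstep Ext C1 (XAct l a) C2" "xtaus Ext C2 C'"
    unfolding xweak_def by auto
  note 1 = xtaus_Ext[OF C(1) assms]
  note 2 = xstep_Ext[OF C(2) 1(1)]
  note 3 = xtaus_Ext[OF C(3) conjunct1[OF 2]]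
  from C(2) have c: "xstep ComSens C1 (XAct l a) C2" by (cases rule: xstep_Ext_cases) auto
  have "committed C1 = committed C" "committed C' = committed C2" using 1(3) 2 3(3) * by auto
  then have "xtaus ComSens C C1" "xtaus ComSens C2 C'"
    using C assms 2 xtaus_ComSens_iff by blast+
  from xweakI[OF this(1) c this(2)] show "xweak ComSens C (XAct l a) C'" by simp
qed

text \<open>
  A class that commits in one transition can be told from a union of classes: before the commit, no
  configuration can be reached in which only a part of it is committed.
\<close>

lemma xweak_XCo_iff:
  assumes C: "coherent C" and L: "L \<noteq> {}"
  shows "xweak ComSens C (XCo L) C' \<longleftrightarrow> L \<inter> committed C = {} \<and>
    (\<exists>C1. xtaus Ext C C1 \<and> committed C1 = committed C \<and>
      \<not> (\<exists>C2. xtaus Ext C1 C2 \<and> committed C \<subset> committed C2 \<and> committed C2 \<subset> committed C \<union> L) \<and>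
      xtaus Ext C1 C' \<and> committed C' = committed C \<union> L)"
proof
  assume w: "xweak ComSens C (XCo L) C'"
  then obtain C1 Cb where s: "xtaus ComSens C C1" "xstep ComSens C1 (XCo L) Cb" "xtaus ComSens Cb C'"
    unfolding xweak_def by auto
  note 1 = xtaus_ComSens[OF s(1) C]
  have "xtaus Ext C1 C2 \<Longrightarrow> committed C \<subset> committed C2 \<Longrightarrow> committed C2 \<subset> committed C \<union> L \<Longrightarrow> False" for C2
  proof -
    assume C2: "xtaus Ext C1 C2" "committed C \<subset> committed C2" "committed C2 \<subset> committed C \<union> L"
    \<comment> \<open>One committed \<open>k\<close> in \<open>L\<close> is enough: all of
      \<open>L\<close> is related to \<open>k\<close> already in \<open>C1\<close>, hence in
      \<open>C2\<close>, and commitment spreads over classes.\<close>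
    then obtain k where k: "k \<in> L" "k \<in> committed C2" by blast
    have "(ExT k, ExT k') \<in> fst C2" if "k' \<in> L" for k'
    proof -
      have "\<forall>k\<in>L. \<forall>k'\<in>L. (ExT k, ExT k') \<in> fst C1"
        using conjunct2[OF xstep_linked[OF s(2) tame_if_coherent[OF 1(1)]], THEN spec[of _ L]]
        by (simp only: simp_thms)
      then have "(ExT k, ExT k') \<in> fst C1" using k(1) that by blast
      then show ?thesis using xtaus_linked[OF C2(1) tame_if_coherent[OF 1(1)]] by (rule subsetD[rotated])
    qed
    moreover have "coherent C2" using xtaus_Ext[OF C2(1) 1(1)] by blast
    ultimately have "L \<subseteq> committed C2"
      using coherent_committed[OF _ k(2)] by blast
    with C2 show False by blast
  qed
  then have no: "\<not> (\<exists>C2. xtaus Ext C1 C2 \<and> committed C \<subset> committed C2 \<and> committed C2 \<subset> committed C \<union> L)"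
    by (intro notI) (elim exE conjE)
  have reach: "xtaus Ext C1 C'"
    using xtaus_step[OF xstep_ExtI[OF s(2), simplified]] xtaus_ExtI[OF s(3)] by (rule xtaus_trans)
  show "L \<inter> committed C = {} \<and>
    (\<exists>C1. xtaus Ext C C1 \<and> committed C1 = committed C \<and>
      \<not> (\<exists>C2. xtaus Ext C1 C2 \<and> committed C \<subset> committed C2 \<and> committed C2 \<subset> committed C \<union> L) \<and>
      xtaus Ext C1 C' \<and> committed C' = committed C \<union> L)"
  proof (intro conjI exI[of _ C1])
    show "L \<inter> committed C = {}" "committed C' = committed C \<union> L"
      using xweak_ComSens[OF w C] by simp_all
  qed (fact xtaus_ExtI[OF s(1)] 1(3) no reach)+
next
  assume "L \<inter> committed C = {} \<and>
    (\<exists>C1. xtaus Ext C C1 \<and> committed C1 = committed C \<and>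
      \<not> (\<exists>C2. xtaus Ext C1 C2 \<and> committed C \<subset> committed C2 \<and> committed C2 \<subset> committed C \<union> L) \<and>
      xtaus Ext C1 C' \<and> committed C' = committed C \<union> L)"
  then obtain C1 where disj: "L \<inter> committed C = {}"
    and C1: "xtaus Ext C C1" "committed C1 = committed C" "xtaus Ext C1 C'" "committed C' = committed C \<union> L"
    and no: "\<not> (\<exists>C2. xtaus Ext C1 C2 \<and> committed C \<subset> committed C2 \<and> committed C2 \<subset> committed C \<union> L)"
    by (elim conjE exE)
  have cC1: "xtaus ComSens C C1" using xtaus_ComSens_iff[OF C] C1(1,2) by blast
  note 1 = xtaus_ComSens[OF cC1 C]
  \<comment> \<open>The committed set grows between \<open>C1\<close> and \<open>C'\<close>, so the
    run has a first labelled commit, of some \<open>L1\<close>.\<close>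
  have "\<not> xtaus ComSens C1 C'"
  proof
    assume "xtaus ComSens C1 C'"
    from xtaus_ComSens(3)[OF this 1(1)] C1(2,4) disj L show False by blast
  qed
  then obtain Ca L1 Cb where s: "xtaus ComSens C1 Ca" "xstep ComSens Ca (XCo L1) Cb" "xtaus Ext Cb C'"
    using xtaus_Ext_decomp[OF C1(3)] by blast
  note a = xtaus_ComSens[OF s(1) 1(1)]
  have b: "coherent Cb" "L1 \<noteq> {}" "L1 \<inter> committed C = {}" "committed Cb = committed C \<union> L1"
    using xstep_ComSens[OF s(2) a(1)] by (simp_all add: a 1)
  have "xtaus Ext C1 Cb"
    using xtaus_ExtI[OF s(1)] xtaus_step[OF xstep_ExtI[OF s(2), simplified]] by (rule xtaus_trans)
  \<comment> \<open>The configuration right after the first commit is reachable from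
    \<open>C1\<close>; as no proper nonempty part of \<open>L\<close> can be committed there,
    \<open>L1\<close> must be all of \<open>L\<close>.\<close>
  with no have no': "\<not> (committed C \<subset> committed C \<union> L1 \<and> committed C \<union> L1 \<subset> committed C \<union> L)"
    unfolding b(4)[symmetric] by blast
  have "committed C \<union> L1 \<subseteq> committed C \<union> L"
    using xtaus_Ext(3)[OF s(3) b(1)] unfolding b(4) C1(4) .
  with b(3) have "L1 \<subseteq> L" by blast
  moreover have "L \<subseteq> L1"
  proof
    fix k assume "k \<in> L"
    show "k \<in> L1"
    proof (rule ccontr)
      assume "k \<notin> L1"
      with \<open>k \<in> L\<close> disj have "committed C \<union> L1 \<subset> committed C \<union> L"
        using \<open>L1 \<subseteq> L\<close> by blast
      moreover have "committed C \<subset> committed C \<union> L1" using b(2,3) by blast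
      ultimately show False using no' by simp
    qed
  qed
  ultimately have eq: "L1 = L" by (rule equalityI)
  \<comment> \<open>Nothing is left to commit after \<open>L\<close>, so the remaining run is silent
    in the commit-sensitive sense as well.\<close>
  have "committed C' = committed Cb" unfolding b(4) C1(4) eq ..
  with s(3) have "xtaus ComSens Cb C'" unfolding xtaus_ComSens_iff[OF b(1)] ..
  with eq show "xweak ComSens C (XCo L) C'"
    using xweakI[OF xtaus_trans[OF cC1 s(1)] s(2)] by simp
qed

section \<open>Extended runs as sequences of commit labels\<close>

fun xcos :: "'x set list \<Rightarrow> ('n, 'i, 'x) conf \<Rightarrow> ('n, 'i, 'x) conf \<Rightarrow> bool" where
  "xcos [] C C' \<longleftrightarrow> xtaus ComSens C C'"
| "xcos (L # Ls) C C' \<longleftrightarrow> (\<exists>C1. xweak ComSens C (XCo L) C1 \<and> xcos Ls C1 C')"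

lemma xtaus_xweak: "xtaus s C C1 \<Longrightarrow> xweak s C1 \<zeta> C' \<Longrightarrow> xweak s C \<zeta> C'"
  unfolding xweak_def by (auto split: if_splits dest: xtaus_trans) (meson xtaus_trans)

lemma xtaus_xcos: "xtaus ComSens C C1 \<Longrightarrow> xcos Ls C1 C' \<Longrightarrow> xcos Ls C C'"
  by (cases Ls) (auto dest: xtaus_trans xtaus_xweak)

lemma xtaus_Ext_iff_xcos: "xtaus Ext C C' \<longleftrightarrow> (\<exists>Ls. xcos Ls C C')"
proof
  assume "xtaus Ext C C'"
  then show "\<exists>Ls. xcos Ls C C'"
    unfolding xtaus_def
  proof (induction rule: converse_rtranclp_induct)
    case base
    have "xcos [] C' C'" by (simp add: xtaus_refl)
    then show ?case ..
  next
    case (step C C1)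
    then obtain Ls where Ls: "xcos Ls C1 C'" by blast
    from step(1) show ?case
    proof (cases rule: xstep_Ext_cases)
      case 1
      then show ?thesis using Ls xtaus_xcos xtaus_step by blast
    next
      case (2 L)
      have "xweak ComSens C (XCo L) C1" by (rule xweakI[OF xtaus_refl 2(2) xtaus_refl]) simp
      then have "xcos (L # Ls) C C'" unfolding xcos.simps using Ls by (intro exI conjI)
      then show ?thesis ..
    qed
  qed
next
  assume "\<exists>Ls. xcos Ls C C'"
  then obtain Ls where "xcos Ls C C'" ..
  then show "xtaus Ext C C'"
  proof (induction Ls arbitrary: C)
    case Nil
    then show ?case by (auto intro: xtaus_ExtI)
  next
    case (Cons L Ls)
    then obtain C1 where C1: "xweak ComSens C (XCo L) C1" "xtaus Ext C1 C'" by auto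
    then obtain Ca Cb where "xtaus ComSens C Ca" "xstep ComSens Ca (XCo L) Cb" "xtaus ComSens Cb C1"
      unfolding xweak_def by auto
    then have "xtaus Ext C C1"
      using xtaus_ExtI xtaus_trans xtaus_step[OF xstep_ExtI[of _ "XCo L", simplified]] by meson
    then show ?case using C1(2) by (rule xtaus_trans)
  qed
qed

text \<open>The labels of a run determine the committed classes at its end. They are sets of names
  of the history, which bounds the lists of labels to be considered.\<close>

lemma xcos_classes:
  assumes "xcos Ls C C'" "coherent C"
  shows "coherent C' \<and> names C' = names C \<and> classes C' = classes C \<union> set Ls \<and> set Ls \<subseteq> Pow (names C)"
  using assms
proof (induction Ls arbitrary: C)
  case Nil
  then show ?case using xtaus_ComSens[of C C'] by auto
next
  case (Cons L Ls)
  then obtain C1 where C1: "xweak ComSens C (XCo L) C1" "xcos Ls C1 C'" by auto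
  with Cons.IH[OF C1(2)] xweak_ComSens[OF C1(1) Cons.prems(2)] show ?case by auto
qed

lemma xweak_XAct_Ext_iff:
  "xweak Ext C (XAct l a) C' \<longleftrightarrow>
    (\<exists>Ls Ls' C1 C2. xcos Ls C C1 \<and> xweak ComSens C1 (XAct l a) C2 \<and> xcos Ls' C2 C')"
proof
  assume "xweak Ext C (XAct l a) C'"
  then obtain C1 C2 where C: "xtaus Ext C C1" "xstep Ext C1 (XAct l a) C2" "xtaus Ext C2 C'"
    unfolding xweak_def by auto
  from C(2) have "xstep ComSens C1 (XAct l a) C2" by (cases rule: xstep_Ext_cases) auto
  from xweakI[OF xtaus_refl this xtaus_refl] have "xweak ComSens C1 (XAct l a) C2" by simp
  then show "\<exists>Ls Ls' C1 C2. xcos Ls C C1 \<and> xweak ComSens C1 (XAct l a) C2 \<and> xcos Ls' C2 C'"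
    using C(1,3) unfolding xtaus_Ext_iff_xcos by blast
next
  assume "\<exists>Ls Ls' C1 C2. xcos Ls C C1 \<and> xweak ComSens C1 (XAct l a) C2 \<and> xcos Ls' C2 C'"
  then obtain C1 C2 where C: "xtaus Ext C C1" "xweak ComSens C1 (XAct l a) C2" "xtaus Ext C2 C'"
    using xtaus_Ext_iff_xcos by blast
  obtain Ca Cb where "xtaus Ext C1 Ca" "xstep Ext Ca (XAct l a) Cb" "xtaus Ext Cb C2"
    using xweak_XAct_ExtI[OF C(2)] by (rule xweakE) simp
  with C(1,3) have "xtaus Ext C Ca" "xstep Ext Ca (XAct l a) Cb" "xtaus Ext Cb C'"
    using xtaus_trans by blast+
  then show "xweak Ext C (XAct l a) C'" by (rule xweakI) simp
qed


section \<open>Expressible properties\<close>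

text \<open>Iterates an injection of the square of an infinite type into the type.\<close>

lemma inj_lists:
  assumes "infinite (UNIV :: 'x set)"
  obtains h :: "'x list \<Rightarrow> 'x" where "inj h"
proof -
  obtain pr :: "'x \<times> 'x \<Rightarrow> 'x" where pr: "inj pr"
  proof -
    from iffD2[OF card_of_ordIso card_of_Times_same_infinite[OF assms]]
    obtain f :: "'x \<times> 'x \<Rightarrow> 'x" where "bij_betw f (UNIV \<times> UNIV) UNIV" by blast
    then show thesis by (intro that[of f]) (simp add: bij_betw_def)
  qed
  obtain c :: "nat \<Rightarrow> 'x" where c: "inj c"
    using infinite_countable_subset[OF assms] by blast
  \<comment> \<open>The code of the empty list may coincide with the code of a pair, so
    \<open>enc\<close> is used only to compare lists of equal length; the length is then paired with
    it.\<close>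
  define enc where "enc = rec_list (c 0) (\<lambda>x _ y. pr (x, y))"
  have "enc xs = enc ys \<Longrightarrow> xs = ys" if "length xs = length ys" for xs ys
    using that by (induction xs ys rule: list_induct2) (auto simp: enc_def inj_eq[OF pr])
  then have "inj (\<lambda>xs. pr (c (length xs), enc xs))"
    by (intro injI) (simp add: inj_eq[OF pr] inj_eq[OF c])
  then show thesis by (rule that)
qed

text \<open>Used to index disjunctions over cofinite sets of names by names, through the finite
  complements.\<close>

lemma inj_finite_sets:
  assumes "infinite (UNIV :: 'x set)"
  obtains h :: "'x set \<Rightarrow> 'x" where "inj_on h {A. finite A}"
proof -
  obtain h :: "'x list \<Rightarrow> 'x" where h: "inj h" using inj_lists[OF assms] .
  have "set (SOME xs. set xs = A) = A" if "finite A" for A :: "'x set"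
    using finite_list[OF that] by (rule someI_ex)
  then have "inj_on (\<lambda>A. h (SOME xs. set xs = A)) {A. finite A}"
    by (intro inj_onI) (metis (no_types, lifting) h inj_eq mem_Collect_eq)
  then show thesis by (rule that)
qed

text \<open>Variable \<open>j\<close> stands for the history name \<open>r j\<close>. The number
  \<open>n\<close> is therefore also the next variable to bind.\<close>

definition over :: "(nat \<Rightarrow> 'x) \<Rightarrow> nat \<Rightarrow> ('n, 'i, 'x) conf \<Rightarrow> bool" where
  "over r n C \<longleftrightarrow> coherent C \<and> names C = r ` {..<n}"

text \<open>Transposing two names outside the history fixes \<open>C\<close> and the environment
  below \<open>n\<close>, so by invariance all such names behave alike: one of them witnesses the
  modality iff cofinitely many do.\<close>

lemma esat_DiaAct_fresh:
  fixes C :: "('n, 'i, 'x::infinite) conf"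
  assumes C: "over r n C" and \<phi>: "nolit \<phi>" "fvars \<phi> \<subseteq> {..<Suc n}" and l: "l \<notin> r ` {..<n}"
  shows "esat s (DiaAct n a \<phi>) r C \<longleftrightarrow> (\<exists>C'. xweak s C (XAct l a) C' \<and> esat s \<phi> (r(n := l)) C')"
proof -
  let ?G = "\<lambda>l. \<exists>C'. xweak s C (XAct l a) C' \<and> esat s \<phi> (r(n := l)) C'"
  have C': "coherent C" "names C = r ` {..<n}" using C by (simp_all add: over_def)
  have swap: "?G l'" if G: "?G l" and l: "l \<notin> r ` {..<n}" "l' \<notin> r ` {..<n}" for l l'
  proof -
    define p where "p = transpose l l'"
    have p: "\<And>k. p (p k) = k" "inj p" "p l = l'" by (simp_all add: p_def)
    have pr: "p (r j) = r j" if "j < n" for j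
      using l that unfolding p_def by (intro transpose_apply_other) auto
    have pC: "prm p C = C" using pr by (intro prm_ident[OF C'(1)]) (auto simp: C'(2))
    obtain D where D: "xweak s C (XAct l a) D" "esat s \<phi> (r(n := l)) D" using G by blast
    have t: "tame D" and w: "xweak s C (XAct l' a) (prm p D)"
      using xweak_prm[OF D(1) tame_if_coherent[OF C'(1)] p(2)] by (simp_all add: pC p(3))
    have "esat s \<phi> (p \<circ> r(n := l)) (prm p D)"
      using esat_prm[OF p(1) \<phi>(1) t] D(2) by blast
    moreover have "esat s \<phi> (p \<circ> r(n := l)) (prm p D) \<longleftrightarrow> esat s \<phi> (r(n := l')) (prm p D)"
    proof (rule esat_cong)
      fix j assume "j \<in> fvars \<phi>"
      then have "j < n \<or> j = n" using \<phi>(2) by auto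
      then show "(p \<circ> r(n := l)) j = (r(n := l')) j" using pr p(3) by auto
    qed
    ultimately show ?thesis using w by blast
  qed
  show ?thesis
  proof
    assume "esat s (DiaAct n a \<phi>) r C"
    then obtain N where N: "finite (- N)" "\<And>l. l \<in> N \<Longrightarrow> ?G l" unfolding esat.simps by blast
    \<comment> \<open>A cofinite set contains a name outside the finite history.\<close>
    have "finite (- N \<union> r ` {..<n})" using N(1) by simp
    then obtain l' where "l' \<notin> - N \<union> r ` {..<n}" using ex_new_if_finite[OF infinite_UNIV] by blast
    then show "?G l" using swap[of l' l] N(2) l by blast
  next
    assume "?G l"
    then have "\<forall>l' \<in> - (r ` {..<n}). ?G l'" using swap[of l] l by blast
    moreover have "finite (- (- (r ` {..<n})))" by simp
    ultimately show "esat s (DiaAct n a \<phi>) r C" unfolding esat.simps by blast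
  qed
qed

text \<open>\<open>Q\<close> records what is known about the configuration at this point of the
  translation; the formula need be correct only under it.\<close>

definition expresses ::
  "logic_id \<Rightarrow> (nat \<Rightarrow> 'x) \<Rightarrow> nat \<Rightarrow> (('n, 'i, 'x) conf \<Rightarrow> bool) \<Rightarrow> (('n, 'i, 'x) conf \<Rightarrow> bool) \<Rightarrow>
    ('n, 'x, 'm) form \<Rightarrow> bool"
where
  "expresses L r n Q \<Phi> \<phi> \<longleftrightarrow> formula L \<phi> \<and> nolit \<phi> \<and> fvars \<phi> \<subseteq> {..<n} \<and>
     (\<forall>C. over r n C \<longrightarrow> Q C \<longrightarrow> (esat (logic_mode L) \<phi> r C \<longleftrightarrow> \<Phi> C))"

section \<open>Closure properties of expressibility\<close>

locale large_index =
  fixes index :: "'x::infinite \<Rightarrow> 'm"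
  assumes inj_index: "inj index"
begin

definition expressible ::
  "logic_id \<Rightarrow> (nat \<Rightarrow> 'x) \<Rightarrow> nat \<Rightarrow> (('n, 'i, 'x) conf \<Rightarrow> bool) \<Rightarrow> (('n, 'i, 'x) conf \<Rightarrow> bool) \<Rightarrow> bool"
where
  "expressible L r n Q \<Phi> \<longleftrightarrow> (\<exists>\<phi> :: ('n, 'x, 'm) form. expresses L r n Q \<Phi> \<phi>)"

lemma expressible_cong:
  assumes "expressible L r n Q \<Phi>" "\<And>C. over r n C \<Longrightarrow> Q C \<Longrightarrow> \<Psi> C \<longleftrightarrow> \<Phi> C"
  shows "expressible L r n Q \<Psi>"
  using assms unfolding expressible_def expresses_def by blast

lemma expressible_Not:
  assumes "expressible L r n Q \<Phi>"
  shows "expressible L r n Q (\<lambda>C. \<not> \<Phi> C)"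
proof -
  from assms obtain \<phi> :: "('b, 'x, 'm) form" where "expresses L r n Q \<Phi> \<phi>"
    unfolding expressible_def ..
  then have "expresses L r n Q (\<lambda>C. \<not> \<Phi> C) (Neg \<phi>)"
    by (auto simp: expresses_def intro: formula.intros)
  then show ?thesis unfolding expressible_def ..
qed

lemma expressible_Ball:
  fixes g :: "'b \<Rightarrow> 'm" and \<Phi> :: "'b \<Rightarrow> ('n, 'i, 'x) conf \<Rightarrow> bool"
  assumes g: "inj_on g A" and \<Phi>: "\<And>y. y \<in> A \<Longrightarrow> expressible L r n Q (\<Phi> y)"
  shows "expressible L r n Q (\<lambda>C. \<forall>y\<in>A. \<Phi> y C)"
proof -
  from \<Phi> obtain f :: "'b \<Rightarrow> ('n, 'x, 'm) form" where f: "\<And>y. y \<in> A \<Longrightarrow> expresses L r n Q (\<Phi> y) (f y)"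
    unfolding expressible_def by metis
  have "expresses L r n Q (\<lambda>C. \<forall>y\<in>A. \<Phi> y C) (Conj (g ` A) (f \<circ> inv_into A g))"
    using f unfolding expresses_def
    by (auto simp: inv_into_f_f[OF g] intro!: formula.intros)
  then show ?thesis unfolding expressible_def ..
qed

lemma expressible_Bex:
  assumes "inj_on (g :: 'b \<Rightarrow> 'm) A" "\<And>y. y \<in> A \<Longrightarrow> expressible L r n Q (\<Phi> y)"
  shows "expressible L r n Q (\<lambda>C. \<exists>y\<in>A. \<Phi> y C)"
proof -
  have "expressible L r n Q (\<lambda>C. \<not> (\<forall>y\<in>A. \<not> \<Phi> y C))"
    using assms by (intro expressible_Not expressible_Ball) auto
  then show ?thesis by simp
qed

lemma inj_on_countable:
  assumes "countable (A :: 'b set)"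
  obtains g :: "'b \<Rightarrow> 'm" where "inj_on g A"
proof -
  obtain c :: "nat \<Rightarrow> 'x" where "inj c"
    using infinite_countable_subset[OF infinite_UNIV[where 'a = 'x]] by blast
  with inj_index inj_on_to_nat_on[OF assms] have "inj_on (index \<circ> c \<circ> to_nat_on A) A"
    by (intro comp_inj_on) (auto intro: inj_on_subset)
  then show thesis by (rule that)
qed

lemma expressible_countable_Ball:
  assumes "countable (A :: 'b set)" "\<And>y. y \<in> A \<Longrightarrow> expressible L r n Q (\<Phi> y)"
  shows "expressible L r n Q (\<lambda>C. \<forall>y\<in>A. \<Phi> y C)"
proof -
  obtain g :: "'b \<Rightarrow> 'm" where "inj_on g A" using inj_on_countable[OF assms(1)] .
  then show ?thesis using assms(2) by (rule expressible_Ball)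
qed

lemma expressible_countable_Bex:
  assumes "countable (A :: 'b set)" "\<And>y. y \<in> A \<Longrightarrow> expressible L r n Q (\<Phi> y)"
  shows "expressible L r n Q (\<lambda>C. \<exists>y\<in>A. \<Phi> y C)"
proof -
  obtain g :: "'b \<Rightarrow> 'm" where "inj_on g A" using inj_on_countable[OF assms(1)] .
  then show ?thesis using assms(2) by (rule expressible_Bex)
qed

lemma expressible_const: "expressible L r n Q (\<lambda>C. b)"
proof -
  have "expressible L r n Q (\<lambda>C. \<forall>y\<in>{}::nat set. False)"
    by (rule expressible_countable_Ball) auto
  then have T: "expressible L r n Q (\<lambda>C. True)" by simp
  with expressible_Not[OF T] show ?thesis by (cases b) auto
qed

lemma expressible_conj:
  assumes "expressible L r n Q \<Phi>" "expressible L r n Q \<Psi>"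
  shows "expressible L r n Q (\<lambda>C. \<Phi> C \<and> \<Psi> C)"
proof -
  have "expressible L r n Q (\<lambda>C. \<forall>b\<in>{True, False}. (if b then \<Phi> else \<Psi>) C)"
    using assms by (intro expressible_countable_Ball) auto
  then show ?thesis by (rule expressible_cong) auto
qed

lemma expressible_cofinite:
  assumes "\<And>l :: 'x. expressible L r n Q (\<Phi> l)"
  shows "expressible L r n Q (\<lambda>C. \<exists>N. finite (- N) \<and> (\<forall>l\<in>N. \<Phi> l C))"
proof -
  obtain h :: "'x set \<Rightarrow> 'x" where h: "inj_on h {A. finite A}"
    using inj_finite_sets[OF infinite_UNIV] .
  \<comment> \<open>There may be more subsets of \<open>'x\<close> than indices, but cofinite sets
    are coded by their finite complements.\<close>
  have "inj_on (\<lambda>N. index (h (- N))) {N. finite (- N)}"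
    using inj_onD[OF h] by (auto simp: inj_on_def inj_eq[OF inj_index])
  then have "expressible L r n Q (\<lambda>C. \<exists>N\<in>{N. finite (- N)}. \<forall>l\<in>N. \<Phi> l C)"
    by (rule expressible_Bex) (intro expressible_Ball[OF inj_on_subset[OF inj_index subset_UNIV]] assms)
  then show ?thesis by simp
qed

lemma over_xtaus: "over r n C \<Longrightarrow> xtaus s C C' \<Longrightarrow> over r n C'"
  using xtaus_Ext[of C C'] xtaus_ComSens[of C C'] by (cases s) (auto simp: over_def)

lemma over_XAct:
  assumes "over r n C" "xweak s C (XAct l a) C'"
  shows "l \<notin> r ` {..<n}" "over (r(n := l)) (Suc n) C'"
proof -
  have *: "coherent C' \<and> l \<notin> names C \<and> names C' = insert l (names C)"
    using assms xweak_Ext[of C "XAct l a" C'] xweak_ComSens[of C "XAct l a" C']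
    by (cases s) (auto simp: over_def)
  then show l: "l \<notin> r ` {..<n}" using assms(1) by (simp add: over_def)
  have r: "(r(n := l)) ` {..<n} = r ` {..<n}" by (intro image_cong) auto
  have "(r(n := l)) ` {..<Suc n} = insert l (r ` {..<n})"
    unfolding lessThan_Suc image_insert r by simp
  then show "over (r(n := l)) (Suc n) C'" using * assms(1) by (simp only: over_def simp_thms)
qed

lemma expressible_DiaTau:
  assumes "expressible L r n Q' \<Phi>"
    and "\<And>C C'. over r n C \<Longrightarrow> Q C \<Longrightarrow> xtaus (logic_mode L) C C' \<Longrightarrow> Q' C'"
  shows "expressible L r n Q (\<lambda>C. \<exists>C'. xtaus (logic_mode L) C C' \<and> \<Phi> C')"
proof -
  from assms(1) obtain \<phi> :: "('b, 'x, 'm) form" where \<phi>: "expresses L r n Q' \<Phi> \<phi>"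
    unfolding expressible_def ..
  have "expresses L r n Q (\<lambda>C. \<exists>C'. xtaus (logic_mode L) C C' \<and> \<Phi> C') (DiaTau \<phi>)"
    unfolding expresses_def
  proof (intro conjI allI impI)
    fix C assume C: "over r n C" "Q C"
    show "esat (logic_mode L) (DiaTau \<phi>) r C \<longleftrightarrow> (\<exists>C'. xtaus (logic_mode L) C C' \<and> \<Phi> C')"
      unfolding esat.simps using over_xtaus[OF C(1)] assms(2)[OF C] \<phi> unfolding expresses_def by blast
  qed (use \<phi> in \<open>auto simp: expresses_def intro: formula.intros\<close>)
  then show ?thesis unfolding expressible_def ..
qed

text \<open>The concrete \<open>l\<close> is recorded in the environment while the formula mentions
  only the bound variable \<open>n\<close>. A name already in the history admits no action, which
  gives the constant false.\<close>

lemma expressible_XAct: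
  assumes "l \<notin> r ` {..<n} \<Longrightarrow> expressible L (r(n := l)) (Suc n) Q' \<Phi>"
    and "\<And>C C'. over r n C \<Longrightarrow> Q C \<Longrightarrow> xweak (logic_mode L) C (XAct l a) C' \<Longrightarrow> Q' C'"
  shows "expressible L r n Q (\<lambda>C. \<exists>C'. xweak (logic_mode L) C (XAct l a) C' \<and> \<Phi> C')"
proof (cases "l \<in> r ` {..<n}")
  case True
  show ?thesis
    by (rule expressible_cong[OF expressible_const[of L r n Q False]]) (metis True over_XAct(1))
next
  case False
  then obtain \<phi> :: "('b, 'x, 'm) form" where \<phi>: "expresses L (r(n := l)) (Suc n) Q' \<Phi> \<phi>"
    using assms(1) unfolding expressible_def by blast
  have "expresses L r n Q (\<lambda>C. \<exists>C'. xweak (logic_mode L) C (XAct l a) C' \<and> \<Phi> C') (DiaAct n a \<phi>)"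
    unfolding expresses_def
  proof (intro conjI allI impI)
    fix C assume C: "over r n C" "Q C"
    have "esat (logic_mode L) (DiaAct n a \<phi>) r C \<longleftrightarrow>
        (\<exists>C'. xweak (logic_mode L) C (XAct l a) C' \<and> esat (logic_mode L) \<phi> (r(n := l)) C')"
      using \<phi> False by (intro esat_DiaAct_fresh[OF C(1)]) (simp_all add: expresses_def)
    then show "esat (logic_mode L) (DiaAct n a \<phi>) r C \<longleftrightarrow> (\<exists>C'. xweak (logic_mode L) C (XAct l a) C' \<and> \<Phi> C')"
      using over_XAct(2)[OF C(1)] assms(2)[OF C] \<phi> unfolding expresses_def by blast
  qed (use \<phi> in \<open>auto simp: expresses_def lessThan_Suc intro: formula.intros\<close>)
  then show ?thesis unfolding expressible_def ..
qed

lemma expressible_committed: "expressible Hasco r n Q (\<lambda>C. committed C = S)"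
proof -
  have v: "expressible Hasco r n Q (\<lambda>C. r j \<in> committed C)" if "j < n" for j
  proof -
    have "expresses Hasco r n Q (\<lambda>C. r j \<in> committed C) (HasCo (Vr j) :: ('b, 'x, 'm) form)"
      using that by (auto simp: expresses_def intro: formula.intros)
    then show ?thesis unfolding expressible_def ..
  qed
  have "expressible Hasco r n Q (\<lambda>C. \<forall>j\<in>{..<n}. r j \<in> committed C \<longleftrightarrow> r j \<in> S)"
  proof (rule expressible_countable_Ball)
    fix j assume "j \<in> {..<n}"
    then show "expressible Hasco r n Q (\<lambda>C. r j \<in> committed C \<longleftrightarrow> r j \<in> S)"
      using v[of j] expressible_Not[OF v[of j]] by (cases "r j \<in> S") simp_all
  qed simp
  \<comment> \<open>Comparing the finitely many history names decides equality with \<open>S\<close>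
    only if \<open>S\<close> has no other elements; otherwise this constant conjunct makes the
    formula false.\<close>
  then have "expressible Hasco r n Q (\<lambda>C. S \<subseteq> r ` {..<n} \<and> (\<forall>j\<in>{..<n}. r j \<in> committed C \<longleftrightarrow> r j \<in> S))"
    by (intro expressible_conj expressible_const)
  then show ?thesis
  proof (rule expressible_cong)
    fix C :: "('b, 'c, 'x) conf" assume C: "over r n C"
    have "committed C \<subseteq> names C" using dead_subset_htrn[of "fst (snd C)"] by (cases C) auto
    with C have "committed C \<subseteq> r ` {..<n}" by (simp add: over_def)
    then show "committed C = S \<longleftrightarrow> S \<subseteq> r ` {..<n} \<and> (\<forall>j\<in>{..<n}. r j \<in> committed C \<longleftrightarrow> r j \<in> S)"
      by auto
  qed
qed

section \<open>Translating equality into commit labels\<close>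

lemma expressible_XCo:
  fixes \<Phi> :: "('n, 'i, 'x) conf \<Rightarrow> bool"
  assumes "expressible Canco r n (\<lambda>C. classes C = insert L \<G>) \<Phi>"
  shows "expressible Canco r n (\<lambda>C. classes C = \<G>) (\<lambda>C. \<exists>C'. xweak ComSens C (XCo L) C' \<and> \<Phi> C')"
proof (cases "L \<noteq> {} \<and> L \<subseteq> r ` {..<n}")
  \<comment> \<open>A commit label is a nonempty set of history names, so no other \<open>L\<close>
    is ever met.\<close>
  case False
  show ?thesis
  proof (rule expressible_cong[OF expressible_const[of _ _ _ _ False]])
    fix C :: "('n, 'i, 'x) conf" assume C: "over r n C"
    have "\<not> xweak ComSens C (XCo L) C'" for C' :: "('n, 'i, 'x) conf"
    proof
      assume "xweak ComSens C (XCo L) C'"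
      from xweak_ComSens[OF this] C False show False by (simp add: over_def)
    qed
    then show "(\<exists>C'. xweak ComSens C (XCo L) C' \<and> \<Phi> C') \<longleftrightarrow> False" by blast
  qed
next
  case True
  from assms obtain \<phi> :: "('n, 'x, 'm) form" where
    \<phi>: "expresses Canco r n (\<lambda>C. classes C = insert L \<G>) \<Phi> \<phi>"
    unfolding expressible_def ..
  \<comment> \<open>The label is written with variables only; under \<open>r\<close> they denote
    exactly \<open>L\<close>, whose elements are history names.\<close>
  let ?K = "Vr ` {j \<in> {..<n}. r j \<in> L}"
  have K: "nval r ` ?K = L" "?K \<noteq> {}" using True by (auto simp: image_image image_iff)
  have "expresses Canco r n (\<lambda>C. classes C = \<G>) (\<lambda>C. \<exists>C'. xweak ComSens C (XCo L) C' \<and> \<Phi> C') (DiaCo ?K \<phi>)"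
    unfolding expresses_def
  proof (intro conjI allI impI)
    fix C :: "('n, 'i, 'x) conf" assume C: "over r n C" "classes C = \<G>"
    have "over r n C' \<and> classes C' = insert L \<G>" if "xweak ComSens C (XCo L) C'" for C' :: "('n, 'i, 'x) conf"
      using xweak_ComSens[OF that] C by (simp add: over_def)
    then show "esat (logic_mode Canco) (DiaCo ?K \<phi>) r C \<longleftrightarrow> (\<exists>C'. xweak ComSens C (XCo L) C' \<and> \<Phi> C')"
      unfolding esat.simps K(1) logic_mode.simps
      using \<phi> unfolding expresses_def logic_mode.simps by blast
  next
    show "formula Canco (DiaCo ?K \<phi>)"
      using \<phi> K(2) unfolding expresses_def by (intro formula.intros) simp_all
  qed (use \<phi> K(2) in \<open>auto simp: expresses_def intro: formula.intros\<close>)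
  then show ?thesis unfolding expressible_def ..
qed

lemma expressible_xcos:
  assumes "expressible Canco r n (\<lambda>C. classes C = \<G> \<union> set Ls) \<Phi>"
  shows "expressible Canco r n (\<lambda>C. classes C = \<G>) (\<lambda>C. \<exists>C'. xcos Ls C C' \<and> \<Phi> C')"
  using assms
proof (induction Ls arbitrary: \<G>)
  case Nil
  then have "expressible Canco r n (\<lambda>C. classes C = \<G>) (\<lambda>C. \<exists>C'. xtaus (logic_mode Canco) C C' \<and> \<Phi> C')"
    by (rule expressible_DiaTau) (auto simp: over_def dest: xtaus_ComSens)
  then show ?case by simp
next
  case (Cons L Ls)
  have "expressible Canco r n (\<lambda>C. classes C = insert L \<G>) (\<lambda>C. \<exists>C'. xcos Ls C C' \<and> \<Phi> C')"
    using Cons.prems by (intro Cons.IH) simp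
  then have "expressible Canco r n (\<lambda>C. classes C = \<G>)
      (\<lambda>C. \<exists>C1. xweak ComSens C (XCo L) C1 \<and> (\<exists>C'. xcos Ls C1 C' \<and> \<Phi> C'))"
    by (rule expressible_XCo)
  then show ?case by (rule expressible_cong) (simp only: xcos.simps, blast)
qed

lemma countable_lists_Pow: "countable (lists (Pow (r ` {..<n::nat})))"
  by (intro countable_lists countable_finite) simp

text \<open>
  The committed classes \<open>\<G>\<close> are known at every stage of the translation, since they occur in the
  labels of the formula built so far.
\<close>

lemma Eq_expressible_in_Canco:
  fixes \<phi> :: "('n, 'x, 'm) form"
  assumes "formula Eq \<phi>"
  shows "expressible Canco r n (\<lambda>C :: ('n, 'i, 'x) conf. classes C = \<G>) (\<lambda>C. esat Ext \<phi> e C)"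
  using assms
proof (induction arbitrary: r n \<G> e rule: formula.induct)
  case (1 \<phi>)
  \<comment> \<open>The silent run is split by its list of commit labels; only countably many lists
    are possible over a finite history.\<close>
  have "expressible Canco r n (\<lambda>C :: ('n, 'i, 'x) conf. classes C = \<G>)
      (\<lambda>C. \<exists>Ls \<in> lists (Pow (r ` {..<n})). \<exists>C'. xcos Ls C C' \<and> esat Ext \<phi> e C')"
    by (intro expressible_countable_Bex countable_lists_Pow expressible_xcos 1)
  then show ?case
  proof (rule expressible_cong)
    fix C :: "('n, 'i, 'x) conf" assume "over r n C"
    then have "Ls \<in> lists (Pow (r ` {..<n}))" if "xcos Ls C C'" for Ls C'
      using xcos_classes[OF that] by (auto simp: over_def)
    then show "esat Ext (DiaTau \<phi>) e C \<longleftrightarrow>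
        (\<exists>Ls \<in> lists (Pow (r ` {..<n})). \<exists>C'. xcos Ls C C' \<and> esat Ext \<phi> e C')"
      unfolding esat.simps xtaus_Ext_iff_xcos by blast
  qed
next
  case (2 \<phi> x a)
  \<comment> \<open>Commits before the action, the action, commits after it. The later labels may
    contain \<open>l\<close>, so they range over the extended history.\<close>
  let ?F = "\<lambda>l (C :: ('n, 'i, 'x) conf). \<exists>Ls \<in> lists (Pow (r ` {..<n})). \<exists>C1. xcos Ls C C1 \<and>
    (\<exists>C2. xweak ComSens C1 (XAct l a) C2 \<and> (\<exists>Ls' \<in> lists (Pow ((r(n := l)) ` {..<Suc n})).
      \<exists>C'. xcos Ls' C2 C' \<and> esat Ext \<phi> (e(x := l)) C'))"
  have "expressible Canco r n (\<lambda>C. classes C = \<G>) (?F l)" for l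
  proof (intro expressible_countable_Bex countable_lists_Pow expressible_xcos)
    fix Ls
    have *: "expressible Canco (r(n := l)) (Suc n) (\<lambda>C. classes C = \<G> \<union> set Ls)
        (\<lambda>C :: ('n, 'i, 'x) conf. \<exists>Ls' \<in> lists (Pow ((r(n := l)) ` {..<Suc n})).
          \<exists>C'. xcos Ls' C C' \<and> esat Ext \<phi> (e(x := l)) C')"
      by (intro expressible_countable_Bex countable_lists_Pow expressible_xcos 2)
    have "expressible Canco r n (\<lambda>C. classes C = \<G> \<union> set Ls)
        (\<lambda>C :: ('n, 'i, 'x) conf. \<exists>C2. xweak (logic_mode Canco) C (XAct l a) C2 \<and>
          (\<exists>Ls' \<in> lists (Pow ((r(n := l)) ` {..<Suc n})).
            \<exists>C'. xcos Ls' C2 C' \<and> esat Ext \<phi> (e(x := l)) C'))"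
      by (rule expressible_XAct[OF *]) (auto simp: over_def dest: xweak_ComSens)
    then show "expressible Canco r n (\<lambda>C. classes C = \<G> \<union> set Ls)
        (\<lambda>C :: ('n, 'i, 'x) conf. \<exists>C2. xweak ComSens C (XAct l a) C2 \<and>
          (\<exists>Ls' \<in> lists (Pow ((r(n := l)) ` {..<Suc n})).
            \<exists>C'. xcos Ls' C2 C' \<and> esat Ext \<phi> (e(x := l)) C'))"
      by (simp only: logic_mode.simps)
  qed
  then have "expressible Canco r n (\<lambda>C. classes C = \<G>)
      (\<lambda>C. \<exists>N. finite (- N) \<and> (\<forall>l\<in>N. ?F l C))"
    by (rule expressible_cofinite)
  then show ?case
  proof (rule expressible_cong)
    fix C :: "('n, 'i, 'x) conf" assume C: "over r n C"
    have "(\<exists>C'. xweak Ext C (XAct l a) C' \<and> esat Ext \<phi> (e(x := l)) C') \<longleftrightarrow> ?F l C" for l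
    proof -
      have "Ls \<in> lists (Pow (r ` {..<n})) \<and> Ls' \<in> lists (Pow ((r(n := l)) ` {..<Suc n}))"
        if "xcos Ls C C1" "xweak ComSens C1 (XAct l a) C2" "xcos Ls' C2 C'" for Ls C1 C2 Ls' C'
      proof -
        have C1: "over r n C1" "set Ls \<subseteq> Pow (r ` {..<n})"
          using xcos_classes[OF that(1)] C by (auto simp: over_def)
        have C2: "over (r(n := l)) (Suc n) C2" using over_XAct(2)[OF C1(1) that(2)] .
        then have "set Ls' \<subseteq> Pow ((r(n := l)) ` {..<Suc n})"
          using xcos_classes[OF that(3)] by (simp add: over_def)
        with C1(2) show ?thesis by (simp only: lists_eq_set mem_Collect_eq simp_thms)
      qed
      then show ?thesis unfolding xweak_XAct_Ext_iff by blast
    qed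
    then show "esat Ext (DiaAct x a \<phi>) e C \<longleftrightarrow> (\<exists>N. finite (- N) \<and> (\<forall>l\<in>N. ?F l C))"
      unfolding esat.simps by simp
  qed
next
  case (3 \<phi>)
  then show ?case unfolding esat.simps by (intro expressible_Not)
next
  case (4 M f)
  have "expressible Canco r n (\<lambda>C :: ('n, 'i, 'x) conf. classes C = \<G>) (\<lambda>C. \<forall>i\<in>M. esat Ext (f i) e C)"
    by (rule expressible_Ball[of id]) (use 4 in auto)
  then show ?case by simp
next
  case (6 v w)
  show ?case
  \<comment> \<open>Two names are equal in the sense of the logic iff some set in
    \<open>\<G>\<close> contains both. With \<open>\<G>\<close> and \<open>e\<close> given, this is
    a truth value independent of \<open>C\<close>.\<close>
  proof (rule expressible_cong[OF expressible_const])
    fix C :: "('n, 'i, 'x) conf" assume C: "over r n C" "classes C = \<G>"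
    obtain E H P where EHP: "C = (E, H, P)" by (cases C)
    with C have D: "coherent (E, H, P)" and G: "groups E H = \<G>" by (simp_all add: over_def)
    have htrn: "k \<in> htrn H" if "k \<in> hasco H" for k using that dead_subset_htrn[of H] by blast
    have "k \<in> hasco H \<and> k' \<in> hasco H \<and> (ExT k, ExT k') \<in> E \<longleftrightarrow> (\<exists>L\<in>\<G>. k \<in> L \<and> k' \<in> L)" for k k'
    proof
      assume *: "k \<in> hasco H \<and> k' \<in> hasco H \<and> (ExT k, ExT k') \<in> E"
      then have "(ExT k, ExT k) \<in> E" using coherentD(4)[OF D] htrn by blast
      with * have "k \<in> ext_class E (ExT k)" "k' \<in> ext_class E (ExT k)" by (simp_all add: ext_class_def)
      with * show "\<exists>L\<in>\<G>. k \<in> L \<and> k' \<in> L" unfolding G[symmetric] groups_def by blast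
    next
      assume "\<exists>L\<in>\<G>. k \<in> L \<and> k' \<in> L"
      then obtain l where l: "l \<in> hasco H" "(ExT l, ExT k) \<in> E" "(ExT l, ExT k') \<in> E"
        unfolding G[symmetric] groups_def ext_class_def by blast
      then show "k \<in> hasco H \<and> k' \<in> hasco H \<and> (ExT k, ExT k') \<in> E"
        using coherentD(8)[OF D l(2,1)] coherentD(8)[OF D l(3,1)]
          transD[OF coherentD(3)[OF D] symD[OF coherentD(2)[OF D] l(2)] l(3)] by simp
    qed
    then show "esat Ext (EqCo v w) e C \<longleftrightarrow> (\<exists>L\<in>\<G>. nval e v \<in> L \<and> nval e w \<in> L)"
      by (simp add: EHP)
  qed
qed simp_all

section \<open>Translating commit labels into committed names\<close>

lemma committed_subset:
  assumes "over r n C"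
  shows "committed C \<in> Pow (r ` {..<n})"
proof -
  have "committed C \<subseteq> names C"
    using dead_subset_htrn[of "fst (snd C)"] by (cases C) auto
  with assms show ?thesis by (simp add: over_def)
qed

text \<open>Lets a formula remember the present committed set \<open>S\<close> and compare with it
  after a transition: finitely many sets are possible, and each is treated by its own
  disjunct.\<close>

lemma expressible_committed_cases:
  assumes "\<And>S. S \<subseteq> r ` {..<n} \<Longrightarrow> expressible Hasco r n Q (\<Phi> S)"
  shows "expressible Hasco r n Q (\<lambda>C. \<Phi> (committed C) C)"
proof -
  have "expressible Hasco r n Q (\<lambda>C. \<exists>S\<in>Pow (r ` {..<n}). committed C = S \<and> \<Phi> S C)"
    using assms
    by (intro expressible_countable_Bex expressible_conj expressible_committed) (auto intro: countable_finite)
  then show ?thesis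
    by (rule expressible_cong) (auto dest: committed_subset)
qed

text \<open>Commit-sensitive silent runs and actions are the extended ones that preserve the
  committed set, and commit labels are handled by \<open>xweak_XCo_iff\<close>.\<close>

lemma Canco_expressible_in_Hasco:
  fixes \<phi> :: "('n, 'x, 'm) form"
  assumes "formula Canco \<phi>"
  shows "expressible Hasco r n (\<lambda>C :: ('n, 'i, 'x) conf. True) (\<lambda>C. esat ComSens \<phi> e C)"
  using assms
proof (induction arbitrary: r n e rule: formula.induct)
  case (1 \<phi>)
  have "expressible Hasco r n (\<lambda>C :: ('n, 'i, 'x) conf. True)
      (\<lambda>C. \<exists>C'. xtaus (logic_mode Hasco) C C' \<and> (committed C' = S \<and> esat ComSens \<phi> e C'))" for S
    by (rule expressible_DiaTau[OF expressible_conj[OF expressible_committed 1(2)]]) simp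
  from expressible_committed_cases[OF this] show ?case
    by (rule expressible_cong) (auto simp: over_def xtaus_ComSens_iff)
next
  case (2 \<phi> x a)
  have "expressible Hasco r n (\<lambda>C :: ('n, 'i, 'x) conf. True)
      (\<lambda>C. \<exists>C'. xweak (logic_mode Hasco) C (XAct l a) C' \<and>
        (committed C' = S \<and> esat ComSens \<phi> (e(x := l)) C'))" for S l
    by (rule expressible_XAct[OF expressible_conj[OF expressible_committed 2(2)]]) simp
  from expressible_cofinite[OF expressible_committed_cases[OF this]] show ?case
    by (rule expressible_cong) (simp add: over_def xweak_XAct_ComSens_iff conj_assoc)
next
  case (3 \<phi>)
  then show ?case unfolding esat.simps by (intro expressible_Not)
next
  case (4 M f)
  have "expressible Hasco r n (\<lambda>C :: ('n, 'i, 'x) conf. True) (\<lambda>C. \<forall>i\<in>M. esat ComSens (f i) e C)"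
    by (rule expressible_Ball[of id]) (use 4 in auto)
  then show ?case by simp
next
  case (7 K \<phi>)
  define L where "L = nval e ` K"
  have L: "L \<noteq> {}" using 7 by (simp add: L_def)
  define partial where "partial S C \<longleftrightarrow> S \<subset> committed C \<and> committed C \<subset> S \<union> L"
    for S and C :: "('n, 'i, 'x) conf"
  \<comment> \<open>The right-hand side of \<open>xweak_XCo_iff\<close> with \<open>S\<close> for
    the committed set at the start, so that only extended modalities and tests on committed sets
    remain.\<close>
  let ?F = "\<lambda>S (C :: ('n, 'i, 'x) conf). L \<inter> S = {} \<and>
    (\<exists>C1. xtaus (logic_mode Hasco) C C1 \<and> committed C1 = S \<and>
      \<not> (\<exists>C2. xtaus (logic_mode Hasco) C1 C2 \<and> partial S C2) \<and>
      (\<exists>C'. xtaus (logic_mode Hasco) C1 C' \<and> committed C' = S \<union> L \<and> esat ComSens \<phi> e C'))"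
  have "expressible Hasco r n (\<lambda>C. True) (partial S)" for S
    unfolding partial_def
    by (rule expressible_committed_cases[of r n _ "\<lambda>T C. S \<subset> T \<and> T \<subset> S \<union> L"]) (rule expressible_const)
  then have "expressible Hasco r n (\<lambda>C. True) (?F S)" for S
    by (intro expressible_conj expressible_const expressible_Not expressible_committed
        expressible_DiaTau[where Q' = "\<lambda>C. True"] 7 TrueI)
  from expressible_committed_cases[OF this] show ?case
  proof (rule expressible_cong)
    fix C :: "('n, 'i, 'x) conf" assume "over r n C"
    then have "coherent C" by (simp add: over_def)
    define whole where "whole C1 \<longleftrightarrow> \<not> (\<exists>C2. xtaus Ext C1 C2 \<and> partial (committed C) C2)" for C1
    have "xweak ComSens C (XCo L) C' \<longleftrightarrow> L \<inter> committed C = {} \<and> (\<exists>C1. xtaus Ext C C1 \<and>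
        committed C1 = committed C \<and> whole C1 \<and> xtaus Ext C1 C' \<and> committed C' = committed C \<union> L)" for C'
      unfolding whole_def partial_def by (rule xweak_XCo_iff[OF \<open>coherent C\<close> L])
    then show "esat ComSens (DiaCo K \<phi>) e C \<longleftrightarrow> ?F (committed C) C"
      unfolding esat.simps L_def[symmetric] logic_mode.simps whole_def[symmetric] by blast
  qed
qed simp_all

end

section \<open>Translating committed names into equality, and the three comparisons\<close>

primrec eq_form :: "('n, 'x, 'm) form \<Rightarrow> ('n, 'x, 'm) form" where
  "eq_form (DiaTau \<phi>) = DiaTau (eq_form \<phi>)"
| "eq_form (DiaAct x a \<phi>) = DiaAct x a (eq_form \<phi>)"
| "eq_form (Neg \<phi>) = Neg (eq_form \<phi>)"
| "eq_form (Conj M f) = Conj M (\<lambda>i. eq_form (f i))"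
| "eq_form (HasCo v) = EqCo v v"
| "eq_form (EqCo v w) = EqCo v w"
| "eq_form (DiaCo K \<phi>) = DiaCo K (eq_form \<phi>)"

lemma fvars_eq_form: "fvars (eq_form \<phi>) = fvars \<phi>"
  by (induction \<phi>) auto

lemma formula_eq_form: "formula Hasco \<phi> \<Longrightarrow> formula Eq (eq_form \<phi>)"
  by (induction rule: formula.induct) (auto intro: formula.intros)

text \<open>A committed name occurs in the history and is thus related to itself, so being committed
  is the same as being equal to itself. Literals and binders stay as they are.\<close>

lemma esat_eq_form:
  fixes C :: "('n, 'i, 'x) conf"
  shows "coherent C \<Longrightarrow> esat s (eq_form \<phi>) e C \<longleftrightarrow> esat s \<phi> e C"
proof (induction \<phi> arbitrary: e C)
  case (DiaTau \<phi>)
  have "esat s (eq_form \<phi>) e C' \<longleftrightarrow> esat s \<phi> e C'" if "xtaus s C C'" for C' :: "('n, 'i, 'x) conf"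
    using DiaTau.IH coherent_xweak[of s C XTau C'] that DiaTau.prems by (simp add: xweak_def)
  then show ?case by (simp cong: conj_cong)
next
  case (DiaAct x a \<phi>)
  have "esat s (eq_form \<phi>) e C' \<longleftrightarrow> esat s \<phi> e C'" if "xweak s C (XAct l a) C'" for e l and C' :: "('n, 'i, 'x) conf"
    by (rule DiaAct.IH) (rule coherent_xweak[OF that DiaAct.prems])
  then show ?case by (simp cong: conj_cong)
next
  case (DiaCo K \<phi>)
  have "esat s (eq_form \<phi>) e C' \<longleftrightarrow> esat s \<phi> e C'" if "xweak s C \<zeta> C'" for \<zeta> and C' :: "('n, 'i, 'x) conf"
    by (rule DiaCo.IH) (rule coherent_xweak[OF that DiaCo.prems])
  then show ?case by (simp cong: conj_cong)
next
  case (HasCo v)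
  obtain E H P where C: "C = (E, H, P)" by (cases C)
  with HasCo have "coherent (E, H, P)" by simp
  from coherentD(4)[OF this] have "(ExT k, ExT k) \<in> E" if "k \<in> hasco H" for k
    using that dead_subset_htrn[of H] by blast
  then show ?case by (auto simp: C)
qed simp_all

lemma closed_esat:
  assumes "fvars \<phi> = {}"
  shows "snd (logic_of L) P \<phi> \<longleftrightarrow> esat (logic_mode L) \<phi> e (init_conf P)"
  unfolding logic_of_def using sat_iff_esat[OF assms] by simp

text \<open>An initial configuration has no history names and no committed classes. With
  \<open>n = 0\<close> the expressing formula has no free variables, so it is closed and the choice
  of environment is immaterial.\<close>

lemma (in large_index) exp_leI:
  assumes "\<And>(\<phi> :: ('n, 'x, 'm) form) e. formula L1 \<phi> \<Longrightarrow> expressible L2 (\<lambda>_. undefined) 0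
      (\<lambda>C :: ('n, 'i, 'x) conf. classes C = {}) (\<lambda>C. esat (logic_mode L1) \<phi> e C)"
  shows "(logic_of L1 :: ('n, 'i, 'x, 'm) logic) \<preceq>\<^sub>e\<^sub>x\<^sub>p logic_of L2"
  unfolding exp_le_def
proof
  fix \<phi> :: "('n, 'x, 'm) form"
  assume "\<phi> \<in> fst (logic_of L1 :: ('n, 'i, 'x, 'm) logic)"
  then have \<phi>: "formula L1 \<phi>" "fvars \<phi> = {}" by (simp_all add: logic_of_def)
  let ?e = "\<lambda>_. undefined :: 'x"
  from assms[OF \<phi>(1)] obtain \<phi>' :: "('n, 'x, 'm) form" where \<phi>': "expresses L2 ?e 0
      (\<lambda>C :: ('n, 'i, 'x) conf. classes C = {}) (\<lambda>C. esat (logic_mode L1) \<phi> ?e C) \<phi>'"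
    unfolding expressible_def by blast
  then have closed: "formula L2 \<phi>'" "fvars \<phi>' = {}" by (simp_all add: expresses_def)
  have "snd (logic_of L1) P \<phi> \<longleftrightarrow> snd (logic_of L2) P \<phi>'"
    if P: "ext_conf (init_conf P)" for P :: "('n, ('i, 'x) trn) tm"
  proof -
    have "over ?e 0 (init_conf P)" "classes (init_conf P) = {}"
      using coherent_init[OF P] by (simp_all add: over_def init_conf_def htrn_def groups_def hasco_def)
    with \<phi>' have "esat (logic_mode L2) \<phi>' ?e (init_conf P) \<longleftrightarrow> esat (logic_mode L1) \<phi> ?e (init_conf P)"
      unfolding expresses_def by blast
    then show ?thesis unfolding closed_esat[OF \<phi>(2), of _ _ ?e] closed_esat[OF closed(2), of _ _ ?e] by (rule HOL.sym)
  qed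
  then show "\<exists>\<phi>' \<in> fst (logic_of L2 :: ('n, 'i, 'x, 'm) logic). \<forall>P :: ('n, ('i, 'x) trn) tm. ext_conf (init_conf P) \<longrightarrow>
      (snd (logic_of L1) P \<phi> \<longleftrightarrow> snd (logic_of L2) P \<phi>')"
    using closed by (intro bexI[of _ \<phi>']) (simp_all add: logic_of_def)
qed

theorem theorem6p9:
  assumes "\<exists>index :: 'x \<Rightarrow> 'm. inj index"
  shows "(L_Eq :: ('n::infinite, 'i::infinite, 'x::infinite, 'm) logic) \<preceq>\<^sub>e\<^sub>x\<^sub>p L_Canco
    \<and> (L_Canco :: ('n, 'i, 'x, 'm) logic) \<preceq>\<^sub>e\<^sub>x\<^sub>p L_Hasco
    \<and> (L_Hasco :: ('n, 'i, 'x, 'm) logic) \<preceq>\<^sub>e\<^sub>x\<^sub>p L_Eq"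
proof (intro conjI)
  from assms obtain index :: "'x \<Rightarrow> 'm" where "inj index" ..
  then interpret large_index index by unfold_locales
  show "(L_Eq :: ('n, 'i, 'x, 'm) logic) \<preceq>\<^sub>e\<^sub>x\<^sub>p L_Canco"
    by (rule exp_leI) (simp only: logic_mode.simps Eq_expressible_in_Canco)
  show "(L_Canco :: ('n, 'i, 'x, 'm) logic) \<preceq>\<^sub>e\<^sub>x\<^sub>p L_Hasco"
  proof (rule exp_leI)
    fix \<phi> :: "('n, 'x, 'm) form" and e assume "formula Canco \<phi>"
    \<comment> \<open>This translation is correct on all configurations over \<open>r\<close>, in
      particular on those without committed classes.\<close>
    from Canco_expressible_in_Hasco[OF this]
    show "expressible Hasco (\<lambda>_. undefined) 0 (\<lambda>C :: ('n, 'i, 'x) conf. classes C = {})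
        (\<lambda>C. esat (logic_mode Canco) \<phi> e C)"
      unfolding expressible_def expresses_def by (simp only: logic_mode.simps) blast
  qed
  show "(L_Hasco :: ('n, 'i, 'x, 'm) logic) \<preceq>\<^sub>e\<^sub>x\<^sub>p L_Eq"
    unfolding exp_le_def
  proof
    fix \<phi> :: "('n, 'x, 'm) form"
    assume "\<phi> \<in> fst (L_Hasco :: ('n, 'i, 'x, 'm) logic)"
    then have \<phi>: "formula Hasco \<phi>" "fvars \<phi> = {}" by (simp_all add: logic_of_def)
    have "snd L_Hasco P \<phi> \<longleftrightarrow> snd L_Eq P (eq_form \<phi>)"
      if "ext_conf (init_conf P)" for P :: "('n, ('i, 'x) trn) tm"
    proof -
      have "fvars (eq_form \<phi>) = {}" using \<phi>(2) by (simp only: fvars_eq_form)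
      then show ?thesis
        using esat_eq_form[OF coherent_init[OF that], of Ext \<phi> "\<lambda>_. undefined"]
        by (simp only: closed_esat[OF \<phi>(2), of _ _ "\<lambda>_. undefined"]
            closed_esat[of "eq_form \<phi>" _ _ "\<lambda>_. undefined"] logic_mode.simps)
    qed
    then show "\<exists>\<phi>' \<in> fst (L_Eq :: ('n, 'i, 'x, 'm) logic). \<forall>P :: ('n, ('i, 'x) trn) tm. ext_conf (init_conf P) \<longrightarrow>
        (snd L_Hasco P \<phi> \<longleftrightarrow> snd L_Eq P \<phi>')"
      using formula_eq_form[OF \<phi>(1)] \<phi>(2)
      by (intro bexI[of _ "eq_form \<phi>"]) (simp_all add: logic_of_def fvars_eq_form)
  qed
qed

end
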